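(* Let $(\mathcal A,(\mathcal A_t)_{t\ge 0},\mathbb E_{\mathcal A})$, $(\mathcal B,(\mathcal B_t)_{t\ge 0},\mathbb E_{\mathcal B})$, $(\mathcal C,(\mathcal C_t)_{t\ge 0},\mathbb E_{\mathcal C})$ be filtered $\mathrm W^*$-probability spaces. Suppose $X:\mathbb R_+\to L^2(\mathbb E_{\mathcal A})$ and $Y:\mathbb R_+\to L^2(\mathbb E_{\mathcal B})$ are $L^2$-decomposable processes and $\Lambda:\mathbb R_+\to B_2(L^2(\mathbb E_{\mathcal A})\times L^2(\mathbb E_{\mathcal B});L^1(\mathbb E_{\mathcal C}))$ is adapted and continuous. Assume in addition that (i) if $t\ge 0$, then $\Lambda(t)[\mathcal A,\mathcal B]\subseteq\mathcal C$ and $$\sup\Big\{\|\Lambda(t)[x,y]\|_r: 1\le p,q,r\le\infty,\ \tfrac1p+\tfrac1q=\tfrac1r,\ x\in\mathcal A,\ \|x\|_p\le1,\ y\in\mathcal B,\ \|y\|_q\le1\Big\}<\infty;$$ (ii) the martingale parts of $X$ and $Y$ are locally uniformly $L^2$-approximable by $L^\infty$-continuous martingales. If $t\ge 0$, then the limit $$\int_0^t\Lambda(s)[dX(s),dY(s)]:=L^1\text{-}\lim_{|\Pi|\to0}\ \sum_{s\in\Pi}\Lambda(s_-)[X(s)-X(s_-),\,Y(s)-Y(s_-)]\in L^1(\mathcal C_t,\mathbb E_{\mathcal C})$$ over partitions $\Pi$ of $[0,t]$ exists. Moreover, the process $t\mapsto\int_0^t\Lambda(s)[dX(s),dY(s)]$,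 $\mathbb R_+\to L^1(\mathbb E_{\mathcal C})$, is $L^1$-continuous and $L^1$-FV, and for all $t\ge0$ $$\int_0^t\Lambda(s)[dX(s),dY(s)]=\int_0^t\Lambda(s)[dM(s),dN(s)],$$ where $M$ (resp. $N$) is the martingale part of $X$ (resp. $Y$).
   Context: A $\mathrm W^*$-probability space $(\mathcal A,\mathbb E)$ is a von Neumann algebra $\mathcal A$ with a faithful normal tracial state $\mathbb E$. For $p\in[1,\infty)$, $\|a\|_p=\mathbb E[|a|^p]^{1/p}$, and $L^p(\mathcal A,\mathbb E)=L^p(\mathbb E)$ is the $\|\cdot\|_p$-completion of $\mathcal A$; $L^\infty(\mathbb E)=\mathcal A$ with the operator norm $\|\cdot\|_\infty$. A filtration is an increasing family $(\mathcal A_t)_{t\ge0}$ of $\mathrm W^*$-subalgebras (unital, $\sigma$-weakly closed $*$-subalgebras). For a $\mathrm W^*$-subalgebra $\mathcal N$, $\mathbb E[\,\cdot\mid\mathcal N]:L^1(\mathcal A,\mathbb E)\to L^1(\mathcal N,\mathbb E)$ is the trace-preserving conditional expectation. Linear/bilinear maps are over $\mathbb R$; $B_2(U\times V;W)$ is the space of bounded real-bilinear maps $U\times V\to W$ with the operator norm. A process $X:\mathbb R_+\to L^p(\mathcal A,\mathbb E)$ is adapted if $X(t)\in L^p(\mathcal A_t,\mathbb E)$ for all $t$; an $L^p$-martingale if it is adapted and $\mathbb E[X(t)\mid\mathcal A_s]=X(s)$ for $0\le s\le t$; $L^p$-FV if it is adapted and has locally bounded variation with respect to $\|\cdot\|_p$.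 An $L^p$-decomposable process is an adapted process $X:\mathbb R_+\to L^p(\mathbb E)$ of the form $X=X(0)+M+A$ with $M$ an $L^p$-continuous $L^p$-martingale, $A$ an $L^p$-continuous $L^p$-FV process, and $M(0)=A(0)=0$; for $p\ge2$ this decomposition is unique and $M$ is called the martingale part of $X$. An $L^2$-continuous $L^2$-martingale $M:\mathbb R_+\to L^2(\mathbb E)$ is locally uniformly $L^2$-approximable by $L^\infty$-continuous martingales if there is a sequence of operator-norm-continuous martingales $M_n:\mathbb R_+\to\mathcal A$ with $\sup_{0\le s\le t}\|M_n(s)-M(s)\|_2\to0$ for all $t\ge0$. A map $\Lambda:\mathbb R_+\to B_2(L^2(\mathbb E_{\mathcal A})\times L^2(\mathbb E_{\mathcal B});L^1(\mathbb E_{\mathcal C}))$ is adapted if for all $u\ge t\ge0$ and $(x,y)\in L^2(\mathbb E_{\mathcal A})\times L^2(\mathbb E_{\mathcal B})$: if $x\in L^2(\mathcal A_u,\mathbb E_{\mathcal A})$, then $\mathbb E_{\mathcal C}[\Lambda(t)[x,y]\mid\mathcal C_u]=\Lambda(t)[x,\mathbb E_{\mathcal B}[y\mid\mathcal B_u]]$; and if $y\in L^2(\mathcal B_u,\mathbb E_{\mathcal B})$, then $\mathbb E_{\mathcal C}[\Lambda(t)[x,y]\mid\mathcal C_u]=\Lambda(t)[\mathbb E_{\mathcal A}[x\mid\mathcal A_u],y]$. A partition of $[0,t]$ is a finite set $\Pi=\{0=t_0<\cdots<t_n=t\}$; $s_-$ is the member of $\Pi$ immediately to the left of $s\in\Pi$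 ($0_-:=0$), and $|\Pi|=\max_{s\in\Pi}(s-s_-)$. *)

theory Defs
  imports "HOL-Analysis.Analysis" "HOL-Computational_Algebra.Polynomial"
begin

section \<open>Complex Hilbert spaces and their bounded operators\<close>

text \<open>The inner product is linear in its first argument.\<close>

class chilbert_space = banach +
  fixes scaleC :: "complex \<Rightarrow> 'a \<Rightarrow> 'a"  (infixr "*\<^sub>C" 75)
    and cinner :: "'a \<Rightarrow> 'a \<Rightarrow> complex"
  assumes scaleC_add_right: "c *\<^sub>C (x + y) = c *\<^sub>C x + c *\<^sub>C y"
    and scaleC_add_left: "(c + d) *\<^sub>C x = c *\<^sub>C x + d *\<^sub>C x"
    and scaleC_scaleC: "c *\<^sub>C (d *\<^sub>C x) = (c * d) *\<^sub>C x"
    and scaleC_of_real: "complex_of_real r *\<^sub>C x = r *\<^sub>R x"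
    and cinner_commute: "cinner x y = cnj (cinner y x)"
    and cinner_add_left: "cinner (x + y) z = cinner x z + cinner y z"
    and cinner_scaleC_left: "cinner (c *\<^sub>C x) y = c * cinner x y"
    and cinner_self: "cinner x x = complex_of_real ((norm x)\<^sup>2)"

text \<open>The type of bounded real-linear operators from the library carries the operator norm;
  \<open>clinear_ops\<close> is the set B(H) of those that are complex-linear.\<close>

definition clinear_ops :: "('h::chilbert_space \<Rightarrow>\<^sub>L 'h) set" where
  "clinear_ops = {a. \<forall>c x. blinfun_apply a (c *\<^sub>C x) = c *\<^sub>C blinfun_apply a x}"

definition op_scaleC :: "complex \<Rightarrow> ('h::chilbert_space \<Rightarrow>\<^sub>L 'h) \<Rightarrow> ('h \<Rightarrow>\<^sub>L 'h)" where
  "op_scaleC c a = Blinfun (\<lambda>x. c *\<^sub>C blinfun_apply a x)"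

definition op_adj :: "('h::chilbert_space \<Rightarrow>\<^sub>L 'h) \<Rightarrow> ('h \<Rightarrow>\<^sub>L 'h)" where
  "op_adj a = (THE b. \<forall>x y. cinner (blinfun_apply b x) y = cinner x (blinfun_apply a y))"

text \<open>The \<open>\<sigma>\<close>-weak topology on B(H): the initial topology of the functionals
  a \<open>\<mapsto>\<close> \<open>\<Sum>\<close>\<open>\<langle>\<close>a x(n), y(n)\<open>\<rangle>\<close> with x, y square-summable.\<close>

definition sigma_weak :: "('h::chilbert_space \<Rightarrow>\<^sub>L 'h) topology" where
  "sigma_weak = subtopology
     (topology_generated_by
       {{a. (\<Sum>n. cinner (blinfun_apply a (x n)) (y n)) \<in> U} | (x::nat \<Rightarrow> 'h) (y::nat \<Rightarrow> 'h) U.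
          summable (\<lambda>n. (norm (x n))\<^sup>2) \<and> summable (\<lambda>n. (norm (y n))\<^sup>2) \<and> open U})
     clinear_ops"

definition von_neumann_algebra :: "('h::chilbert_space \<Rightarrow>\<^sub>L 'h) set \<Rightarrow> bool" where
  "von_neumann_algebra A \<longleftrightarrow>
     A \<subseteq> clinear_ops \<and> id_blinfun \<in> A \<and>
     (\<forall>a\<in>A. \<forall>b\<in>A. a + b \<in> A \<and> a o\<^sub>L b \<in> A) \<and>
     (\<forall>c. \<forall>a\<in>A. op_scaleC c a \<in> A) \<and>
     (\<forall>a\<in>A. op_adj a \<in> A) \<and>
     closedin sigma_weak A"

definition faithful_normal_tracial_state ::
    "('h::chilbert_space \<Rightarrow>\<^sub>L 'h) set \<Rightarrow> (('h \<Rightarrow>\<^sub>L 'h) \<Rightarrow> complex) \<Rightarrow> bool" where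
  "faithful_normal_tracial_state A E \<longleftrightarrow>
     (\<forall>a\<in>A. \<forall>b\<in>A. E (a + b) = E a + E b) \<and>
     (\<forall>c. \<forall>a\<in>A. E (op_scaleC c a) = c * E a) \<and>
     E id_blinfun = 1 \<and>
     (\<forall>a\<in>A. Im (E (op_adj a o\<^sub>L a)) = 0 \<and> 0 \<le> Re (E (op_adj a o\<^sub>L a))) \<and>
     (\<forall>a\<in>A. E (op_adj a o\<^sub>L a) = 0 \<longrightarrow> a = 0) \<and>
     continuous_map (subtopology sigma_weak A) euclidean E \<and>
     (\<forall>a\<in>A. \<forall>b\<in>A. E (a o\<^sub>L b) = E (b o\<^sub>L a))"

definition wstar_prob_space ::
    "('h::chilbert_space \<Rightarrow>\<^sub>L 'h) set \<Rightarrow> (('h \<Rightarrow>\<^sub>L 'h) \<Rightarrow> complex) \<Rightarrow> bool" where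
  "wstar_prob_space A E \<longleftrightarrow> von_neumann_algebra A \<and> faithful_normal_tracial_state A E"

definition filtration ::
    "('h::chilbert_space \<Rightarrow>\<^sub>L 'h) set \<Rightarrow> (real \<Rightarrow> ('h \<Rightarrow>\<^sub>L 'h) set) \<Rightarrow> bool" where
  "filtration A F \<longleftrightarrow>
     (\<forall>t\<ge>0. von_neumann_algebra (F t) \<and> F t \<subseteq> A) \<and>
     (\<forall>s t. 0 \<le> s \<and> s \<le> t \<longrightarrow> F s \<subseteq> F t)"

definition filtered_wstar_prob_space ::
    "('h::chilbert_space \<Rightarrow>\<^sub>L 'h) set \<Rightarrow> (real \<Rightarrow> ('h \<Rightarrow>\<^sub>L 'h) set) \<Rightarrow>
     (('h \<Rightarrow>\<^sub>L 'h) \<Rightarrow> complex) \<Rightarrow> bool" where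
  "filtered_wstar_prob_space A F E \<longleftrightarrow> wstar_prob_space A E \<and> filtration A F"


section \<open>Noncommutative Lp-norms\<close>

definition op_pow :: "('h::real_normed_vector \<Rightarrow>\<^sub>L 'h) \<Rightarrow> nat \<Rightarrow> ('h \<Rightarrow>\<^sub>L 'h)" where
  "op_pow a n = (((o\<^sub>L) a) ^^ n) id_blinfun"

definition poly_op :: "real poly \<Rightarrow> ('h::real_normed_vector \<Rightarrow>\<^sub>L 'h) \<Rightarrow> ('h \<Rightarrow>\<^sub>L 'h)" where
  "poly_op q a = (\<Sum>i\<le>degree q. coeff q i *\<^sub>R op_pow a i)"

text \<open>Continuous functional calculus f(b) for a positive operator b, whose spectrum lies in
  the interval from 0 to \<open>\<parallel>b\<parallel>\<close>: the norm limit of q(n)(b) for any real polynomials q(n)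
  converging to f uniformly on that interval.\<close>

definition pos_fun_calc :: "(real \<Rightarrow> real) \<Rightarrow> ('h::real_normed_vector \<Rightarrow>\<^sub>L 'h) \<Rightarrow> ('h \<Rightarrow>\<^sub>L 'h)" where
  "pos_fun_calc f b = (THE c. \<forall>q :: nat \<Rightarrow> real poly.
     uniform_limit {0..norm b} (\<lambda>n. poly (q n)) f sequentially \<longrightarrow>
     (\<lambda>n. poly_op (q n) b) \<longlonglongrightarrow> c)"

definition op_abs :: "('h::chilbert_space \<Rightarrow>\<^sub>L 'h) \<Rightarrow> ('h \<Rightarrow>\<^sub>L 'h)" where
  "op_abs a = pos_fun_calc sqrt (op_adj a o\<^sub>L a)"

definition nc_norm ::
    "(('h::chilbert_space \<Rightarrow>\<^sub>L 'h) \<Rightarrow> complex) \<Rightarrow> ennreal \<Rightarrow> ('h \<Rightarrow>\<^sub>L 'h) \<Rightarrow> real" where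
  "nc_norm E p a =
     (if p = \<infinity> then norm a
      else Re (E (pos_fun_calc (\<lambda>x. x powr enn2real p) (op_abs a))) powr (1 / enn2real p))"


section \<open>Noncommutative Lp-spaces\<close>

text \<open>For finite p, Lp(A,E) is represented by a Banach space type together with a map \<open>\<iota>\<close>
  exhibiting it as a completion of A for the p-norm. The completion, and with it everything
  below, is determined up to isometric isomorphism by this property. Values of \<open>\<iota>\<close> outside A
  are irrelevant.\<close>

definition Lp_completion ::
    "('h::chilbert_space \<Rightarrow>\<^sub>L 'h) set \<Rightarrow> (('h \<Rightarrow>\<^sub>L 'h) \<Rightarrow> complex) \<Rightarrow> ennreal \<Rightarrow>
     (('h \<Rightarrow>\<^sub>L 'h) \<Rightarrow> 'v::banach) \<Rightarrow> bool" where
  "Lp_completion A E p \<iota> \<longleftrightarrow>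
     (\<forall>a\<in>A. \<forall>b\<in>A. \<iota> (a + b) = \<iota> a + \<iota> b) \<and>
     (\<forall>r. \<forall>a\<in>A. \<iota> (r *\<^sub>R a) = r *\<^sub>R \<iota> a) \<and>
     (\<forall>a\<in>A. norm (\<iota> a) = nc_norm E p a) \<and>
     closure (\<iota> ` A) = UNIV"

text \<open>Lp(N,E) for a W*-subalgebra N, as a closed subspace of Lp(A,E).\<close>

definition Lp_sub :: "(('h::chilbert_space \<Rightarrow>\<^sub>L 'h) \<Rightarrow> 'v::banach) \<Rightarrow> ('h \<Rightarrow>\<^sub>L 'h) set \<Rightarrow> 'v set" where
  "Lp_sub \<iota> N = closure (\<iota> ` N)"

text \<open>E[x b] for x in Lp(A,E) and b in A: the continuous extension of a \<open>\<mapsto>\<close> E[a b].\<close>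

definition trace_mult ::
    "('h::chilbert_space \<Rightarrow>\<^sub>L 'h) set \<Rightarrow> (('h \<Rightarrow>\<^sub>L 'h) \<Rightarrow> complex) \<Rightarrow>
     (('h \<Rightarrow>\<^sub>L 'h) \<Rightarrow> 'v::banach) \<Rightarrow> 'v \<Rightarrow> ('h \<Rightarrow>\<^sub>L 'h) \<Rightarrow> complex" where
  "trace_mult A E \<iota> x b = (THE z. \<forall>a :: nat \<Rightarrow> 'h \<Rightarrow>\<^sub>L 'h.
     (\<forall>n. a n \<in> A) \<and> (\<lambda>n. \<iota> (a n)) \<longlonglongrightarrow> x \<longrightarrow> (\<lambda>n. E (a n o\<^sub>L b)) \<longlonglongrightarrow> z)"

text \<open>The trace-preserving conditional expectation onto a W*-subalgebra N: the unique y in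
  Lp(N,E) with E[y b] = E[x b] for all b in N. For p = 1 it is the conditional
  expectation from L1(A,E) to L1(N,E); for p > 1 it is the restriction of that map to
  Lp(A,E), which takes values in Lp(N,E).\<close>

definition cond_exp ::
    "('h::chilbert_space \<Rightarrow>\<^sub>L 'h) set \<Rightarrow> (('h \<Rightarrow>\<^sub>L 'h) \<Rightarrow> complex) \<Rightarrow>
     (('h \<Rightarrow>\<^sub>L 'h) \<Rightarrow> 'v::banach) \<Rightarrow> ('h \<Rightarrow>\<^sub>L 'h) set \<Rightarrow> 'v \<Rightarrow> 'v" where
  "cond_exp A E \<iota> N x = (THE y. y \<in> Lp_sub \<iota> N \<and>
     (\<forall>b\<in>N. trace_mult A E \<iota> y b = trace_mult A E \<iota> x b))"


section \<open>Partitions\<close>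

definition is_partition :: "real \<Rightarrow> real set \<Rightarrow> bool" where
  "is_partition t P \<longleftrightarrow> finite P \<and> 0 \<in> P \<and> t \<in> P \<and> P \<subseteq> {0..t}"

definition left_nb :: "real set \<Rightarrow> real \<Rightarrow> real" where
  "left_nb P s = (if s = 0 then 0 else Max {u\<in>P. u < s})"

definition mesh :: "real set \<Rightarrow> real" where
  "mesh P = Max ((\<lambda>s. s - left_nb P s) ` P)"

text \<open>The filter of partitions of [0,t] with mesh tending to 0.\<close>

definition mesh_filter :: "real \<Rightarrow> real set filter" where
  "mesh_filter t = (INF d\<in>{0<..}. principal {P. is_partition t P \<and> mesh P < d})"


section \<open>Processes\<close>

text \<open>Processes are functions on the reals of which only the values at nonnegative times matter.\<close>

definition adapted ::
    "(real \<Rightarrow> ('h::chilbert_space \<Rightarrow>\<^sub>L 'h) set) \<Rightarrow> (('h \<Rightarrow>\<^sub>L 'h) \<Rightarrow> 'v::banach) \<Rightarrow>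
     (real \<Rightarrow> 'v) \<Rightarrow> bool" where
  "adapted F \<iota> X \<longleftrightarrow> (\<forall>t\<ge>0. X t \<in> Lp_sub \<iota> (F t))"

definition Lp_martingale ::
    "('h::chilbert_space \<Rightarrow>\<^sub>L 'h) set \<Rightarrow> (real \<Rightarrow> ('h \<Rightarrow>\<^sub>L 'h) set) \<Rightarrow>
     (('h \<Rightarrow>\<^sub>L 'h) \<Rightarrow> complex) \<Rightarrow> (('h \<Rightarrow>\<^sub>L 'h) \<Rightarrow> 'v::banach) \<Rightarrow> (real \<Rightarrow> 'v) \<Rightarrow> bool" where
  "Lp_martingale A F E \<iota> X \<longleftrightarrow> adapted F \<iota> X \<and>
     (\<forall>s t. 0 \<le> s \<and> s \<le> t \<longrightarrow> cond_exp A E \<iota> (F s) (X t) = X s)"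

definition locally_bv :: "(real \<Rightarrow> 'v::real_normed_vector) \<Rightarrow> bool" where
  "locally_bv X \<longleftrightarrow>
     (\<forall>t\<ge>0. bdd_above {\<Sum>s\<in>P. norm (X s - X (left_nb P s)) | P. is_partition t P})"

definition Lp_FV ::
    "(real \<Rightarrow> ('h::chilbert_space \<Rightarrow>\<^sub>L 'h) set) \<Rightarrow> (('h \<Rightarrow>\<^sub>L 'h) \<Rightarrow> 'v::banach) \<Rightarrow>
     (real \<Rightarrow> 'v) \<Rightarrow> bool" where
  "Lp_FV F \<iota> X \<longleftrightarrow> adapted F \<iota> X \<and> locally_bv X"

text \<open>M is a martingale part of X. For p at least 2 its values at nonnegative times are unique.\<close>

definition martingale_part ::
    "('h::chilbert_space \<Rightarrow>\<^sub>L 'h) set \<Rightarrow> (real \<Rightarrow> ('h \<Rightarrow>\<^sub>L 'h) set) \<Rightarrow>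
     (('h \<Rightarrow>\<^sub>L 'h) \<Rightarrow> complex) \<Rightarrow> (('h \<Rightarrow>\<^sub>L 'h) \<Rightarrow> 'v::banach) \<Rightarrow>
     (real \<Rightarrow> 'v) \<Rightarrow> (real \<Rightarrow> 'v) \<Rightarrow> bool" where
  "martingale_part A F E \<iota> X M \<longleftrightarrow>
     Lp_martingale A F E \<iota> M \<and> continuous_on {0..} M \<and> M 0 = 0 \<and>
     (\<exists>V. Lp_FV F \<iota> V \<and> continuous_on {0..} V \<and> V 0 = 0 \<and>
          (\<forall>t\<ge>0. X t = X 0 + M t + V t))"

definition decomposable ::
    "('h::chilbert_space \<Rightarrow>\<^sub>L 'h) set \<Rightarrow> (real \<Rightarrow> ('h \<Rightarrow>\<^sub>L 'h) set) \<Rightarrow>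
     (('h \<Rightarrow>\<^sub>L 'h) \<Rightarrow> complex) \<Rightarrow> (('h \<Rightarrow>\<^sub>L 'h) \<Rightarrow> 'v::banach) \<Rightarrow> (real \<Rightarrow> 'v) \<Rightarrow> bool" where
  "decomposable A F E \<iota> X \<longleftrightarrow> adapted F \<iota> X \<and> (\<exists>M. martingale_part A F E \<iota> X M)"

text \<open>Here \<open>\<iota>\<close> is meant to be the embedding of A into L2(A,E). The approximating martingales
  take values in A, and the norm in their continuity condition is the operator norm.\<close>

definition loc_unif_approximable ::
    "('h::chilbert_space \<Rightarrow>\<^sub>L 'h) set \<Rightarrow> (real \<Rightarrow> ('h \<Rightarrow>\<^sub>L 'h) set) \<Rightarrow>
     (('h \<Rightarrow>\<^sub>L 'h) \<Rightarrow> complex) \<Rightarrow> (('h \<Rightarrow>\<^sub>L 'h) \<Rightarrow> 'v::banach) \<Rightarrow> (real \<Rightarrow> 'v) \<Rightarrow> bool" where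
  "loc_unif_approximable A F E \<iota> M \<longleftrightarrow>
     (\<exists>m :: nat \<Rightarrow> real \<Rightarrow> ('h \<Rightarrow>\<^sub>L 'h).
        (\<forall>n. continuous_on {0..} (m n) \<and> (\<forall>t\<ge>0. m n t \<in> F t) \<and>
             Lp_martingale A F E \<iota> (\<lambda>t. \<iota> (m n t))) \<and>
        (\<forall>t\<ge>0. uniform_limit {0..t} (\<lambda>n s. \<iota> (m n s)) M sequentially))"


section \<open>Bilinear integrands and quadratic covariation integrals\<close>

text \<open>Bounded real-bilinear maps are curried; the operator norm of the nested type of bounded
  linear maps is the norm of the bilinear map.\<close>

definition adapted_bilinear ::
    "('h::chilbert_space \<Rightarrow>\<^sub>L 'h) set \<Rightarrow> (real \<Rightarrow> ('h \<Rightarrow>\<^sub>L 'h) set) \<Rightarrow>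
     (('h \<Rightarrow>\<^sub>L 'h) \<Rightarrow> complex) \<Rightarrow> (('h \<Rightarrow>\<^sub>L 'h) \<Rightarrow> 'u::banach) \<Rightarrow>
     ('k::chilbert_space \<Rightarrow>\<^sub>L 'k) set \<Rightarrow> (real \<Rightarrow> ('k \<Rightarrow>\<^sub>L 'k) set) \<Rightarrow>
     (('k \<Rightarrow>\<^sub>L 'k) \<Rightarrow> complex) \<Rightarrow> (('k \<Rightarrow>\<^sub>L 'k) \<Rightarrow> 'v::banach) \<Rightarrow>
     ('l::chilbert_space \<Rightarrow>\<^sub>L 'l) set \<Rightarrow> (real \<Rightarrow> ('l \<Rightarrow>\<^sub>L 'l) set) \<Rightarrow>
     (('l \<Rightarrow>\<^sub>L 'l) \<Rightarrow> complex) \<Rightarrow> (('l \<Rightarrow>\<^sub>L 'l) \<Rightarrow> 'w::banach) \<Rightarrow>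
     (real \<Rightarrow> 'u \<Rightarrow>\<^sub>L 'v \<Rightarrow>\<^sub>L 'w) \<Rightarrow> bool" where
  "adapted_bilinear A FA EA \<iota>A B FB EB \<iota>B C FC EC \<iota>C \<Lambda> \<longleftrightarrow>
     (\<forall>t u x y. 0 \<le> t \<and> t \<le> u \<longrightarrow>
        (x \<in> Lp_sub \<iota>A (FA u) \<longrightarrow>
           cond_exp C EC \<iota>C (FC u) (blinfun_apply (blinfun_apply (\<Lambda> t) x) y) =
           blinfun_apply (blinfun_apply (\<Lambda> t) x) (cond_exp B EB \<iota>B (FB u) y)) \<and>
        (y \<in> Lp_sub \<iota>B (FB u) \<longrightarrow>
           cond_exp C EC \<iota>C (FC u) (blinfun_apply (blinfun_apply (\<Lambda> t) x) y) =
           blinfun_apply (blinfun_apply (\<Lambda> t) (cond_exp A EA \<iota>A (FA u) x)) y))"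

definition quad_sum ::
    "(real \<Rightarrow> 'u::real_normed_vector \<Rightarrow>\<^sub>L 'v::real_normed_vector \<Rightarrow>\<^sub>L 'w::real_normed_vector) \<Rightarrow>
     (real \<Rightarrow> 'u) \<Rightarrow> (real \<Rightarrow> 'v) \<Rightarrow> real set \<Rightarrow> 'w" where
  "quad_sum \<Lambda> X Y P =
     (\<Sum>s\<in>P. blinfun_apply (blinfun_apply (\<Lambda> (left_nb P s)) (X s - X (left_nb P s)))
                             (Y s - Y (left_nb P s)))"

definition quad_int ::
    "(real \<Rightarrow> 'u::real_normed_vector \<Rightarrow>\<^sub>L 'v::real_normed_vector \<Rightarrow>\<^sub>L 'w::real_normed_vector) \<Rightarrow>
     (real \<Rightarrow> 'u) \<Rightarrow> (real \<Rightarrow> 'v) \<Rightarrow> real \<Rightarrow> 'w" where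
  "quad_int \<Lambda> X Y t = Lim (mesh_filter t) (quad_sum \<Lambda> X Y)"

end

theory Submission
  imports Defs "HOL-Computational_Algebra.Fundamental_Theorem_Algebra"
begin

text \<open>
  Write \<open>Q(X, Y, \<Pi>)\<close> for the quadratic sum over a partition \<open>\<Pi>\<close>. The drift parts of \<open>X\<close> and \<open>Y\<close>
  disappear in the limit: a mixed sum with a factor of bounded variation is at most a constant times
  the largest increment of the other factor. For martingales \<open>M\<close>, \<open>N\<close> the increments are
  orthogonal in \<open>L\<^sup>2\<close>, so that \<open>\<parallel>Q(M, N, \<Pi>)\<parallel>\<^sub>1 \<le> sup\<parallel>\<Lambda>\<parallel> \<parallel>M(t)\<parallel>\<^sub>2 \<parallel>N(t)\<parallel>\<^sub>2\<close> for every
  partition. By this bound it is enough to show the Cauchy property for the approximating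
  martingales \<open>m\<close>, \<open>n\<close>, which are continuous in operator norm.

  Let \<open>R\<close> refine \<open>P\<close>, and let \<open>a\<close> be the left end point of the cell of \<open>P\<close> that contains \<open>s \<in> R\<close>. Up to
  the oscillation of \<open>\<Lambda>\<close>, the difference \<open>Q(m, n, P) - Q(m, n, R)\<close> is the sum over \<open>s \<in> R\<close> of
  \<open>\<Lambda>(a)[m(s\<^sub>-) - m(a), n(s) - n(s\<^sub>-)] + \<Lambda>(a)[m(s) - m(s\<^sub>-), n(s\<^sub>-) - n(a)]\<close>.
  As \<open>\<Lambda>\<close> is adapted, each of the two families consists of martingale differences in the third
  algebra; by the Hoelder-type bounds on \<open>\<Lambda>\<close> with exponents \<open>(\<infinity>, 2, 2)\<close> and \<open>(2, \<infinity>, 2)\<close> they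
  lie in \<open>L\<^sup>2\<close>. They are therefore orthogonal, and the \<open>L\<^sup>1\<close>-norm of their sum is at most its \<open>L\<^sup>2\<close>-norm, which is bounded by a
  constant times the oscillation of \<open>m\<close> or \<open>n\<close> in operator norm over one cell
  (\<open>norm_transform_left\<close>, \<open>norm_transform_right\<close>). The constant in the Hoelder-type
  bounds depends on the time, without any uniformity. So \<open>\<Lambda>(a)\<close> is replaced by \<open>\<Lambda>(g(a))\<close>,
  where \<open>g\<close> rounds down to a fixed grid, and only finitely many constants occur (\<open>grid_sampling\<close>, \<open>quad_sum_Cauchy_bounded\<close>).

  The limit over \<open>[s, t]\<close> is bounded by the increment from \<open>s\<close> to \<open>t\<close> of the continuous increasing
  function \<open>\<parallel>M\<parallel>\<^sub>2\<^sup>2 + \<parallel>N\<parallel>\<^sub>2\<^sup>2\<close>, times a constant; this gives continuity and bounded variation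
  (\<open>quad_limit_regular\<close>).

  Underneath lies the \<open>L\<^sup>1\<close>-\<open>L\<^sup>2\<close> theory of a tracial state. The functional calculus of a positive
  operator \<open>h\<close> rests on \<open>\<parallel>q(h)\<parallel> \<le> sup \<bar>q\<bar>\<close> over \<open>[0, \<parallel>h\<parallel>]\<close> (\<open>norm_poly_op_le\<close>). It yields
  \<open>\<bar>E[ab]\<bar> \<le> \<parallel>a\<parallel>\<^sub>1 \<parallel>b\<parallel>\<close> and the converse duality (\<open>E_Hoelder_1_infinity\<close>,
  \<open>nc_norm_1_duality\<close>), and these make the extended trace well defined and separating on
  \<open>L\<^sup>1\<close>. Conditional expectations are orthogonal projections (\<open>cond_exp_characterization\<close>), obtained from
  minimising sequences (\<open>riesz_approximation\<close>).
\<close>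

section \<open>Hilbert space: Cauchy-Schwarz, Riesz representation, adjoints\<close>

lemma scaleC_zero_left: "0 *\<^sub>C (x::'a::chilbert_space) = 0"
  using scaleC_of_real[of "0" x] by simp

lemma scaleC_zero_right: "c *\<^sub>C (0::'a::chilbert_space) = 0"
  using scaleC_add_right[of c 0 "0::'a"] by simp

lemma scaleC_minus_right: "c *\<^sub>C (- x) = - (c *\<^sub>C (x::'a::chilbert_space))"
  using scaleC_add_right[of c x "-x"] scaleC_zero_right
  by (metis add.right_inverse add_eq_0_iff)

lemma scaleC_minus_left: "(- c) *\<^sub>C x = - (c *\<^sub>C (x::'a::chilbert_space))"
  using scaleC_add_left[of c "-c" x] scaleC_zero_left
  by (metis add.right_inverse add_eq_0_iff)

lemma scaleC_diff_right: "c *\<^sub>C (x - y) = c *\<^sub>C x - c *\<^sub>C (y::'a::chilbert_space)"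
  using scaleC_add_right[of c x "-y"] by (simp add: scaleC_minus_right)

lemma cinner_add_right: "cinner x (y + z) = cinner x y + cinner x (z::'a::chilbert_space)"
  by (metis cinner_commute cinner_add_left complex_cnj_add)

lemma cinner_scaleC_right: "cinner x (c *\<^sub>C y) = cnj c * cinner x (y::'a::chilbert_space)"
  by (metis cinner_commute cinner_scaleC_left complex_cnj_mult)

lemma cinner_scaleR_left: "cinner (r *\<^sub>R x) y = of_real r * cinner x (y::'a::chilbert_space)"
  by (metis cinner_scaleC_left scaleC_of_real)

lemma cinner_scaleR_right: "cinner x (r *\<^sub>R y) = of_real r * cinner x (y::'a::chilbert_space)"
  by (metis cinner_scaleC_right scaleC_of_real complex_cnj_complex_of_real)

lemma cinner_minus_left: "cinner (- x) y = - cinner x (y::'a::chilbert_space)"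
  using cinner_scaleR_left[of "-1" x y] by simp

lemma cinner_minus_right: "cinner x (- y) = - cinner x (y::'a::chilbert_space)"
  using cinner_scaleR_right[of x "-1" y] by simp

lemma cinner_diff_left: "cinner (x - z) y = cinner x y - cinner z (y::'a::chilbert_space)"
  using cinner_add_left[of x "-z" y] by (simp add: cinner_minus_left)

lemma cinner_diff_right: "cinner y (x - z) = cinner y x - cinner y (z::'a::chilbert_space)"
  using cinner_add_right[of y x "-z"] by (simp add: cinner_minus_right)

lemma cinner_zero_left: "cinner 0 (y::'a::chilbert_space) = 0"
  using cinner_scaleR_left[of 0 0 y] by simp

lemma cinner_zero_right: "cinner (y::'a::chilbert_space) 0 = 0"
  using cinner_scaleR_right[of y 0 0] by simp

lemmas cinner_simps = cinner_add_left cinner_add_right cinner_diff_left cinner_diff_right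
  cinner_minus_left cinner_minus_right cinner_zero_left cinner_zero_right
  cinner_scaleR_left cinner_scaleR_right cinner_scaleC_left cinner_scaleC_right

lemma Re_cinner_commute: "Re (cinner x y) = Re (cinner y (x::'a::chilbert_space))"
  by (metis cinner_commute cnj.sel(1))

lemma norm_add_square:
  "(norm (x + y))\<^sup>2 = (norm x)\<^sup>2 + (norm y)\<^sup>2 + 2 * Re (cinner x (y::'a::chilbert_space))"
proof -
  have "(norm (x + y))\<^sup>2 = Re (cinner (x + y) (x + y))"
    by (simp only: cinner_self Re_complex_of_real)
  also have "\<dots> = Re (cinner x x) + Re (cinner y y) + 2 * Re (cinner x y)"
    by (simp add: cinner_add_left cinner_add_right Re_cinner_commute[of y x])
  finally show ?thesis by (simp add: cinner_self)
qed

text \<open>The common source of the Cauchy-Schwarz inequalities below and of the bound on the first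
  variation of a minimising sequence.\<close>

lemma quadratic_nonneg_discriminant:
  fixes a b c :: real
  assumes nonneg: "\<And>t. 0 \<le> a + 2 * t * b + t\<^sup>2 * c" and c: "0 \<le> c"
  shows "b\<^sup>2 \<le> a * c"
proof (cases "c = 0")
  case True
  have "b = 0"
  proof (rule ccontr)
    assume b: "b \<noteq> 0"
    have "0 \<le> a + 2 * (- (a + 1) / (2 * b)) * b" using nonneg[of "- (a + 1) / (2 * b)"] True by simp
    also have "\<dots> = - 1" using b by (simp add: field_simps)
    finally show False by simp
  qed
  then show ?thesis using True by simp
next
  case False
  with c have c: "c > 0" by simp
  have "0 \<le> a + 2 * (- b / c) * b + (- b / c)\<^sup>2 * c" by (rule nonneg)
  also have "\<dots> = a - b\<^sup>2 / c" using c by (simp add: field_simps power2_eq_square)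
  finally show ?thesis using c by (simp add: field_simps)
qed

text \<open>Reduces Cauchy-Schwarz for a complex form to its real part.\<close>

lemma unimodular_rotation:
  obtains u :: complex where "cmod u = 1" "u * z = of_real (cmod z)"
proof (cases "z = 0")
  case True then show ?thesis using that[of 1] by simp
next
  case False
  have "cnj z / of_real (cmod z) * z = of_real (cmod z)"
    using False complex_norm_square[of z] by (simp add: field_simps power2_eq_square)
  moreover have "cmod (cnj z / of_real (cmod z)) = 1" using False by (simp add: norm_divide)
  ultimately show ?thesis using that by blast
qed

lemma Re_cinner_Cauchy_Schwarz: "\<bar>Re (cinner x y)\<bar> \<le> norm x * norm (y::'a::chilbert_space)"
proof -
  have "0 \<le> (norm x)\<^sup>2 + 2 * t * Re (cinner x y) + t\<^sup>2 * (norm y)\<^sup>2" for t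
  proof -
    have "0 \<le> (norm (x + t *\<^sub>R y))\<^sup>2" by simp
    then show ?thesis unfolding norm_add_square
      by (simp add: cinner_scaleR_right power_mult_distrib algebra_simps)
  qed
  then have "(Re (cinner x y))\<^sup>2 \<le> (norm x)\<^sup>2 * (norm y)\<^sup>2"
    by (rule quadratic_nonneg_discriminant) simp
  then show ?thesis by (metis abs_le_square_iff abs_mult abs_norm_cancel power_mult_distrib)
qed

lemma norm_scaleC: "norm (c *\<^sub>C x) = cmod c * norm (x::'a::chilbert_space)"
proof -
  have "complex_of_real ((norm (c *\<^sub>C x))\<^sup>2) = c * cnj c * of_real ((norm x)\<^sup>2)"
    by (simp only: cinner_self[symmetric] cinner_scaleC_left cinner_scaleC_right ac_simps)
  also have "\<dots> = of_real ((cmod c)\<^sup>2 * (norm x)\<^sup>2)"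
    by (simp add: complex_norm_square[symmetric])
  finally have "(norm (c *\<^sub>C x))\<^sup>2 = (cmod c * norm x)\<^sup>2"
    by (simp only: of_real_eq_iff power_mult_distrib)
  then show ?thesis by (simp add: power2_eq_iff_nonneg)
qed

lemma cinner_Cauchy_Schwarz: "cmod (cinner x y) \<le> norm x * norm (y::'a::chilbert_space)"
proof -
  obtain u where u: "cmod u = 1" "u * cinner x y = of_real (cmod (cinner x y))"
    by (rule unimodular_rotation)
  have "cmod (cinner x y) = Re (cinner (u *\<^sub>C x) y)" by (simp add: cinner_scaleC_left u)
  also have "\<dots> \<le> norm (u *\<^sub>C x) * norm y" using Re_cinner_Cauchy_Schwarz[of "u *\<^sub>C x" y] by linarith
  finally show ?thesis by (simp add: norm_scaleC u)
qed

lemma bounded_bilinear_cinner: "bounded_bilinear (cinner :: 'a::chilbert_space \<Rightarrow> 'a \<Rightarrow> complex)"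
  by (rule bounded_bilinear.intro)
     (auto simp: cinner_simps scaleR_conv_of_real intro!: exI[of _ 1] cinner_Cauchy_Schwarz)

lemma bounded_linear_scaleC: "bounded_linear (\<lambda>x::'a::chilbert_space. c *\<^sub>C x)"
proof (rule bounded_linear_intro)
  show "c *\<^sub>C (r *\<^sub>R x) = r *\<^sub>R c *\<^sub>C x" for r and x :: 'a
    by (simp add: scaleC_of_real[symmetric] scaleC_scaleC mult.commute)
  show "norm (c *\<^sub>C x) \<le> norm x * cmod c" for x :: 'a
    by (simp add: norm_scaleC)
qed (rule scaleC_add_right)

text \<open>A minimiser of \<open>B x x - 2 \<phi> x\<close> over \<open>N\<close> would represent \<open>\<phi>\<close>, but the form may be degenerate and
  \<open>N\<close> incomplete. A minimising sequence does as well: it is Cauchy by the parallelogram law, and its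
  first variation tends to zero. In a Hilbert space it converges (the Riesz theorem); for
  conditional expectations it converges in a completion of \<open>N\<close>.\<close>

lemma riesz_approximation:
  fixes B :: "'x::real_vector \<Rightarrow> 'x \<Rightarrow> real" and \<phi> :: "'x \<Rightarrow> real"
  assumes N: "subspace N"
    and sym: "\<And>x y. x \<in> N \<Longrightarrow> y \<in> N \<Longrightarrow> B x y = B y x"
    and addB: "\<And>x y z. x \<in> N \<Longrightarrow> y \<in> N \<Longrightarrow> z \<in> N \<Longrightarrow> B (x + y) z = B x z + B y z"
    and scaleB: "\<And>r x y. x \<in> N \<Longrightarrow> y \<in> N \<Longrightarrow> B (r *\<^sub>R x) y = r * B x y"
    and pos: "\<And>x. x \<in> N \<Longrightarrow> 0 \<le> B x x"
    and add: "\<And>x y. x \<in> N \<Longrightarrow> y \<in> N \<Longrightarrow> \<phi> (x + y) = \<phi> x + \<phi> y"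
    and scale: "\<And>r x. x \<in> N \<Longrightarrow> \<phi> (r *\<^sub>R x) = r * \<phi> x"
    and bound: "\<And>x. x \<in> N \<Longrightarrow> \<phi> x \<le> c * sqrt (B x x)"
  obtains a :: "nat \<Rightarrow> 'x" where "\<And>n. a n \<in> N"
    and "\<And>e. e > 0 \<Longrightarrow> \<exists>K. \<forall>m\<ge>K. \<forall>n\<ge>K. B (a m - a n) (a m - a n) < e"
    and "\<And>b. b \<in> N \<Longrightarrow> (\<lambda>n. B (a n) b) \<longlonglongrightarrow> \<phi> b"
proof -
  define J where "J x = B x x - 2 * \<phi> x" for x
  have Nsc: "r *\<^sub>R x \<in> N" if "x \<in> N" for r x using N that by (simp add: subspace_scale)
  have Nadd: "x + y \<in> N" if "x \<in> N" "y \<in> N" for x y using N that by (simp add: subspace_add)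
  have addB2: "B z (x + y) = B z x + B z y" if "x \<in> N" "y \<in> N" "z \<in> N" for x y z
    using that addB sym Nadd by metis
  have scaleB2: "B y (r *\<^sub>R x) = r * B y x" if "x \<in> N" "y \<in> N" for x y r
    using that scaleB sym Nsc by metis
  \<comment> \<open>\<open>J\<close> along a line, the source of both the Cauchy property and the first variation\<close>
  have J_line: "J (x + t *\<^sub>R y) = J x + 2 * t * (B x y - \<phi> y) + t\<^sup>2 * B y y"
    if "x \<in> N" "y \<in> N" for x y t
    unfolding J_def using that Nsc[of y t] sym[of y x]
    by (simp add: add scale addB addB2 Nadd scaleB scaleB2 power2_eq_square algebra_simps)
  have J_lower: "- c\<^sup>2 \<le> J x" if "x \<in> N" for x
  proof -
    have "0 \<le> (sqrt (B x x) - c)\<^sup>2" by simp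
    also have "\<dots> = B x x - 2 * (c * sqrt (B x x)) + c\<^sup>2" using pos[OF that]
      by (simp add: power2_diff)
    finally show ?thesis using bound[OF that] unfolding J_def by linarith
  qed
  define j where "j = Inf (J ` N)"
  have N0: "0 \<in> N" using N by (rule subspace_0)
  have bdd: "bdd_below (J ` N)" using J_lower by (auto intro!: bdd_belowI2)
  have j_le: "j \<le> J x" if "x \<in> N" for x unfolding j_def using bdd that by (rule cINF_lower)
  have "\<exists>x\<in>N. J x < j + inverse (real (Suc n))" for n
  proof -
    have "Inf (J ` N) < j + inverse (real (Suc n))" unfolding j_def by simp
    then obtain v where "v \<in> J ` N" "v < j + inverse (real (Suc n))"
      using cInf_lessD[of "J ` N"] N0 by blast
    then show ?thesis by blast
  qed
  then obtain a where aN: "\<And>n. a n \<in> N" and aJ: "\<And>n. J (a n) < j + inverse (real (Suc n))"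
    by metis
  have cauchy: "\<exists>K. \<forall>m\<ge>K. \<forall>n\<ge>K. B (a m - a n) (a m - a n) < e" if e: "e > 0" for e
  proof -
    obtain K where K: "inverse (real (Suc K)) < e / 4"
      using reals_Archimedean[of "e / 4"] e by auto
    have "B (a m - a n) (a m - a n) < e" if mn: "m \<ge> K" "n \<ge> K" for m n
    proof -
      define d where "d = a m - a n"
      have dN: "d \<in> N" unfolding d_def using N aN by (simp add: subspace_diff)
      have 1: "J (a m) = J (a n) + 2 * (B (a n) d - \<phi> d) + B d d"
        using J_line[OF aN[of n] dN, of 1] by (simp add: d_def)
      have "j \<le> J (a n + (1/2) *\<^sub>R d)" by (intro j_le Nadd Nsc aN dN)
      also have "\<dots> = J (a n) + (B (a n) d - \<phi> d) + B d d / 4"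
        using J_line[OF aN[of n] dN, of "1/2"] by (simp add: power2_eq_square)
      finally have 2: "j \<le> J (a n) + (B (a n) d - \<phi> d) + B d d / 4" .
      have "B d d \<le> 2 * (J (a m) - j) + 2 * (J (a n) - j)" using 1 2 by argo
      moreover have J_close: "J (a k) - j < e / 4" if "k \<ge> K" for k
      proof -
        have "inverse (real (Suc k)) \<le> inverse (real (Suc K))" using that by (simp add: field_simps)
        then show ?thesis using aJ[of k] K by linarith
      qed
      note J_close[OF mn(1)] J_close[OF mn(2)]
      ultimately show ?thesis unfolding d_def by argo
    qed
    then show ?thesis by blast
  qed
  have lim: "(\<lambda>n. B (a n) b) \<longlonglongrightarrow> \<phi> b" if b: "b \<in> N" for b
  proof -
    have le: "\<bar>B (a n) b - \<phi> b\<bar> \<le> sqrt (inverse (real (Suc n)) * B b b)" for n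
    proof -
      have "0 \<le> (J (a n) - j) + 2 * t * (B (a n) b - \<phi> b) + t\<^sup>2 * B b b" for t
        using j_le[OF Nadd[OF aN[of n] Nsc[OF b, of t]]] J_line[OF aN[of n] b, of t] by linarith
      then have "(B (a n) b - \<phi> b)\<^sup>2 \<le> (J (a n) - j) * B b b"
        by (rule quadratic_nonneg_discriminant) (rule pos[OF b])
      also have "\<dots> \<le> inverse (real (Suc n)) * B b b"
        using aJ[of n] pos[OF b] by (intro mult_right_mono) auto
      finally show ?thesis by (metis real_sqrt_abs real_sqrt_le_iff)
    qed
    have "(\<lambda>n. sqrt (inverse (real (Suc n)) * B b b)) \<longlonglongrightarrow> sqrt (0 * B b b)"
      by (intro tendsto_intros LIMSEQ_inverse_real_of_nat)
    then have "(\<lambda>n. B (a n) b - \<phi> b) \<longlonglongrightarrow> 0"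
      by (intro Lim_null_comparison[of "\<lambda>n. B (a n) b - \<phi> b"]) (use le in auto)
    then show ?thesis by (simp add: LIM_zero_cancel)
  qed
  show ?thesis using that[OF aN cauchy lim] .
qed

lemma riesz_representation:
  fixes \<phi> :: "'h::chilbert_space \<Rightarrow> real"
  assumes "linear \<phi>" and bound: "\<And>x. \<phi> x \<le> c * norm x"
  obtains z where "\<And>x. Re (cinner z x) = \<phi> x"
proof -
  interpret linear \<phi> by fact
  have [simp]: "sqrt (Re (cinner x x)) = norm x" for x :: 'h by (simp add: cinner_self)
  obtain a :: "nat \<Rightarrow> 'h" where
      a: "\<And>e. e > 0 \<Longrightarrow> \<exists>K. \<forall>m\<ge>K. \<forall>n\<ge>K. Re (cinner (a m - a n) (a m - a n)) < e"
    and lim: "\<And>b. (\<lambda>n. Re (cinner (a n) b)) \<longlonglongrightarrow> \<phi> b"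
    by (rule riesz_approximation[of UNIV "\<lambda>x y. Re (cinner x y)" \<phi> c])
       (auto simp: cinner_simps Re_cinner_commute add scale bound cinner_self)
  have "Cauchy a"
  proof (rule CauchyI)
    fix e :: real assume e: "e > 0"
    then obtain K where K: "\<forall>m\<ge>K. \<forall>n\<ge>K. Re (cinner (a m - a n) (a m - a n)) < e\<^sup>2"
      using a[of "e\<^sup>2"] by auto
    have "norm (a m - a n) < e" if "m \<ge> K" "n \<ge> K" for m n
      using K that e by (auto simp: cinner_self intro: power_less_imp_less_base[of _ 2])
    then show "\<exists>K. \<forall>m\<ge>K. \<forall>n\<ge>K. norm (a m - a n) < e" by blast
  qed
  then obtain z where z: "a \<longlonglongrightarrow> z" using Cauchy_convergent convergent_def by blast
  have "Re (cinner z x) = \<phi> x" for x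
  proof -
    have "(\<lambda>n. Re (cinner (a n) x)) \<longlonglongrightarrow> Re (cinner z x)"
      by (intro tendsto_Re bounded_bilinear.tendsto[OF bounded_bilinear_cinner] z tendsto_const)
    then show ?thesis using lim LIMSEQ_unique by blast
  qed
  then show ?thesis by (rule that)
qed

lemma cinner_eqI:
  assumes "\<And>y. cinner u y = cinner v (y::'h::chilbert_space)"
  shows "u = v"
proof -
  have "cinner (u - v) (u - v) = 0" using assms by (simp add: cinner_simps)
  then show ?thesis by (simp add: cinner_self)
qed

lemma clinear_ops_scaleC:
  "a \<in> clinear_ops \<Longrightarrow> blinfun_apply a (c *\<^sub>C x) = c *\<^sub>C blinfun_apply a x"
  by (simp add: clinear_ops_def)

text \<open>Riesz representation is applied to the real part of \<open>y \<mapsto> \<langle>x, a y\<rangle>\<close>; since \<open>a\<close> is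
  complex-linear, inserting \<open>\<i> y\<close> recovers the imaginary part.\<close>

lemma adjoint_exists:
  fixes a :: "'h::chilbert_space \<Rightarrow>\<^sub>L 'h"
  assumes a: "a \<in> clinear_ops"
  obtains b where "\<And>x y. cinner (blinfun_apply b x) y = cinner x (blinfun_apply a y)"
proof -
  have "\<exists>z. \<forall>y. cinner z y = cinner x (blinfun_apply a y)" for x
  proof -
    have "linear (\<lambda>y. Re (cinner x (blinfun_apply a y)))"
      by (rule linearI) (simp_all add: blinfun.add_right blinfun.scaleR_right cinner_simps)
    moreover have "Re (cinner x (blinfun_apply a y)) \<le> (norm x * norm a) * norm y" for y
    proof -
      have "Re (cinner x (blinfun_apply a y)) \<le> norm x * norm (blinfun_apply a y)"
        using Re_cinner_Cauchy_Schwarz abs_le_D1 by blast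
      also have "\<dots> \<le> norm x * (norm a * norm y)" by (intro mult_left_mono norm_blinfun) simp
      finally show ?thesis by (simp add: mult.assoc)
    qed
    ultimately obtain z where z: "\<And>y. Re (cinner z y) = Re (cinner x (blinfun_apply a y))"
      using riesz_representation by blast
    have "cinner z y = cinner x (blinfun_apply a y)" for y
    proof (rule complex_eqI)
      show "Im (cinner z y) = Im (cinner x (blinfun_apply a y))"
        using z[of "\<i> *\<^sub>C y"] by (simp add: clinear_ops_scaleC[OF a] cinner_simps)
    qed (rule z)
    then show ?thesis by blast
  qed
  then obtain f where f: "\<And>x y. cinner (f x) y = cinner x (blinfun_apply a y)" by metis
  have "bounded_linear f"
  proof (rule bounded_linear_intro)
    show "f (x + y) = f x + f y" for x y by (rule cinner_eqI) (simp add: f cinner_simps)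
    show "f (r *\<^sub>R x) = r *\<^sub>R f x" for r x by (rule cinner_eqI) (simp add: f cinner_simps)
    show "norm (f x) \<le> norm x * norm a" for x
    proof (cases "f x = 0")
      case False
      have "(norm (f x))\<^sup>2 = cmod (cinner (f x) (f x))"
        by (simp add: cinner_self norm_power)
      also have "\<dots> = cmod (cinner x (blinfun_apply a (f x)))" by (simp add: f)
      also have "\<dots> \<le> norm x * (norm a * norm (f x))"
        by (rule order_trans[OF cinner_Cauchy_Schwarz]) (intro mult_left_mono norm_blinfun, simp)
      finally show ?thesis using False by (simp add: power2_eq_square)
    qed simp
  qed
  then show ?thesis using f by (intro that[of "Blinfun f"]) (simp add: bounded_linear_Blinfun_apply)
qed

lemma adjoint_unique:
  assumes "\<And>x y. cinner (blinfun_apply b x) y = cinner x (blinfun_apply a y)"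
    and "\<And>x y. cinner (blinfun_apply c x) y = cinner x (blinfun_apply a y)"
  shows "b = (c :: 'h::chilbert_space \<Rightarrow>\<^sub>L 'h)"
  by (rule blinfun_eqI, rule cinner_eqI) (simp add: assms)

lemma cinner_adj_left:
  assumes "a \<in> clinear_ops"
  shows "cinner (blinfun_apply (op_adj a) x) y = cinner x (blinfun_apply a y)"
proof -
  obtain b where b: "\<forall>x y. cinner (blinfun_apply b x) y = cinner x (blinfun_apply a y)"
    using adjoint_exists[OF assms] by metis
  have "\<forall>x y. cinner (blinfun_apply (op_adj a) x) y = cinner x (blinfun_apply a y)"
    unfolding op_adj_def
    by (rule theI[where P = "\<lambda>b. \<forall>x y. cinner (blinfun_apply b x) y = cinner x (blinfun_apply a y)", OF b])
       (use b in \<open>blast intro: adjoint_unique\<close>)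
  then show ?thesis by blast
qed

lemma op_adj_eqI:
  assumes "\<And>x y. cinner (blinfun_apply b x) y = cinner x (blinfun_apply a y)"
    and "a \<in> clinear_ops"
  shows "op_adj a = b"
  by (rule adjoint_unique[where a = a]) (simp_all add: assms cinner_adj_left)

lemma cinner_adj_right:
  assumes "a \<in> clinear_ops"
  shows "cinner x (blinfun_apply (op_adj a) y) = cinner (blinfun_apply a x) y"
  using arg_cong[OF cinner_adj_left[OF assms, of y x], of cnj]
  by (simp add: cinner_commute[symmetric])

lemma op_adj_clinear: 
  assumes "a \<in> clinear_ops" shows "op_adj a \<in> clinear_ops"
  unfolding clinear_ops_def mem_Collect_eq
  by (intro allI cinner_eqI) (simp add: cinner_adj_left[OF assms] cinner_simps)

lemma op_adj_adj: "a \<in> clinear_ops \<Longrightarrow> op_adj (op_adj a) = a"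
  by (rule op_adj_eqI) (auto simp: cinner_adj_right op_adj_clinear)

lemma clinear_ops_add: "a \<in> clinear_ops \<Longrightarrow> b \<in> clinear_ops \<Longrightarrow> a + b \<in> clinear_ops"
  by (auto simp: clinear_ops_def blinfun.add_left scaleC_add_right)

lemma clinear_ops_diff: "a \<in> clinear_ops \<Longrightarrow> b \<in> clinear_ops \<Longrightarrow> a - b \<in> clinear_ops"
  by (auto simp: clinear_ops_def blinfun.diff_left scaleC_diff_right)

lemma clinear_ops_compose: "a \<in> clinear_ops \<Longrightarrow> b \<in> clinear_ops \<Longrightarrow> a o\<^sub>L b \<in> clinear_ops"
  by (auto simp: clinear_ops_def)

lemma clinear_ops_id: "id_blinfun \<in> clinear_ops"
  by (auto simp: clinear_ops_def)

lemma op_scaleC_apply: "blinfun_apply (op_scaleC c a) x = c *\<^sub>C blinfun_apply a x"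
  unfolding op_scaleC_def
  by (subst bounded_linear_Blinfun_apply)
     (rule bounded_linear_compose[OF bounded_linear_scaleC blinfun.bounded_linear_right], rule refl)

lemma op_scaleC_of_real: "op_scaleC (of_real r) a = r *\<^sub>R a"
  by (rule blinfun_eqI) (simp add: op_scaleC_apply scaleC_of_real blinfun.scaleR_left)

lemma clinear_ops_op_scaleC: "a \<in> clinear_ops \<Longrightarrow> op_scaleC c a \<in> clinear_ops"
  by (auto simp: clinear_ops_def op_scaleC_apply scaleC_scaleC mult.commute)

lemma clinear_ops_scaleR: "a \<in> clinear_ops \<Longrightarrow> r *\<^sub>R a \<in> clinear_ops"
  using clinear_ops_op_scaleC[of a "of_real r"] by (simp add: op_scaleC_of_real)

lemma op_adj_add:
  assumes "a \<in> clinear_ops" "b \<in> clinear_ops"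
  shows "op_adj (a + b) = op_adj a + op_adj b"
  by (rule op_adj_eqI) (simp_all only: blinfun.add_left cinner_add_left cinner_add_right
      cinner_adj_left[OF assms(1)] cinner_adj_left[OF assms(2)] clinear_ops_add[OF assms])

lemma op_adj_diff:
  assumes "a \<in> clinear_ops" "b \<in> clinear_ops"
  shows "op_adj (a - b) = op_adj a - op_adj b"
  by (rule op_adj_eqI) (simp_all only: blinfun.diff_left cinner_diff_left cinner_diff_right
      cinner_adj_left[OF assms(1)] cinner_adj_left[OF assms(2)] clinear_ops_diff[OF assms])

lemma op_adj_compose:
  assumes "a \<in> clinear_ops" "b \<in> clinear_ops"
  shows "op_adj (a o\<^sub>L b) = op_adj b o\<^sub>L op_adj a"
  by (rule op_adj_eqI) (simp_all only: blinfun_apply_blinfun_compose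
      cinner_adj_left[OF assms(1)] cinner_adj_left[OF assms(2)] clinear_ops_compose[OF assms])

lemma op_adj_op_scaleC:
  assumes "a \<in> clinear_ops"
  shows "op_adj (op_scaleC c a) = op_scaleC (cnj c) (op_adj a)"
  by (rule op_adj_eqI) (simp_all only: op_scaleC_apply cinner_scaleC_left cinner_scaleC_right
      cinner_adj_left[OF assms] clinear_ops_op_scaleC[OF assms])

lemma op_adj_scaleR: "a \<in> clinear_ops \<Longrightarrow> op_adj (r *\<^sub>R a) = r *\<^sub>R op_adj a"
  using op_adj_op_scaleC[of a "of_real r"] by (simp add: op_scaleC_of_real)

lemma op_adj_id: "op_adj id_blinfun = id_blinfun"
  by (rule op_adj_eqI) (auto simp: clinear_ops_id)

lemma norm_op_adj_le: "a \<in> clinear_ops \<Longrightarrow> norm (op_adj a) \<le> norm a"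
proof (rule norm_blinfun_bound)
  fix x assume a: "a \<in> clinear_ops"
  show "norm (blinfun_apply (op_adj a) x) \<le> norm a * norm x"
  proof (cases "blinfun_apply (op_adj a) x = 0")
    case False
    let ?z = "blinfun_apply (op_adj a) x"
    have "(norm ?z)\<^sup>2 = cmod (cinner ?z ?z)" by (simp add: cinner_self norm_power)
    also have "\<dots> = cmod (cinner x (blinfun_apply a ?z))" by (simp add: cinner_adj_left a)
    also have "\<dots> \<le> norm x * (norm a * norm ?z)"
      by (rule order_trans[OF cinner_Cauchy_Schwarz]) (intro mult_left_mono norm_blinfun, simp)
    finally have "norm ?z * norm ?z \<le> (norm a * norm x) * norm ?z"
      by (simp only: power2_eq_square ac_simps)
    then show ?thesis using False by (metis mult_le_cancel_right_pos zero_less_norm_iff)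
  qed simp
qed simp

lemma norm_op_adj:
  assumes "a \<in> clinear_ops" shows "norm (op_adj a) = norm a"
  using norm_op_adj_le[OF assms] norm_op_adj_le[OF op_adj_clinear[OF assms]]
  by (simp add: op_adj_adj[OF assms])

section \<open>Von Neumann algebras are norm closed\<close>

lemma closed_clinear_ops: "closed (clinear_ops :: ('h::chilbert_space \<Rightarrow>\<^sub>L 'h) set)"
proof -
  have "clinear_ops = (\<Inter>c. \<Inter>x. {a :: 'h \<Rightarrow>\<^sub>L 'h. blinfun_apply a (c *\<^sub>C x) = c *\<^sub>C blinfun_apply a x})"
    by (rule set_eqI) (simp add: clinear_ops_def)
  also have "closed \<dots>"
  proof (intro closed_INT ballI closed_Collect_eq)
    fix c and x :: 'h
    show "continuous_on UNIV (\<lambda>a :: 'h \<Rightarrow>\<^sub>L 'h. blinfun_apply a (c *\<^sub>C x))"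
      by (rule linear_continuous_on[OF blinfun.bounded_linear_left])
    show "continuous_on UNIV (\<lambda>a :: 'h \<Rightarrow>\<^sub>L 'h. c *\<^sub>C blinfun_apply a x)"
      by (rule linear_continuous_on[OF bounded_linear_compose[OF bounded_linear_scaleC
            blinfun.bounded_linear_left]])
  qed
  finally show ?thesis .
qed

text \<open>The defining functionals of the \<open>\<sigma>\<close>-weak topology are norm continuous, since
  \<open>\<bar>\<Sum>\<langle>a x(n), y(n)\<rangle>\<bar> \<le> \<parallel>a\<parallel> \<Sum>\<parallel>x(n)\<parallel> \<parallel>y(n)\<parallel>\<close>.\<close>

lemma continuous_sigma_weak_functional:
  fixes x y :: "nat \<Rightarrow> 'h::chilbert_space"
  assumes x: "summable (\<lambda>n. (norm (x n))\<^sup>2)" and y: "summable (\<lambda>n. (norm (y n))\<^sup>2)"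
  shows "continuous_on UNIV (\<lambda>a :: 'h \<Rightarrow>\<^sub>L 'h. \<Sum>n. cinner (blinfun_apply a (x n)) (y n))"
proof -
  have sxy: "summable (\<lambda>n. norm (x n) * norm (y n))"
  proof (rule summable_comparison_test')
    show "summable (\<lambda>n. (norm (x n))\<^sup>2 + (norm (y n))\<^sup>2)" using x y by (rule summable_add)
    show "norm (norm (x n) * norm (y n)) \<le> (norm (x n))\<^sup>2 + (norm (y n))\<^sup>2" if "n \<ge> 0" for n
    proof -
      have "2 * norm (x n) * norm (y n) \<le> (norm (x n))\<^sup>2 + (norm (y n))\<^sup>2" by (rule sum_squares_bound)
      moreover have "0 \<le> norm (x n) * norm (y n)" by simp
      ultimately show ?thesis by (simp only: real_norm_def abs_mult abs_norm_cancel)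
    qed
  qed
  define S where "S = (\<Sum>n. norm (x n) * norm (y n))"
  have bd: "norm (cinner (blinfun_apply a (x n)) (y n)) \<le> norm a * (norm (x n) * norm (y n))"
    for a :: "'h \<Rightarrow>\<^sub>L 'h" and n
    by (rule order_trans[OF cinner_Cauchy_Schwarz])
       (simp add: mult.assoc[symmetric] mult_right_mono norm_blinfun)
  have sa: "summable (\<lambda>n. norm (cinner (blinfun_apply a (x n)) (y n)))" for a :: "'h \<Rightarrow>\<^sub>L 'h"
    by (rule summable_comparison_test'[OF summable_mult[OF sxy, of "norm a"]]) (simp add: bd)
  have "bounded_linear (\<lambda>a :: 'h \<Rightarrow>\<^sub>L 'h. \<Sum>n. cinner (blinfun_apply a (x n)) (y n))"
  proof (rule bounded_linear_intro)
    fix a b :: "'h \<Rightarrow>\<^sub>L 'h" and r :: real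
    show "(\<Sum>n. cinner (blinfun_apply (a + b) (x n)) (y n))
        = (\<Sum>n. cinner (blinfun_apply a (x n)) (y n)) + (\<Sum>n. cinner (blinfun_apply b (x n)) (y n))"
      by (simp add: blinfun.add_left cinner_add_left suminf_add summable_norm_cancel[OF sa])
    show "(\<Sum>n. cinner (blinfun_apply (r *\<^sub>R a) (x n)) (y n))
        = r *\<^sub>R (\<Sum>n. cinner (blinfun_apply a (x n)) (y n))"
      by (simp add: blinfun.scaleR_left cinner_scaleR_left suminf_mult summable_norm_cancel[OF sa]
          scaleR_conv_of_real)
    have "norm (\<Sum>n. cinner (blinfun_apply a (x n)) (y n))
        \<le> (\<Sum>n. norm (cinner (blinfun_apply a (x n)) (y n)))"
      by (rule summable_norm[OF sa])
    also have "\<dots> \<le> (\<Sum>n. norm a * (norm (x n) * norm (y n)))"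
      by (intro suminf_le bd sa summable_mult sxy)
    also have "\<dots> = norm a * S" unfolding S_def by (rule suminf_mult[OF sxy])
    finally show "norm (\<Sum>n. cinner (blinfun_apply a (x n)) (y n)) \<le> norm a * S" .
  qed
  then show ?thesis by (rule bounded_linear.continuous_on) (rule continuous_on_id)
qed

text \<open>The functional calculus stays inside the algebra by this property: its values are norm limits.\<close>

lemma von_neumann_closed:
  fixes A :: "('h::chilbert_space \<Rightarrow>\<^sub>L 'h) set"
  assumes "von_neumann_algebra A"
  shows "closed A"
proof -
  let ?G = "{{a. (\<Sum>n. cinner (blinfun_apply a (x n)) (y n)) \<in> U} | (x::nat \<Rightarrow> 'h) (y::nat \<Rightarrow> 'h) U.
          summable (\<lambda>n. (norm (x n))\<^sup>2) \<and> summable (\<lambda>n. (norm (y n))\<^sup>2) \<and> open U}"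
  have G: "open S" if "S \<in> ?G" for S
  proof -
    from that obtain x y :: "nat \<Rightarrow> 'h" and U where
      S: "S = {a. (\<Sum>n. cinner (blinfun_apply a (x n)) (y n)) \<in> U}" and "open U"
      and "summable (\<lambda>n. (norm (x n))\<^sup>2)" "summable (\<lambda>n. (norm (y n))\<^sup>2)"
      by blast
    then have "open ((\<lambda>a. \<Sum>n. cinner (blinfun_apply a (x n)) (y n)) -` U)"
      using continuous_sigma_weak_functional[of x y] by (simp add: continuous_on_open_vimage)
    then show ?thesis unfolding S vimage_def .
  qed
  have gen: "open T" if "generate_topology_on ?G T" for T
    using that
  proof (induction rule: generate_topology_on.induct)
    case (Basis s) then show ?case by (rule G)
  qed auto
  have "closedin sigma_weak A" using assms by (simp add: von_neumann_algebra_def)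
  then obtain T where T: "closedin (topology_generated_by ?G) T" "A = T \<inter> clinear_ops"
    unfolding sigma_weak_def closedin_subtopology by blast
  define W where "W = topspace (topology_generated_by ?G)"
  have "openin (topology_generated_by ?G) W" unfolding W_def by (rule openin_topspace)
  then have "openin (topology_generated_by ?G) (W - T)" using T(1) by blast
  then have o: "open (W - T)" using gen by (simp add: openin_topology_generated_by_iff)
  have "W = UNIV"
  proof -
    have "(UNIV :: ('h \<Rightarrow>\<^sub>L 'h) set) \<in> ?G"
      by (rule CollectI, rule exI[of _ "\<lambda>n. 0"], rule exI[of _ "\<lambda>n. 0"], rule exI[of _ UNIV]) simp
    then have "UNIV \<subseteq> \<Union>?G" by (rule Union_upper)
    then show ?thesis unfolding W_def topology_generated_by_topspace by (rule top.extremum_uniqueI)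
  qed
  then have "T = - (W - T)" by auto
  then have "closed T" using o by (metis closed_def double_complement)
  then show ?thesis unfolding T(2) by (intro closed_Int closed_clinear_ops)
qed

lemma von_neumann_rules:
  assumes "von_neumann_algebra A"
  shows "A \<subseteq> clinear_ops" and "id_blinfun \<in> A"
    and "a \<in> A \<Longrightarrow> b \<in> A \<Longrightarrow> a + b \<in> A" and "a \<in> A \<Longrightarrow> b \<in> A \<Longrightarrow> a o\<^sub>L b \<in> A"
    and "a \<in> A \<Longrightarrow> op_scaleC c a \<in> A" and "a \<in> A \<Longrightarrow> op_adj a \<in> A"
    and "a \<in> A \<Longrightarrow> r *\<^sub>R a \<in> A" and "a \<in> A \<Longrightarrow> b \<in> A \<Longrightarrow> a - b \<in> A" and "0 \<in> A"
proof -
  show sc: "op_scaleC c a \<in> A" if "a \<in> A" for a c using assms that by (simp add: von_neumann_algebra_def)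
  show r: "r *\<^sub>R a \<in> A" if "a \<in> A" for a r using sc[OF that, of "of_real r"] by (simp add: op_scaleC_of_real)
  show add: "a + b \<in> A" if "a \<in> A" "b \<in> A" for a b using assms that by (simp add: von_neumann_algebra_def)
  show "a - b \<in> A" if "a \<in> A" "b \<in> A" using add[OF that(1) r[OF that(2), of "-1"]] by simp
  show i: "id_blinfun \<in> A" using assms by (simp add: von_neumann_algebra_def)
  show "0 \<in> A" using r[OF i, of 0] by simp
  show "A \<subseteq> clinear_ops" using assms by (simp add: von_neumann_algebra_def)
  show "a o\<^sub>L b \<in> A" if "a \<in> A" "b \<in> A" using assms that by (simp add: von_neumann_algebra_def)
  show "op_adj a \<in> A" if "a \<in> A" using assms that by (simp add: von_neumann_algebra_def)
qed

lemma von_neumann_subspace: "von_neumann_algebra A \<Longrightarrow> subspace A"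
  using von_neumann_rules(3,7,9)[of A] by (intro subspaceI) simp_all

section \<open>Polynomials of an operator\<close>

lemma op_pow_0: "op_pow a 0 = id_blinfun" by (simp add: op_pow_def)
lemma op_pow_Suc: "op_pow a (Suc n) = a o\<^sub>L op_pow a n" by (simp add: op_pow_def)

lemma blinfun_compose_assoc: "(a o\<^sub>L b) o\<^sub>L c = a o\<^sub>L (b o\<^sub>L c)"
  by (rule blinfun_eqI) simp

lemma blinfun_compose_id_left: "id_blinfun o\<^sub>L a = a" and blinfun_compose_id_right: "a o\<^sub>L id_blinfun = a"
  by (rule blinfun_eqI, simp)+

lemma poly_op_0: "poly_op 0 a = 0" by (simp add: poly_op_def)

lemma poly_op_pCons: "poly_op (pCons c q) a = c *\<^sub>R id_blinfun + (a o\<^sub>L poly_op q a)"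
proof (cases "q = 0")
  case True
  then show ?thesis by (simp add: poly_op_def op_pow_0
        bounded_bilinear.zero_right[OF bounded_bilinear_blinfun_compose])
next
  case False
  then have "poly_op (pCons c q) a = (\<Sum>i\<le>Suc (degree q). coeff (pCons c q) i *\<^sub>R op_pow a i)"
    by (simp add: poly_op_def)
  also have "\<dots> = c *\<^sub>R id_blinfun + (\<Sum>i\<le>degree q. coeff q i *\<^sub>R (a o\<^sub>L op_pow a i))"
    by (subst sum.atMost_Suc_shift) (simp add: op_pow_0 op_pow_Suc)
  also have "(\<Sum>i\<le>degree q. coeff q i *\<^sub>R (a o\<^sub>L op_pow a i)) = a o\<^sub>L poly_op q a"
    unfolding poly_op_def
    by (simp add: bounded_bilinear.sum_right[OF bounded_bilinear_blinfun_compose]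
        bounded_bilinear.scaleR_right[OF bounded_bilinear_blinfun_compose])
  finally show ?thesis .
qed

lemmas compose_add_left = bounded_bilinear.add_left[OF bounded_bilinear_blinfun_compose]
lemmas compose_add_right = bounded_bilinear.add_right[OF bounded_bilinear_blinfun_compose]
lemmas compose_diff_left = bounded_bilinear.diff_left[OF bounded_bilinear_blinfun_compose]
lemmas compose_diff_right = bounded_bilinear.diff_right[OF bounded_bilinear_blinfun_compose]
lemmas compose_scaleR_left = bounded_bilinear.scaleR_left[OF bounded_bilinear_blinfun_compose]
lemmas compose_scaleR_right = bounded_bilinear.scaleR_right[OF bounded_bilinear_blinfun_compose]
lemmas compose_zero_left = bounded_bilinear.zero_left[OF bounded_bilinear_blinfun_compose]
lemmas compose_zero_right = bounded_bilinear.zero_right[OF bounded_bilinear_blinfun_compose]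
lemmas tendsto_compose = bounded_bilinear.tendsto[OF bounded_bilinear_blinfun_compose]

lemma poly_op_add: "poly_op (p + q) a = poly_op p a + poly_op q a"
proof (induction p arbitrary: q)
  case (pCons c p)
  obtain d r where q: "q = pCons d r" by (cases q)
  have "poly_op (pCons c p + q) a = (c + d) *\<^sub>R id_blinfun + (a o\<^sub>L poly_op p a + poly_op r a)"
    by (simp add: q poly_op_pCons pCons.IH)
  also have "\<dots> = poly_op (pCons c p) a + poly_op q a"
    by (simp add: q poly_op_pCons compose_add_right scaleR_add_left)
  finally show ?case .
qed (simp add: poly_op_0)

lemma poly_op_smult: "poly_op (smult c p) a = c *\<^sub>R poly_op p a"
  by (induction p) (simp_all add: poly_op_0 poly_op_pCons compose_scaleR_right scaleR_add_right)

lemma poly_op_diff: "poly_op (p - q) a = poly_op p a - poly_op q a"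
  using poly_op_add[of "p - q" q a] by (simp add: algebra_simps)

lemma poly_op_mult: "poly_op (p * q) a = poly_op p a o\<^sub>L poly_op q a"
  by (induction p)
     (simp_all add: poly_op_0 poly_op_pCons poly_op_add poly_op_smult compose_add_left
       compose_scaleR_left compose_zero_left blinfun_compose_assoc blinfun_compose_id_left)

lemma poly_op_in:
  assumes "von_neumann_algebra A" "a \<in> A" shows "poly_op q a \<in> A"
  by (induction q) (simp_all add: poly_op_0 poly_op_pCons von_neumann_rules[OF assms(1)] assms)

lemma poly_op_clinear:
  assumes "a \<in> clinear_ops" shows "poly_op q a \<in> clinear_ops"
proof (induction q)
  case 0 then show ?case using clinear_ops_scaleR[OF assms, of 0] by (simp add: poly_op_0)
next
  case (pCons c q) then show ?case
    by (simp add: poly_op_pCons clinear_ops_add clinear_ops_scaleR clinear_ops_compose clinear_ops_id assms)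
qed

lemma poly_op_commute: "poly_op q a o\<^sub>L a = a o\<^sub>L poly_op q a"
  using poly_op_mult[of q "[:0, 1:]" a] poly_op_mult[of "[:0, 1:]" q a]
  by (simp add: poly_op_pCons poly_op_0 mult.commute blinfun_compose_id_right compose_zero_right)

lemma op_adj_poly_op:
  assumes a: "a \<in> clinear_ops" and self: "op_adj a = a"
  shows "op_adj (poly_op q a) = poly_op q a"
proof (induction q)
  case 0 show ?case using op_adj_scaleR[OF a, of 0] by (simp add: poly_op_0)
next
  case (pCons c q)
  note cl = a poly_op_clinear[OF a, of q] clinear_ops_id
  have "op_adj (poly_op (pCons c q) a) = c *\<^sub>R id_blinfun + (poly_op q a o\<^sub>L a)"
    unfolding poly_op_pCons
    by (simp add: op_adj_add clinear_ops_scaleR clinear_ops_compose cl op_adj_scaleR op_adj_id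
        op_adj_compose pCons.IH self)
  then show ?case by (simp add: poly_op_pCons poly_op_commute)
qed

text \<open>A complex polynomial of an operator, applied to a vector. Complex coefficients are needed to
  split a polynomial into linear factors.\<close>

definition cpoly_apply :: "complex poly \<Rightarrow> ('h::chilbert_space \<Rightarrow>\<^sub>L 'h) \<Rightarrow> 'h \<Rightarrow> 'h" where
  "cpoly_apply p a x = fold_coeffs (\<lambda>c y. c *\<^sub>C x + blinfun_apply a y) p 0"

lemma cpoly_apply_0: "cpoly_apply 0 a x = 0"
  by (simp add: cpoly_apply_def)

lemma cpoly_apply_pCons: "cpoly_apply (pCons c p) a x = c *\<^sub>C x + blinfun_apply a (cpoly_apply p a x)"
  by (cases "p = 0 \<and> c = 0")
     (auto simp: cpoly_apply_def fold_coeffs_pCons_coeff_not_0_eq fold_coeffs_pCons_not_0_0_eq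
       scaleC_zero_left)

lemma cpoly_apply_add: "cpoly_apply (p + q) a x = cpoly_apply p a x + cpoly_apply q a x"
proof (induction p arbitrary: q)
  case (pCons c p)
  show ?case
    by (cases q) (simp add: cpoly_apply_pCons pCons.IH scaleC_add_left blinfun.add_right)
qed (simp add: cpoly_apply_0)

lemma cpoly_apply_smult:
  "a \<in> clinear_ops \<Longrightarrow> cpoly_apply (smult c p) a x = c *\<^sub>C cpoly_apply p a x"
  by (induction p)
     (simp_all add: cpoly_apply_0 cpoly_apply_pCons scaleC_zero_right scaleC_add_right scaleC_scaleC
       clinear_ops_scaleC)

lemma cpoly_apply_linear_factor:
  assumes "a \<in> clinear_ops"
  shows "cpoly_apply ([:- z, 1:] * p) a x
       = blinfun_apply a (cpoly_apply p a x) - z *\<^sub>C cpoly_apply p a x"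
proof -
  have "[:- z, 1:] * p = smult (- z) p + pCons 0 p" by simp
  then show ?thesis
    by (simp only: cpoly_apply_add cpoly_apply_smult[OF assms] cpoly_apply_pCons scaleC_zero_left
        scaleC_minus_left) simp
qed

lemma cpoly_apply_of_real:
  "cpoly_apply (map_poly of_real q) a x = blinfun_apply (poly_op q a) x"
  by (induction q)
     (simp_all add: map_poly_pCons cpoly_apply_0 poly_op_0 cpoly_apply_pCons poly_op_pCons
       blinfun.add_left blinfun.scaleR_left scaleC_of_real)

section \<open>Continuous functional calculus of a positive operator\<close>

definition positive_op :: "('h::chilbert_space \<Rightarrow>\<^sub>L 'h) \<Rightarrow> bool" where
  "positive_op h \<longleftrightarrow> h \<in> clinear_ops \<and> op_adj h = h \<and> (\<forall>x. 0 \<le> Re (cinner (blinfun_apply h x) x))"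

lemma positive_op_adj_compose:
  assumes "a \<in> clinear_ops" shows "positive_op (op_adj a o\<^sub>L a)"
  using assms
  by (auto simp: positive_op_def clinear_ops_compose op_adj_clinear op_adj_compose op_adj_adj
      cinner_adj_left cinner_self)

text \<open>A complex number off \<open>[0, \<parallel>h\<parallel>]\<close> is not in the approximate point spectrum of \<open>h\<close>: the
  numerical range of \<open>h\<close> lies in this interval.\<close>

lemma positive_op_bounded_below:
  assumes h: "positive_op h" and z: "z \<notin> complex_of_real ` {0..norm h}"
  obtains d where "d > 0" "\<And>x. d * norm x \<le> norm (blinfun_apply h x - z *\<^sub>C x)"
proof -
  note bd = that
  have cl: "h \<in> clinear_ops" and self: "op_adj h = h"
    and pos: "\<And>x. 0 \<le> Re (cinner (blinfun_apply h x) x)" using h by (auto simp: positive_op_def)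
  have *: thesis if d: "d > 0"
    and le: "\<And>x. d * (norm x)\<^sup>2 \<le> cmod (cinner (blinfun_apply h x - z *\<^sub>C x) x)" for d
  proof (rule bd[OF d])
    fix x
    show "d * norm x \<le> norm (blinfun_apply h x - z *\<^sub>C x)"
    proof (cases "x = 0")
      case False
      have "d * norm x * norm x \<le> norm (blinfun_apply h x - z *\<^sub>C x) * norm x"
        using le[of x] cinner_Cauchy_Schwarz[of "blinfun_apply h x - z *\<^sub>C x" x]
        by (simp add: power2_eq_square mult.assoc)
      then show ?thesis using False by (metis mult_le_cancel_right_pos zero_less_norm_iff)
    qed simp
  qed
  have im: "Im (cinner (blinfun_apply h x) x) = 0" for x
    using cinner_adj_left[OF cl, of x x] cinner_commute[of x "blinfun_apply h x"]
    by (simp add: self complex_eq_iff)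
  have expand: "cinner (blinfun_apply h x - z *\<^sub>C x) x = cinner (blinfun_apply h x) x - z * of_real ((norm x)\<^sup>2)" for x
    by (simp add: cinner_diff_left cinner_scaleC_left cinner_self)
  have upper: "Re (cinner (blinfun_apply h x) x) \<le> norm h * (norm x)\<^sup>2" for x
  proof -
    have "Re (cinner (blinfun_apply h x) x) \<le> norm (blinfun_apply h x) * norm x"
      using Re_cinner_Cauchy_Schwarz abs_le_D1 by blast
    also have "\<dots> \<le> norm h * norm x * norm x" by (intro mult_right_mono norm_blinfun) simp
    finally show ?thesis by (simp add: power2_eq_square mult.assoc)
  qed
  consider "Im z \<noteq> 0" | "Im z = 0" "Re z < 0" | "Im z = 0" "Re z > norm h"
  proof (cases "Im z = 0 \<and> 0 \<le> Re z \<and> Re z \<le> norm h")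
    case True
    then have "z = complex_of_real (Re z)" "Re z \<in> {0..norm h}" by (auto simp: complex_eq_iff)
    then show thesis using z by blast
  qed (use that in force)
  then show thesis
  proof cases
    case 1
    show thesis
    proof (rule *[of "\<bar>Im z\<bar>"])
      show "\<bar>Im z\<bar> * (norm x)\<^sup>2 \<le> cmod (cinner (blinfun_apply h x - z *\<^sub>C x) x)" for x
        using abs_Im_le_cmod[of "cinner (blinfun_apply h x - z *\<^sub>C x) x"]
        unfolding expand by (simp add: im abs_mult)
    qed (use 1 in simp)
  next
    case 2
    show thesis
    proof (rule *[of "- Re z"])
      show "- Re z * (norm x)\<^sup>2 \<le> cmod (cinner (blinfun_apply h x - z *\<^sub>C x) x)" for x
        using abs_Re_le_cmod[of "cinner (blinfun_apply h x - z *\<^sub>C x) x"] pos[of x]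
        unfolding expand by (simp add: 2)
    qed (use 2 in simp)
  next
    case 3
    show thesis
    proof (rule *[of "Re z - norm h"])
      show "(Re z - norm h) * (norm x)\<^sup>2 \<le> cmod (cinner (blinfun_apply h x - z *\<^sub>C x) x)" for x
        using abs_Re_le_cmod[of "cinner (blinfun_apply h x - z *\<^sub>C x) x"] upper[of x]
        unfolding expand by (simp add: 3 left_diff_distrib)
    qed (use 3 in simp)
  qed
qed

text \<open>A product of linear factors is bounded below if every factor is.\<close>

lemma cpoly_bounded_below:
  assumes h: "positive_op h" and "p \<noteq> 0"
    and "\<And>z. poly p z = 0 \<Longrightarrow> z \<notin> complex_of_real ` {0..norm h}"
  shows "\<exists>d>0. \<forall>x. d * norm x \<le> norm (cpoly_apply p h x)"
  using assms(2,3)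
proof (induction "degree p" arbitrary: p)
  case 0
  then obtain c where "p = [:c:]" "c \<noteq> 0" by (metis degree_eq_zeroE pCons_0_0)
  then show ?case
    by (intro exI[of _ "cmod c"]) (simp add: cpoly_apply_pCons cpoly_apply_0 norm_scaleC)
next
  case (Suc n)
  then obtain z where z: "poly p z = 0"
    using fundamental_theorem_of_algebra[of p] constant_degree[of p] by auto
  then obtain p' where p': "p = [:- z, 1:] * p'" by (metis dvdE poly_eq_0_iff_dvd)
  have "p' \<noteq> 0" using Suc.prems p' by auto
  then have "degree p = Suc (degree p')" unfolding p' by (subst degree_mult_eq) auto
  then have "\<exists>d>0. \<forall>x. d * norm x \<le> norm (cpoly_apply p' h x)"
    using Suc.hyps \<open>p' \<noteq> 0\<close> Suc.prems by (intro Suc.hyps(1)) (auto simp: p')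
  then obtain d where d: "d > 0" "\<And>x. d * norm x \<le> norm (cpoly_apply p' h x)" by blast
  obtain e where e: "e > 0" "\<And>x. e * norm x \<le> norm (blinfun_apply h x - z *\<^sub>C x)"
    using positive_op_bounded_below[OF h, of z] Suc.prems z by blast
  have "e * d * norm x \<le> norm (cpoly_apply p h x)" for x
  proof -
    have "e * (d * norm x) \<le> e * norm (cpoly_apply p' h x)" using d e by (intro mult_left_mono) auto
    also have "\<dots> \<le> norm (cpoly_apply p h x)"
      unfolding p' using h e by (subst cpoly_apply_linear_factor) (auto simp: positive_op_def)
    finally show ?thesis by (simp only: mult.assoc)
  qed
  then show ?case using d e by (intro exI[of _ "e * d"]) auto
qed

text \<open>With \<open>T = q(h)\<close> and \<open>\<mu> = \<parallel>T\<parallel>\<close>, self-adjointness makes \<open>T\<^sup>2 - \<mu>\<^sup>2\<close> fail to be bounded below, so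
  the polynomial \<open>q\<^sup>2 - \<mu>\<^sup>2\<close> has a root in \<open>[0, \<parallel>h\<parallel>]\<close>.\<close>

lemma norm_poly_op_le:
  assumes h: "positive_op h" and S: "\<And>x. x \<in> {0..norm h} \<Longrightarrow> \<bar>poly q x\<bar> \<le> S"
  shows "norm (poly_op q h) \<le> S"
proof (rule ccontr)
  assume "\<not> norm (poly_op q h) \<le> S"
  define T where "T = poly_op q h"
  define \<mu> where "\<mu> = norm T"
  have cl: "h \<in> clinear_ops" and self: "op_adj h = h" using h by (auto simp: positive_op_def)
  have S0: "0 \<le> S" using S[of 0] by simp
  have \<mu>: "S < \<mu>" "0 < \<mu>" using \<open>\<not> norm (poly_op q h) \<le> S\<close> S0 unfolding \<mu>_def T_def by auto
  have Tcl: "T \<in> clinear_ops" and Tself: "op_adj T = T"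
    unfolding T_def using cl self by (auto intro: poly_op_clinear op_adj_poly_op)
  \<comment> \<open>The square takes care of both signs of the spectral value of modulus \<open>\<mu>\<close> at once.\<close>
  define p where "p = q * q - [:\<mu>\<^sup>2:]"
  have nz: "poly p x \<noteq> 0" if "x \<in> {0..norm h}" for x
  proof
    assume "poly p x = 0"
    then have "(poly q x)\<^sup>2 = \<mu>\<^sup>2" by (simp add: p_def power2_eq_square)
    then have "\<bar>poly q x\<bar> = \<mu>" using \<mu> by (metis abs_of_pos power2_eq_iff abs_minus_cancel)
    then show False using S[OF that] \<mu> by simp
  qed
  let ?P = "map_poly of_real p :: complex poly"
  have "\<exists>d>0. \<forall>x. d * norm x \<le> norm (cpoly_apply ?P h x)"
  proof (rule cpoly_bounded_below[OF h])
    have "poly p 0 \<noteq> 0" using nz[of 0] by simp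
    then have "p \<noteq> 0" by auto
    then show "?P \<noteq> 0" by (metis map_poly_0 of_real_0 of_real_eq_iff map_poly_eq_0_iff of_real_eq_0_iff)
    fix z assume "poly ?P z = 0"
    moreover have "poly ?P (of_real x) = of_real (poly p x)" for x
      by (induction p) (simp_all add: map_poly_pCons)
    ultimately show "z \<notin> complex_of_real ` {0..norm h}" using nz by auto
  qed
  then obtain d where d: "d > 0" "\<And>x. d * norm x \<le> norm (blinfun_apply (poly_op p h) x)"
    unfolding cpoly_apply_of_real by blast
  have pT: "blinfun_apply (poly_op p h) x = blinfun_apply T (blinfun_apply T x) - \<mu>\<^sup>2 *\<^sub>R x" for x
    by (simp add: p_def poly_op_diff poly_op_mult poly_op_pCons poly_op_0 compose_zero_right T_def blinfun.diff_left
        blinfun.scaleR_left)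
  \<comment> \<open>A lower bound \<open>d\<close> for \<open>T\<^sup>2 - \<mu>\<^sup>2\<close> pushes \<open>\<parallel>T\<parallel>\<^sup>2\<close> below \<open>\<mu>\<^sup>2 - k\<close>, a contradiction.\<close>
  define k where "k = d\<^sup>2 / (2 * \<mu>\<^sup>2)"
  have k: "0 < k" unfolding k_def using d \<mu> by simp
  have bound: "(norm (blinfun_apply T x))\<^sup>2 \<le> (\<mu>\<^sup>2 - k) * (norm x)\<^sup>2" for x
  proof -
    have nT: "norm (blinfun_apply T y) \<le> \<mu> * norm y" for y unfolding \<mu>_def by (rule norm_blinfun)
    have "(d * norm x)\<^sup>2 \<le> (norm (blinfun_apply T (blinfun_apply T x) + - (\<mu>\<^sup>2 *\<^sub>R x)))\<^sup>2"
      using d(2)[of x] d(1) unfolding pT by (intro power_mono) auto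
    also have "\<dots> = (norm (blinfun_apply T (blinfun_apply T x)))\<^sup>2 + \<mu>\<^sup>2 * \<mu>\<^sup>2 * (norm x)\<^sup>2
        - 2 * \<mu>\<^sup>2 * Re (cinner (blinfun_apply T (blinfun_apply T x)) x)"
      unfolding norm_add_square
      by (simp add: cinner_minus_right cinner_scaleR_right power_mult_distrib power2_eq_square)
    also have "Re (cinner (blinfun_apply T (blinfun_apply T x)) x) = (norm (blinfun_apply T x))\<^sup>2"
      using cinner_adj_left[OF Tcl, of "blinfun_apply T x" x] by (simp add: Tself cinner_self)
    also have "(norm (blinfun_apply T (blinfun_apply T x)))\<^sup>2 \<le> \<mu>\<^sup>2 * (\<mu>\<^sup>2 * (norm x)\<^sup>2)"
    proof -
      have "norm (blinfun_apply T (blinfun_apply T x)) \<le> \<mu> * (\<mu> * norm x)"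
        using nT[of "blinfun_apply T x"] nT[of x] \<mu> by (meson mult_left_mono order_trans less_imp_le)
      then have "(norm (blinfun_apply T (blinfun_apply T x)))\<^sup>2 \<le> (\<mu> * (\<mu> * norm x))\<^sup>2"
        by (intro power_mono) auto
      then show ?thesis by (simp add: power_mult_distrib)
    qed
    finally have "d\<^sup>2 * (norm x)\<^sup>2 \<le> 2 * \<mu>\<^sup>2 * (\<mu>\<^sup>2 * (norm x)\<^sup>2 - (norm (blinfun_apply T x))\<^sup>2)"
      by (simp add: power_mult_distrib algebra_simps)
    then have "k * (norm x)\<^sup>2 \<le> \<mu>\<^sup>2 * (norm x)\<^sup>2 - (norm (blinfun_apply T x))\<^sup>2"
      unfolding k_def using \<mu>(2) by (simp add: field_simps)
    then show ?thesis by (simp add: algebra_simps)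
  qed
  have "norm T \<le> sqrt (\<mu>\<^sup>2 - k)"
  proof (rule norm_blinfun_bound)
    show "norm (blinfun_apply T x) \<le> sqrt (\<mu>\<^sup>2 - k) * norm x" for x
    proof -
      have "sqrt ((norm (blinfun_apply T x))\<^sup>2) \<le> sqrt ((\<mu>\<^sup>2 - k) * (norm x)\<^sup>2)"
        using bound by (simp only: real_sqrt_le_iff)
      then show ?thesis by (simp add: real_sqrt_mult)
    qed
    have "\<mu>\<^sup>2 - k \<ge> 0"
    proof (rule ccontr)
      assume neg: "\<not> \<mu>\<^sup>2 - k \<ge> 0"
      have "blinfun_apply T x = 0" for x
      proof -
        have "(\<mu>\<^sup>2 - k) * (norm x)\<^sup>2 \<le> 0" using neg by (intro mult_nonpos_nonneg) auto
        then have "(norm (blinfun_apply T x))\<^sup>2 \<le> 0" using bound[of x] by linarith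
        then show ?thesis by simp
      qed
      then have "T = 0" by (intro blinfun_eqI) simp
      then show False using \<mu> \<mu>_def by simp
    qed
    then show "0 \<le> sqrt (\<mu>\<^sup>2 - k)" by simp
  qed
  then have "sqrt (\<mu>\<^sup>2) \<le> sqrt (\<mu>\<^sup>2 - k)" using \<mu> by (simp add: \<mu>_def[symmetric])
  then show False using k by (simp only: real_sqrt_le_iff)
qed

lemma polynomial_approximation:
  assumes "continuous_on {0..m} f"
  obtains q :: "nat \<Rightarrow> real poly" where "uniform_limit {0..m} (\<lambda>n. poly (q n)) f sequentially"
proof -
  have "\<exists>q :: real poly. \<forall>x\<in>{0..m}. \<bar>f x - poly q x\<bar> < inverse (real (Suc n))" for n
  proof -
    obtain g where g: "real_polynomial_function g" "\<And>x. x \<in> {0..m} \<Longrightarrow> \<bar>f x - g x\<bar> < inverse (real (Suc n))"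
      using Stone_Weierstrass_real_polynomial_function[of "{0..m}" f "inverse (real (Suc n))"] assms
      by (metis compact_Icc inverse_positive_iff_positive of_nat_0_less_iff zero_less_Suc)
    then obtain a k where "g = (\<lambda>x. \<Sum>i\<le>k. a i * x ^ i)"
      using real_polynomial_function_iff_sum by blast
    then have "g x = poly (\<Sum>i\<le>k. monom (a i) i) x" for x
      by (simp add: poly_sum poly_monom)
    then show ?thesis using g(2) by metis
  qed
  then obtain q :: "nat \<Rightarrow> real poly" where
    q: "\<And>n x. x \<in> {0..m} \<Longrightarrow> \<bar>f x - poly (q n) x\<bar> < inverse (real (Suc n))" by metis
  have "uniform_limit {0..m} (\<lambda>n. poly (q n)) f sequentially"
  proof (rule uniform_limitI)
    fix e :: real assume "e > 0"
    then obtain K where K: "inverse (real (Suc K)) < e" using reals_Archimedean by blast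
    have "dist (poly (q n) x) (f x) < e" if "n \<ge> K" "x \<in> {0..m}" for n x
    proof -
      have "inverse (real (Suc n)) \<le> inverse (real (Suc K))" using that by (simp add: field_simps)
      then have "\<bar>f x - poly (q n) x\<bar> < e" using q[OF that(2), of n] K by linarith
      then show ?thesis by (simp add: dist_real_def abs_minus_commute)
    qed
    then show "\<forall>\<^sub>F n in sequentially. \<forall>x\<in>{0..m}. dist (poly (q n) x) (f x) < e"
      unfolding eventually_sequentially by blast
  qed
  then show ?thesis by (rule that)
qed

text \<open>Any two approximating sequences of polynomials are uniformly close on \<open>[0, \<parallel>h\<parallel>]\<close>, hence
  close as polynomials of \<open>h\<close>: the defining limit exists and depends on \<open>f\<close> alone.\<close>

lemma pos_fun_calc_tendsto:
  assumes h: "positive_op h"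
    and q: "uniform_limit {0..norm h} (\<lambda>n. poly (q n)) f sequentially"
  shows "(\<lambda>n. poly_op (q n) h) \<longlonglongrightarrow> pos_fun_calc f h"
proof -
  have near: "\<exists>K. \<forall>m\<ge>K. \<forall>n\<ge>K. norm (poly_op (q m) h - poly_op (r n) h) < e"
    if q: "uniform_limit {0..norm h} (\<lambda>n. poly (q n)) f sequentially"
      and r: "uniform_limit {0..norm h} (\<lambda>n. poly (r n)) f sequentially" and e: "e > 0"
    for q r :: "nat \<Rightarrow> real poly" and e
  proof -
    have "\<forall>\<^sub>F n in sequentially. (\<forall>x\<in>{0..norm h}. dist (poly (q n) x) (f x) < e / 4)
        \<and> (\<forall>x\<in>{0..norm h}. dist (poly (r n) x) (f x) < e / 4)"
      using uniform_limitD[OF q, of "e / 4"] uniform_limitD[OF r, of "e / 4"] e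
      by (auto intro: eventually_conj)
    then obtain K where
      K: "\<And>n x. n \<ge> K \<Longrightarrow> x \<in> {0..norm h} \<Longrightarrow> dist (poly (q n) x) (f x) < e / 4 \<and> dist (poly (r n) x) (f x) < e / 4"
      unfolding eventually_sequentially by blast
    have "norm (poly_op (q m) h - poly_op (r n) h) < e" if "m \<ge> K" "n \<ge> K" for m n
    proof -
      have "norm (poly_op (q m - r n) h) \<le> e / 2"
      proof (rule norm_poly_op_le[OF h])
        fix x assume x: "x \<in> {0..norm h}"
        show "\<bar>poly (q m - r n) x\<bar> \<le> e / 2"
          using K[OF that(1) x] K[OF that(2) x] unfolding dist_real_def poly_diff by argo
      qed
      then show ?thesis using e by (simp add: poly_op_diff)
    qed
    then show ?thesis by blast
  qed
  have "Cauchy (\<lambda>n. poly_op (q n) h)" using near[OF q q] by (intro CauchyI) blast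
  then obtain c where c: "(\<lambda>n. poly_op (q n) h) \<longlonglongrightarrow> c" using Cauchy_convergent convergent_def by blast
  have all: "(\<lambda>n. poly_op (r n) h) \<longlonglongrightarrow> c"
    if r: "uniform_limit {0..norm h} (\<lambda>n. poly (r n)) f sequentially" for r
  proof -
    have "(\<lambda>n. poly_op (r n) h - poly_op (q n) h) \<longlonglongrightarrow> 0"
    proof (rule LIMSEQ_I)
      fix e :: real assume "e > 0"
      then show "\<exists>K. \<forall>n\<ge>K. norm (poly_op (r n) h - poly_op (q n) h - 0) < e"
        using near[OF r q, of e] by (metis diff_zero)
    qed
    from tendsto_add[OF this c] show ?thesis by simp
  qed
  have "pos_fun_calc f h = c" unfolding pos_fun_calc_def
  proof (rule the_equality)
    show "\<forall>r. uniform_limit {0..norm h} (\<lambda>n. poly (r n)) f sequentially \<longrightarrow> (\<lambda>n. poly_op (r n) h) \<longlonglongrightarrow> c"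
      using all by blast
    fix c' assume "\<forall>r. uniform_limit {0..norm h} (\<lambda>n. poly (r n)) f sequentially \<longrightarrow> (\<lambda>n. poly_op (r n) h) \<longlonglongrightarrow> c'"
    then show "c' = c" using q c LIMSEQ_unique by blast
  qed
  then show ?thesis using c by simp
qed

lemma pos_fun_calc_cong:
  assumes "\<And>x. x \<in> {0..norm h} \<Longrightarrow> f x = g x"
  shows "pos_fun_calc f h = pos_fun_calc g h"
proof -
  have "uniform_limit {0..norm h} q f sequentially \<longleftrightarrow> uniform_limit {0..norm h} q g sequentially"
    for q :: "nat \<Rightarrow> real \<Rightarrow> real"
    by (rule uniform_limit_cong') (use assms in auto)
  then show ?thesis unfolding pos_fun_calc_def by (simp only:)
qed

lemma pos_fun_calc_poly:
  assumes "positive_op h" shows "pos_fun_calc (poly q) h = poly_op q h"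
proof -
  have "(\<lambda>n::nat. poly_op q h) \<longlonglongrightarrow> pos_fun_calc (poly q) h"
    by (rule pos_fun_calc_tendsto[OF assms]) (rule uniform_limit_const)
  then show ?thesis by (simp add: LIMSEQ_const_iff)
qed

lemma pos_fun_calc_const:
  assumes "positive_op h" shows "pos_fun_calc (\<lambda>x. c) h = c *\<^sub>R id_blinfun"
proof -
  have "poly [:c:] = (\<lambda>x. c)" by (rule ext) simp
  then show ?thesis
    using pos_fun_calc_poly[OF assms, of "[:c:]"] by (simp add: poly_op_pCons poly_op_0 compose_zero_right)
qed

lemma pos_fun_calc_ident:
  assumes "positive_op h" shows "pos_fun_calc (\<lambda>x. x) h = h"
proof -
  have "poly [:0, 1:] = (\<lambda>x::real. x)" by (rule ext) simp
  then show ?thesis using pos_fun_calc_poly[OF assms, of "[:0, 1:]"]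
    by (simp add: poly_op_pCons poly_op_0 compose_zero_right blinfun_compose_id_right)
qed

context
  fixes h :: "'h::chilbert_space \<Rightarrow>\<^sub>L 'h"
  assumes h: "positive_op h"
begin

lemma pos_fun_calc_approx:
  assumes "continuous_on {0..norm h} f"
  obtains q where "uniform_limit {0..norm h} (\<lambda>n. poly (q n)) f sequentially"
    "(\<lambda>n. poly_op (q n) h) \<longlonglongrightarrow> pos_fun_calc f h"
  by (rule polynomial_approximation[OF assms]) (rule that, assumption, rule pos_fun_calc_tendsto[OF h])

lemma pos_fun_calc_in:
  assumes "von_neumann_algebra A" "h \<in> A" "continuous_on {0..norm h} f"
  shows "pos_fun_calc f h \<in> A"
proof -
  obtain q where q: "(\<lambda>n. poly_op (q n) h) \<longlonglongrightarrow> pos_fun_calc f h"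
    by (rule pos_fun_calc_approx[OF assms(3)])
  show ?thesis
    by (rule closed_sequentially[OF von_neumann_closed[OF assms(1)] _ q]) (rule poly_op_in[OF assms(1,2)])
qed

lemma pos_fun_calc_clinear:
  assumes "continuous_on {0..norm h} f"
  shows "pos_fun_calc f h \<in> clinear_ops"
proof -
  obtain q where q: "(\<lambda>n. poly_op (q n) h) \<longlonglongrightarrow> pos_fun_calc f h"
    by (rule pos_fun_calc_approx[OF assms])
  have "h \<in> clinear_ops" using h by (simp add: positive_op_def)
  then show ?thesis
    by (intro closed_sequentially[OF closed_clinear_ops _ q] poly_op_clinear)
qed

lemma pos_fun_calc_self_adjoint:
  assumes "continuous_on {0..norm h} f"
  shows "op_adj (pos_fun_calc f h) = pos_fun_calc f h"
proof -
  obtain q where q: "(\<lambda>n. poly_op (q n) h) \<longlonglongrightarrow> pos_fun_calc f h"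
    by (rule pos_fun_calc_approx[OF assms])
  have cl: "h \<in> clinear_ops" and self: "op_adj h = h" using h by (auto simp: positive_op_def)
  let ?c = "pos_fun_calc f h"
  have "cinner (blinfun_apply ?c x) y = cinner x (blinfun_apply ?c y)" for x y
  proof (rule LIMSEQ_unique)
    show "(\<lambda>n. cinner (blinfun_apply (poly_op (q n) h) x) y) \<longlonglongrightarrow> cinner (blinfun_apply ?c x) y"
      by (intro bounded_bilinear.tendsto[OF bounded_bilinear_cinner] tendsto_const
          bounded_linear.tendsto[OF blinfun.bounded_linear_left] q)
    have "(\<lambda>n. cinner x (blinfun_apply (poly_op (q n) h) y)) \<longlonglongrightarrow> cinner x (blinfun_apply ?c y)"
      by (intro bounded_bilinear.tendsto[OF bounded_bilinear_cinner] tendsto_const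
          bounded_linear.tendsto[OF blinfun.bounded_linear_left] q)
    moreover have "cinner (blinfun_apply (poly_op (q n) h) x) y = cinner x (blinfun_apply (poly_op (q n) h) y)" for n
      using cinner_adj_left[OF poly_op_clinear[OF cl], of "q n" x y] by (simp add: op_adj_poly_op[OF cl self])
    ultimately show "(\<lambda>n. cinner (blinfun_apply (poly_op (q n) h) x) y) \<longlonglongrightarrow> cinner x (blinfun_apply ?c y)"
      by simp
  qed
  then show ?thesis by (intro op_adj_eqI pos_fun_calc_clinear[OF assms])
qed

lemma pos_fun_calc_diff:
  assumes f: "continuous_on {0..norm h} f" and g: "continuous_on {0..norm h} g"
  shows "pos_fun_calc (\<lambda>x. f x - g x) h = pos_fun_calc f h - pos_fun_calc g h"
proof -
  obtain p where p: "uniform_limit {0..norm h} (\<lambda>n. poly (p n)) f sequentially"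
      "(\<lambda>n. poly_op (p n) h) \<longlonglongrightarrow> pos_fun_calc f h"
    by (rule pos_fun_calc_approx[OF f])
  obtain q where q: "uniform_limit {0..norm h} (\<lambda>n. poly (q n)) g sequentially"
      "(\<lambda>n. poly_op (q n) h) \<longlonglongrightarrow> pos_fun_calc g h"
    by (rule pos_fun_calc_approx[OF g])
  have "poly (p n - q n) = (\<lambda>x. poly (p n) x - poly (q n) x)" for n by (rule ext) simp
  then have "uniform_limit {0..norm h} (\<lambda>n. poly (p n - q n)) (\<lambda>x. f x - g x) sequentially"
    using uniform_limit_minus[OF p(1) q(1)] by simp
  from pos_fun_calc_tendsto[OF h this] tendsto_diff[OF p(2) q(2)]
  show ?thesis unfolding poly_op_diff by (rule LIMSEQ_unique)
qed

lemma pos_fun_calc_mult: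
  assumes f: "continuous_on {0..norm h} f" and g: "continuous_on {0..norm h} g"
  shows "pos_fun_calc (\<lambda>x. f x * g x) h = pos_fun_calc f h o\<^sub>L pos_fun_calc g h"
proof -
  obtain p where p: "uniform_limit {0..norm h} (\<lambda>n. poly (p n)) f sequentially"
      "(\<lambda>n. poly_op (p n) h) \<longlonglongrightarrow> pos_fun_calc f h"
    by (rule pos_fun_calc_approx[OF f])
  obtain q where q: "uniform_limit {0..norm h} (\<lambda>n. poly (q n)) g sequentially"
      "(\<lambda>n. poly_op (q n) h) \<longlonglongrightarrow> pos_fun_calc g h"
    by (rule pos_fun_calc_approx[OF g])
  have "bounded (f ` {0..norm h})" "bounded (g ` {0..norm h})"
    by (auto intro!: compact_imp_bounded compact_continuous_image f g)
  moreover have "poly (p n * q n) = (\<lambda>x. poly (p n) x * poly (q n) x)" for n by (rule ext) simp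
  ultimately have "uniform_limit {0..norm h} (\<lambda>n. poly (p n * q n)) (\<lambda>x. f x * g x) sequentially"
    using uniform_lim_mult[OF p(1) q(1)] by simp
  from pos_fun_calc_tendsto[OF h this] tendsto_compose[OF p(2) q(2)]
  show ?thesis unfolding poly_op_mult by (rule LIMSEQ_unique)
qed

text \<open>\<open>f(h)\<close> is the square of the self-adjoint operator \<open>(\<surd>f)(h)\<close>.\<close>

lemma pos_fun_calc_positive:
  assumes f: "continuous_on {0..norm h} f" and "\<And>x. x \<in> {0..norm h} \<Longrightarrow> 0 \<le> f x"
  shows "positive_op (pos_fun_calc f h)"
proof -
  have s: "continuous_on {0..norm h} (\<lambda>x. sqrt (f x))" by (intro continuous_intros f)
  let ?s = "pos_fun_calc (\<lambda>x. sqrt (f x)) h"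
  have "pos_fun_calc f h = pos_fun_calc (\<lambda>x. sqrt (f x) * sqrt (f x)) h"
    by (rule pos_fun_calc_cong) (use assms in auto)
  also have "\<dots> = op_adj ?s o\<^sub>L ?s"
    using pos_fun_calc_mult[OF s s] pos_fun_calc_self_adjoint[OF s] by simp
  finally show ?thesis using positive_op_adj_compose[OF pos_fun_calc_clinear[OF s]] by simp
qed

end

lemma op_abs_positive:
  assumes "a \<in> clinear_ops" shows "positive_op (op_abs a)"
  unfolding op_abs_def
  by (rule pos_fun_calc_positive[OF positive_op_adj_compose[OF assms]]) (intro continuous_intros, simp)

lemma op_abs_square:
  assumes a: "a \<in> clinear_ops" shows "op_abs a o\<^sub>L op_abs a = op_adj a o\<^sub>L a"
proof -
  let ?b = "op_adj a o\<^sub>L a"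
  have b: "positive_op ?b" by (rule positive_op_adj_compose[OF a])
  have s: "continuous_on {0..norm ?b} sqrt" by (intro continuous_intros)
  have "op_abs a o\<^sub>L op_abs a = pos_fun_calc (\<lambda>x. sqrt x * sqrt x) ?b"
    unfolding op_abs_def by (rule pos_fun_calc_mult[OF b s s, symmetric])
  also have "\<dots> = pos_fun_calc (\<lambda>x. x) ?b" by (rule pos_fun_calc_cong) simp
  also have "\<dots> = ?b" by (rule pos_fun_calc_ident[OF b])
  finally show ?thesis .
qed

lemma op_abs_in:
  assumes "von_neumann_algebra A" "a \<in> A" shows "op_abs a \<in> A"
proof -
  have "a \<in> clinear_ops" using assms von_neumann_rules(1) by blast
  then show ?thesis unfolding op_abs_def
    by (intro pos_fun_calc_in[OF _ assms(1)] positive_op_adj_compose continuous_intros)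
       (simp_all add: assms von_neumann_rules[OF assms(1)])
qed

section \<open>The trace and the noncommutative norms with exponents 1 and 2\<close>

locale wstar_space =
  fixes A :: "('h::chilbert_space \<Rightarrow>\<^sub>L 'h) set" and E :: "('h \<Rightarrow>\<^sub>L 'h) \<Rightarrow> complex"
  assumes wstar: "wstar_prob_space A E"
begin

lemma vn: "von_neumann_algebra A"
  using wstar by (simp add: wstar_prob_space_def)

lemmas rules = von_neumann_rules[OF vn]

lemma clin: "a \<in> A \<Longrightarrow> a \<in> clinear_ops" using rules(1) by blast

lemma E_add: "a \<in> A \<Longrightarrow> b \<in> A \<Longrightarrow> E (a + b) = E a + E b"
  and E_scaleC: "a \<in> A \<Longrightarrow> E (op_scaleC c a) = c * E a"
  and E_id: "E id_blinfun = 1"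
  and E_pos: "a \<in> A \<Longrightarrow> 0 \<le> Re (E (op_adj a o\<^sub>L a))"
  and E_real: "a \<in> A \<Longrightarrow> Im (E (op_adj a o\<^sub>L a)) = 0"
  and E_trace: "a \<in> A \<Longrightarrow> b \<in> A \<Longrightarrow> E (a o\<^sub>L b) = E (b o\<^sub>L a)"
proof -
  note w = wstar[unfolded wstar_prob_space_def faithful_normal_tracial_state_def, THEN conjunct2]
  note w2 = w[THEN conjunct2, THEN conjunct2]
  show "E (a + b) = E a + E b" if "a \<in> A" "b \<in> A" using bspec[OF bspec[OF w[THEN conjunct1] that(1)] that(2)] .
  show "E (op_scaleC c a) = c * E a" if "a \<in> A"
    using w[THEN conjunct2, THEN conjunct1, THEN spec, of c] that by (rule bspec)
  show "E id_blinfun = 1" using w2 by (rule conjunct1)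
  have "Im (E (op_adj a o\<^sub>L a)) = 0 \<and> 0 \<le> Re (E (op_adj a o\<^sub>L a))" if "a \<in> A"
    using w2[THEN conjunct2, THEN conjunct1] that by (rule bspec)
  then show "0 \<le> Re (E (op_adj a o\<^sub>L a))" "Im (E (op_adj a o\<^sub>L a)) = 0" if "a \<in> A"
    using that by simp_all
  show "E (a o\<^sub>L b) = E (b o\<^sub>L a)" if "a \<in> A" "b \<in> A"
    using bspec[OF bspec[OF w2[THEN conjunct2, THEN conjunct2, THEN conjunct2, THEN conjunct2] that(1)] that(2)] .
qed

lemma E_scaleR: "a \<in> A \<Longrightarrow> E (r *\<^sub>R a) = of_real r * E a"
  using E_scaleC[of a "of_real r"] by (simp add: op_scaleC_of_real)

lemma E_diff: "a \<in> A \<Longrightarrow> b \<in> A \<Longrightarrow> E (a - b) = E a - E b"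
  using E_add[of a "(- 1) *\<^sub>R b"] E_scaleR[of b "-1"] rules(7)[of b "-1"] by simp

text \<open>Positivity alone makes the trace hermitian: \<open>E((a + c)\<^sup>*(a + c))\<close> is real for \<open>c = 1\<close> and
  for \<open>c = \<i>\<close>.\<close>

lemma E_adj:
  assumes a: "a \<in> A" shows "E (op_adj a) = cnj (E a)"
proof -
  note mem = a rules(2) rules(6)[OF a] rules(5)[OF a] rules(5)[OF rules(6)[OF a]]
  have expand: "E (op_adj (a + op_scaleC c id_blinfun) o\<^sub>L (a + op_scaleC c id_blinfun))
      = E (op_adj a o\<^sub>L a) + c * E (op_adj a) + cnj c * E a + cnj c * c" for c
  proof -
    have [simp]: "op_scaleC c id_blinfun \<in> A" for c by (rule rules(5)[OF rules(2)])
    have adj: "op_adj (a + op_scaleC c id_blinfun) = op_adj a + op_scaleC (cnj c) id_blinfun"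
      using clin[OF a] by (simp add: op_adj_add clinear_ops_op_scaleC clinear_ops_id op_adj_op_scaleC op_adj_id)
    have "op_adj (a + op_scaleC c id_blinfun) o\<^sub>L (a + op_scaleC c id_blinfun)
        = ((op_adj a o\<^sub>L a) + op_scaleC c (op_adj a)) + (op_scaleC (cnj c) a + op_scaleC (cnj c * c) id_blinfun)"
      unfolding adj
      by (rule blinfun_eqI)
         (simp add: blinfun.add_left blinfun.add_right op_scaleC_apply clinear_ops_scaleC[OF op_adj_clinear[OF clin[OF a]]]
           scaleC_add_right scaleC_scaleC)
    then show ?thesis by (simp add: E_add E_scaleC E_id mem rules)
  qed
  have mem1: "a + op_scaleC c id_blinfun \<in> A" for c using mem by (simp add: rules)
  have "Im (E (op_adj a) + E a) = 0"
    using expand[of 1] E_real[OF a] E_real[OF mem1[of 1]] by simp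
  moreover have "Re (E (op_adj a)) - Re (E a) = 0"
    using expand[of \<i>] E_real[OF a] E_real[OF mem1[of \<i>]] by simp
  ultimately show ?thesis by (simp add: complex_eq_iff)
qed

text \<open>The \<open>L\<^sup>2\<close>-norm without functional calculus; \<open>nc_norm_2\<close> below identifies it.\<close>

definition l2 :: "('h \<Rightarrow>\<^sub>L 'h) \<Rightarrow> real" where
  "l2 a = sqrt (Re (E (op_adj a o\<^sub>L a)))"

lemma l2_square: "a \<in> A \<Longrightarrow> (l2 a)\<^sup>2 = Re (E (op_adj a o\<^sub>L a))"
  unfolding l2_def using E_pos by simp

lemma l2_nonneg: "0 \<le> l2 a" if "a \<in> A"
  unfolding l2_def using E_pos[OF that] by simp

lemma l2_scaleR: "a \<in> A \<Longrightarrow> l2 (r *\<^sub>R a) = \<bar>r\<bar> * l2 a"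
  unfolding l2_def
  by (simp add: op_adj_scaleR clin compose_scaleR_left compose_scaleR_right E_scaleR rules real_sqrt_mult
      flip: power2_eq_square mult.assoc)

lemma l2_adj: "a \<in> A \<Longrightarrow> l2 (op_adj a) = l2 a"
  unfolding l2_def by (simp add: op_adj_adj clin E_trace rules)

lemma E_cross: "x \<in> A \<Longrightarrow> y \<in> A \<Longrightarrow> E (op_adj x o\<^sub>L y) = cnj (E (op_adj y o\<^sub>L x))"
  using E_adj[of "op_adj y o\<^sub>L x"] by (simp add: rules op_adj_compose clin op_adj_adj)

lemma l2_add_square:
  assumes "x \<in> A" "y \<in> A"
  shows "(l2 (x + y))\<^sup>2 = (l2 x)\<^sup>2 + (l2 y)\<^sup>2 + 2 * Re (E (op_adj y o\<^sub>L x))"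
proof -
  have "op_adj (x + y) o\<^sub>L (x + y)
      = ((op_adj x o\<^sub>L x) + (op_adj y o\<^sub>L y)) + ((op_adj y o\<^sub>L x) + (op_adj x o\<^sub>L y))"
    using assms by (simp add: op_adj_add clin compose_add_left compose_add_right)
  then show ?thesis using assms E_cross[of x y] by (simp add: l2_square rules E_add)
qed

lemma E_Cauchy_Schwarz_adj:
  assumes x: "x \<in> A" and y: "y \<in> A"
  shows "cmod (E (op_adj y o\<^sub>L x)) \<le> l2 x * l2 y"
proof -
  obtain u where u: "cmod u = 1" "u * E (op_adj y o\<^sub>L x) = of_real (cmod (E (op_adj y o\<^sub>L x)))"
    by (rule unimodular_rotation)
  define z where "z = op_scaleC u x"
  have zA: "z \<in> A" unfolding z_def by (rule rules(5)[OF x])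
  have c: "op_adj w o\<^sub>L op_scaleC u x = op_scaleC u (op_adj w o\<^sub>L x)" if "w \<in> A" for w
    by (rule blinfun_eqI) (simp add: op_scaleC_apply clinear_ops_scaleC[OF op_adj_clinear[OF clin[OF that]]])
  have lz: "l2 z = l2 x"
  proof -
    have "op_adj z o\<^sub>L z = op_scaleC (cnj u * u) (op_adj x o\<^sub>L x)" unfolding z_def
      using clin[OF x] by (intro blinfun_eqI)
        (simp add: op_adj_op_scaleC op_scaleC_apply clinear_ops_scaleC[OF op_adj_clinear[OF clin[OF x]]] scaleC_scaleC)
    moreover have "cnj u * u = 1" using u(1) complex_norm_square[of u] by (simp add: mult.commute)
    ultimately show ?thesis unfolding l2_def using x by (simp add: E_scaleC rules)
  qed
  have zE: "Re (E (op_adj y o\<^sub>L z)) = cmod (E (op_adj y o\<^sub>L x))"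
    unfolding z_def c[OF y] using x y u by (simp add: E_scaleC rules)
  have "0 \<le> (l2 z)\<^sup>2 + 2 * t * Re (E (op_adj y o\<^sub>L z)) + t\<^sup>2 * (l2 y)\<^sup>2" for t
  proof -
    have "0 \<le> (l2 (z + t *\<^sub>R y))\<^sup>2" by simp
    also have "\<dots> = (l2 z)\<^sup>2 + 2 * t * Re (E (op_adj y o\<^sub>L z)) + t\<^sup>2 * (l2 y)\<^sup>2"
      using zA y by (simp add: l2_add_square rules l2_scaleR power_mult_distrib op_adj_scaleR clin
          compose_scaleR_left E_scaleR)
    finally show ?thesis .
  qed
  then have "(Re (E (op_adj y o\<^sub>L z)))\<^sup>2 \<le> (l2 z)\<^sup>2 * (l2 y)\<^sup>2"
    by (rule quadratic_nonneg_discriminant) simp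
  then have "(cmod (E (op_adj y o\<^sub>L x)))\<^sup>2 \<le> (l2 x * l2 y)\<^sup>2"
    unfolding zE lz by (simp add: power_mult_distrib)
  then show ?thesis by (rule power2_le_imp_le) (simp add: l2_nonneg x y)
qed

lemma E_Cauchy_Schwarz: "x \<in> A \<Longrightarrow> y \<in> A \<Longrightarrow> cmod (E (x o\<^sub>L y)) \<le> l2 x * l2 y"
  using E_Cauchy_Schwarz_adj[of y "op_adj x"] by (simp add: rules op_adj_adj clin l2_adj mult.commute)

text \<open>A positive operator is the square of a self-adjoint element of the algebra, so the trace is
  positive on it, also after conjugation by any element.\<close>

lemma E_positive_conjugate:
  assumes d: "positive_op d" "d \<in> A" and x: "x \<in> A"
  shows "0 \<le> Re (E (op_adj x o\<^sub>L (d o\<^sub>L x)))"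
proof -
  define s where "s = pos_fun_calc sqrt d"
  have c: "continuous_on {0..norm d} sqrt" by (intro continuous_intros)
  have sA: "s \<in> A" unfolding s_def by (rule pos_fun_calc_in[OF d(1) vn d(2) c])
  have self: "op_adj s = s" unfolding s_def by (rule pos_fun_calc_self_adjoint[OF d(1) c])
  have "s o\<^sub>L s = pos_fun_calc (\<lambda>x. sqrt x * sqrt x) d"
    unfolding s_def by (rule pos_fun_calc_mult[OF d(1) c c, symmetric])
  also have "\<dots> = pos_fun_calc (\<lambda>x. x) d" by (rule pos_fun_calc_cong) simp
  also have "\<dots> = d" by (rule pos_fun_calc_ident[OF d(1)])
  finally have "op_adj x o\<^sub>L (d o\<^sub>L x) = op_adj (s o\<^sub>L x) o\<^sub>L (s o\<^sub>L x)"
    using x sA by (simp add: op_adj_compose clin self blinfun_compose_assoc[symmetric])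
       (simp add: blinfun_compose_assoc)
  then show ?thesis using E_pos[of "s o\<^sub>L x"] x sA by (simp add: rules)
qed

lemma E_positive: "positive_op d \<Longrightarrow> d \<in> A \<Longrightarrow> 0 \<le> Re (E d)"
  using E_positive_conjugate[of d id_blinfun]
  by (simp add: rules op_adj_id blinfun_compose_id_left blinfun_compose_id_right)

text \<open>The operator \<open>\<parallel>y\<parallel>\<^sup>2 - y\<^sup>*y\<close> is positive.\<close>

lemma l2_compose_le:
  assumes y: "y \<in> A" and x: "x \<in> A"
  shows "l2 (y o\<^sub>L x) \<le> norm y * l2 x"
proof -
  define d where "d = (norm y)\<^sup>2 *\<^sub>R id_blinfun - (op_adj y o\<^sub>L y)"
  have dA: "d \<in> A" unfolding d_def using y by (simp add: rules)
  have "0 \<le> Re (cinner (blinfun_apply d v) v)" for v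
  proof -
    have "Re (cinner (blinfun_apply d v) v) = (norm y * norm v)\<^sup>2 - (norm (blinfun_apply y v))\<^sup>2"
      unfolding d_def using clin[OF y]
      by (simp add: blinfun.diff_left blinfun.scaleR_left cinner_simps cinner_adj_left cinner_self
          power_mult_distrib)
    also have "\<dots> \<ge> 0" using norm_blinfun[of y v] by (simp add: power_mono)
    finally show ?thesis .
  qed
  moreover have "op_adj d = d" unfolding d_def using clin[OF y]
    by (simp add: op_adj_diff clinear_ops_scaleR clinear_ops_id clinear_ops_compose op_adj_clinear
        op_adj_scaleR op_adj_id op_adj_compose op_adj_adj)
  ultimately have "positive_op d" unfolding positive_op_def using clin[OF dA] by blast
  then have "0 \<le> Re (E (op_adj x o\<^sub>L (d o\<^sub>L x)))" using dA x by (rule E_positive_conjugate)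
  also have "op_adj x o\<^sub>L (d o\<^sub>L x) = (norm y)\<^sup>2 *\<^sub>R (op_adj x o\<^sub>L x) - (op_adj (y o\<^sub>L x) o\<^sub>L (y o\<^sub>L x))"
    unfolding d_def using x y
    by (simp add: compose_diff_left compose_diff_right compose_scaleR_left compose_scaleR_right
        blinfun_compose_id_left op_adj_compose clin blinfun_compose_assoc)
  also have "Re (E \<dots>) = (norm y)\<^sup>2 * (l2 x)\<^sup>2 - (l2 (y o\<^sub>L x))\<^sup>2"
    using x y by (simp add: E_diff E_scaleR rules l2_square)
  finally have "(l2 (y o\<^sub>L x))\<^sup>2 \<le> (norm y * l2 x)\<^sup>2" by (simp add: power_mult_distrib)
  then show ?thesis by (rule power2_le_imp_le) (simp add: l2_nonneg x)
qed

lemma l2_compose_le_right: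
  assumes "x \<in> A" "y \<in> A" shows "l2 (x o\<^sub>L y) \<le> l2 x * norm y"
  using l2_compose_le[of "op_adj y" "op_adj x"] l2_adj[of "x o\<^sub>L y"] assms
  by (simp add: rules op_adj_compose clin l2_adj norm_op_adj mult.commute)

lemma l2_id: "l2 id_blinfun = 1"
  by (simp add: l2_def op_adj_id blinfun_compose_id_left E_id)

lemma nc_norm_2:
  assumes a: "a \<in> A" shows "nc_norm E 2 a = l2 a"
proof -
  have h: "positive_op (op_abs a)" by (rule op_abs_positive[OF clin[OF a]])
  have c: "continuous_on {0..norm (op_abs a)} (\<lambda>x. x)" by (rule continuous_on_id)
  have "pos_fun_calc (\<lambda>x. x powr 2) (op_abs a) = pos_fun_calc (\<lambda>x. x * x) (op_abs a)"
    by (rule pos_fun_calc_cong) (auto simp: power2_eq_square[symmetric] powr_numeral)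
  also have "\<dots> = op_abs a o\<^sub>L op_abs a"
    by (simp add: pos_fun_calc_mult[OF h c c] pos_fun_calc_ident[OF h])
  finally show ?thesis
    using E_pos[OF a] by (simp add: nc_norm_def l2_def op_abs_square[OF clin[OF a]] powr_half_sqrt)
qed

lemma nc_norm_1:
  assumes a: "a \<in> A" shows "nc_norm E 1 a = Re (E (op_abs a))"
proof -
  have h: "positive_op (op_abs a)" by (rule op_abs_positive[OF clin[OF a]])
  have "pos_fun_calc (\<lambda>x. x powr 1) (op_abs a) = pos_fun_calc (\<lambda>x. x) (op_abs a)"
    by (rule pos_fun_calc_cong) auto
  then have "pos_fun_calc (\<lambda>x. x powr 1) (op_abs a) = op_abs a" by (simp add: pos_fun_calc_ident[OF h])
  then show ?thesis
    using E_positive[OF h op_abs_in[OF vn a]] by (simp add: nc_norm_def)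
qed

lemma nc_norm_1_le_2:
  assumes a: "a \<in> A" shows "nc_norm E 1 a \<le> l2 a"
proof -
  have h: "positive_op (op_abs a)" by (rule op_abs_positive[OF clin[OF a]])
  have hA: "op_abs a \<in> A" by (rule op_abs_in[OF vn a])
  have "op_adj (op_abs a) = op_abs a" using h by (simp add: positive_op_def)
  then have "l2 (op_abs a) = l2 a" unfolding l2_def by (simp add: op_abs_square[OF clin[OF a]])
  moreover have "Re (E (op_abs a)) \<le> l2 (op_abs a)"
    using E_Cauchy_Schwarz[OF rules(2) hA] complex_Re_le_cmod[of "E (op_abs a)"]
    by (simp add: blinfun_compose_id_left l2_id)
  ultimately show ?thesis using nc_norm_1[OF a] by simp
qed

lemma E_pos_fun_calc_mono:
  assumes h: "positive_op h" "h \<in> A"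
    and f: "continuous_on {0..norm h} f" and g: "continuous_on {0..norm h} g"
    and le: "\<And>x. x \<in> {0..norm h} \<Longrightarrow> f x \<le> g x"
  shows "Re (E (pos_fun_calc f h)) \<le> Re (E (pos_fun_calc g h))"
proof -
  have c: "continuous_on {0..norm h} (\<lambda>x. g x - f x)" by (intro continuous_intros f g)
  have "0 \<le> Re (E (pos_fun_calc (\<lambda>x. g x - f x) h))"
    by (rule E_positive) (use le in \<open>auto intro!: pos_fun_calc_positive[OF h(1) c] pos_fun_calc_in[OF h(1) vn h(2) c]\<close>)
  then show ?thesis
    using pos_fun_calc_in[OF h(1) vn h(2) f] pos_fun_calc_in[OF h(1) vn h(2) g]
    by (simp add: pos_fun_calc_diff[OF h(1) g f] E_diff)
qed

text \<open>In place of the polar decomposition, write \<open>a b = (a g)(k b)\<close> with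
  \<open>k = (\<bar>a\<bar> + e)\<^bsup>1/2\<^esup>\<close> and \<open>g = k\<^bsup>-1\<^esup>\<close>, and apply the Cauchy-Schwarz inequality:
  \<open>\<parallel>a g\<parallel>\<^sub>2\<^sup>2 = E[\<bar>a\<bar>\<^sup>2/(\<bar>a\<bar> + e)] \<le> E\<bar>a\<bar>\<close> and \<open>\<parallel>k b\<parallel>\<^sub>2\<^sup>2 \<le> \<parallel>b\<parallel>\<^sup>2 (E\<bar>a\<bar> + e)\<close>.\<close>

lemma E_Hoelder_1_infinity:
  assumes a: "a \<in> A" and b: "b \<in> A"
  shows "cmod (E (a o\<^sub>L b)) \<le> nc_norm E 1 a * norm b"
proof -
  define h where "h = op_abs a"
  have h: "positive_op h" unfolding h_def by (rule op_abs_positive[OF clin[OF a]])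
  have hA: "h \<in> A" unfolding h_def by (rule op_abs_in[OF vn a])
  have hh: "op_adj a o\<^sub>L a = h o\<^sub>L h" unfolding h_def by (rule op_abs_square[OF clin[OF a], symmetric])
  define n where "n = nc_norm E 1 a"
  have n: "n = Re (E h)" unfolding n_def h_def by (rule nc_norm_1[OF a])
  have n0: "0 \<le> n" unfolding n by (rule E_positive[OF h hA])
  have bound: "cmod (E (a o\<^sub>L b)) \<le> (n + e) * norm b" if e: "e > 0" for e
  proof -
    let ?k = "\<lambda>x::real. sqrt (x + e)" and ?g = "\<lambda>x::real. 1 / sqrt (x + e)"
    have ck: "continuous_on {0..norm h} ?k" by (intro continuous_intros)
    have cg: "continuous_on {0..norm h} ?g" by (intro continuous_intros) (use e in auto)
    have ci: "continuous_on {0..norm h} (\<lambda>x. x)" by (intro continuous_intros)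
    define k g where "k = pos_fun_calc ?k h" and "g = pos_fun_calc ?g h"
    note mem = pos_fun_calc_in[OF h vn hA]
    have kA: "k \<in> A" and gA: "g \<in> A" unfolding k_def g_def by (intro mem ck cg)+
    have kself: "op_adj k = k" and gself: "op_adj g = g"
      unfolding k_def g_def by (intro pos_fun_calc_self_adjoint[OF h] ck cg)+
    have "g o\<^sub>L k = pos_fun_calc (\<lambda>x. ?g x * ?k x) h"
      unfolding g_def k_def by (rule pos_fun_calc_mult[OF h cg ck, symmetric])
    also have "\<dots> = pos_fun_calc (\<lambda>x. 1) h" by (rule pos_fun_calc_cong) (use e in auto)
    finally have gk: "g o\<^sub>L k = id_blinfun" by (simp add: pos_fun_calc_const[OF h])
    have split: "a o\<^sub>L b = (a o\<^sub>L g) o\<^sub>L (k o\<^sub>L b)"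
      by (simp add: blinfun_compose_assoc) (simp add: blinfun_compose_assoc[symmetric] gk blinfun_compose_id_right)
    have chg: "continuous_on {0..norm h} (\<lambda>x. x * ?g x)" by (intro continuous_intros) (use e in auto)
    have cgh: "continuous_on {0..norm h} (\<lambda>x. ?g x * x)" by (intro continuous_intros) (use e in auto)
    have hg: "h o\<^sub>L g = pos_fun_calc (\<lambda>x. x * ?g x) h"
      using pos_fun_calc_mult[OF h ci cg] by (simp add: g_def pos_fun_calc_ident[OF h])
    have gh: "g o\<^sub>L h = pos_fun_calc (\<lambda>x. ?g x * x) h"
      using pos_fun_calc_mult[OF h cg ci] by (simp add: g_def pos_fun_calc_ident[OF h])
    have "op_adj (a o\<^sub>L g) o\<^sub>L (a o\<^sub>L g) = (g o\<^sub>L h) o\<^sub>L (h o\<^sub>L g)"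
      using a gA by (simp add: op_adj_compose clin gself)
        (metis blinfun_compose_assoc hh)
    also have "\<dots> = pos_fun_calc (\<lambda>x. (?g x * x) * (x * ?g x)) h"
      unfolding gh hg by (rule pos_fun_calc_mult[OF h cgh chg, symmetric])
    finally have "(l2 (a o\<^sub>L g))\<^sup>2 = Re (E (pos_fun_calc (\<lambda>x. (?g x * x) * (x * ?g x)) h))"
      using a gA by (simp add: l2_square rules)
    also have "\<dots> \<le> Re (E (pos_fun_calc (\<lambda>x. x) h))"
    proof (rule E_pos_fun_calc_mono[OF h hA _ ci])
      show "continuous_on {0..norm h} (\<lambda>x. (?g x * x) * (x * ?g x))" by (intro continuous_on_mult cgh chg)
      fix x assume "x \<in> {0..norm h}"
      then have x: "0 \<le> x" by simp
      have "(?g x * x) * (x * ?g x) = x * (x / (x + e))" using x e by (simp add: field_simps)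
      also have "\<dots> \<le> x * 1" using x e by (intro mult_left_mono) auto
      finally show "(?g x * x) * (x * ?g x) \<le> x" by simp
    qed
    also have "\<dots> = n" by (simp add: n pos_fun_calc_ident[OF h])
    finally have 1: "l2 (a o\<^sub>L g) \<le> sqrt n" by (rule real_le_rsqrt)
    have cke: "continuous_on {0..norm h} (\<lambda>x. x + e)" by (intro continuous_intros)
    have "op_adj k o\<^sub>L k = pos_fun_calc (\<lambda>x. ?k x * ?k x) h"
      unfolding kself unfolding k_def by (rule pos_fun_calc_mult[OF h ck ck, symmetric])
    also have "\<dots> = pos_fun_calc (\<lambda>x. x - (- e)) h" by (rule pos_fun_calc_cong) (use e in auto)
    also have "\<dots> = h + e *\<^sub>R id_blinfun"
      using pos_fun_calc_diff[OF h ci, of "\<lambda>x. - e"] by (simp add: pos_fun_calc_ident[OF h] pos_fun_calc_const[OF h])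
    finally have "(l2 k)\<^sup>2 = n + e" using kA hA by (simp add: l2_square E_add E_scaleR rules E_id n)
    then have 2: "l2 k \<le> sqrt (n + e)" by (simp add: real_le_rsqrt)
    have "cmod (E (a o\<^sub>L b)) \<le> l2 (a o\<^sub>L g) * l2 (k o\<^sub>L b)"
      unfolding split using a b kA gA by (intro E_Cauchy_Schwarz) (simp_all add: rules)
    also have "\<dots> \<le> sqrt n * (sqrt (n + e) * norm b)"
    proof (rule mult_mono[OF 1])
      have "l2 (k o\<^sub>L b) \<le> l2 k * norm b" using kA b by (rule l2_compose_le_right)
      also have "\<dots> \<le> sqrt (n + e) * norm b" using 2 by (rule mult_right_mono) simp
      finally show "l2 (k o\<^sub>L b) \<le> sqrt (n + e) * norm b" .
    qed (use n0 kA b in \<open>simp_all add: l2_nonneg rules\<close>)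
    also have "\<dots> \<le> sqrt (n + e) * (sqrt (n + e) * norm b)" using e n0 by (intro mult_right_mono) auto
    also have "\<dots> = (n + e) * norm b" using e n0 by (simp add: mult.assoc[symmetric])
    finally show ?thesis .
  qed
  show ?thesis
  proof (rule field_le_epsilon)
    fix e :: real assume e: "e > 0"
    have b1: "0 < norm b + 1" by (rule add_nonneg_pos) auto
    have "cmod (E (a o\<^sub>L b)) \<le> (n + e / (norm b + 1)) * norm b"
      by (rule bound[OF divide_pos_pos[OF e b1]])
    also have "\<dots> = n * norm b + e * (norm b / (norm b + 1))" by (simp add: algebra_simps)
    also have "\<dots> \<le> n * norm b + e * 1" using e b1 by (intro add_left_mono mult_left_mono) (auto simp: divide_le_eq_1)
    finally show "cmod (E (a o\<^sub>L b)) \<le> nc_norm E 1 a * norm b + e" by (simp add: n_def)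
  qed
qed

text \<open>The element \<open>b = (a (\<bar>a\<bar> + e)\<^bsup>-1\<^esup>)\<^sup>*\<close> approximates the adjoint of the polar part of \<open>a\<close>
  and, unlike it, comes from norm-continuous functional calculus.\<close>

lemma nc_norm_1_duality:
  assumes N: "von_neumann_algebra N" "N \<subseteq> A" and a: "a \<in> N" and e: "e > 0"
  obtains b where "b \<in> N" "norm b \<le> 1" "nc_norm E 1 a - e \<le> Re (E (a o\<^sub>L b))"
proof -
  have aA: "a \<in> A" using N a by blast
  define h where "h = op_abs a"
  have h: "positive_op h" unfolding h_def by (rule op_abs_positive[OF clin[OF aA]])
  have hN: "h \<in> N" unfolding h_def by (rule op_abs_in[OF N(1) a])
  have hA: "h \<in> A" using N hN by blast
  have hh: "op_adj a o\<^sub>L a = h o\<^sub>L h" unfolding h_def by (rule op_abs_square[OF clin[OF aA], symmetric])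
  let ?f = "\<lambda>x::real. 1 / (x + e)"
  have cf: "continuous_on {0..norm h} ?f" by (intro continuous_intros) (use e in auto)
  have ci: "continuous_on {0..norm h} (\<lambda>x. x)" by (intro continuous_intros)
  define f where "f = pos_fun_calc ?f h"
  have fN: "f \<in> N" unfolding f_def by (rule pos_fun_calc_in[OF h N(1) hN cf])
  have fA: "f \<in> A" using N fN by blast
  have fself: "op_adj f = f" unfolding f_def by (rule pos_fun_calc_self_adjoint[OF h cf])
  have hf: "h o\<^sub>L f = pos_fun_calc (\<lambda>x. x * ?f x) h"
    using pos_fun_calc_mult[OF h ci cf] by (simp add: f_def pos_fun_calc_ident[OF h])
  have chf: "continuous_on {0..norm h} (\<lambda>x. x * ?f x)" by (intro continuous_on_mult ci cf)
  have hfself: "op_adj (h o\<^sub>L f) = h o\<^sub>L f" unfolding hf by (rule pos_fun_calc_self_adjoint[OF h chf])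
  have fh: "f o\<^sub>L h = h o\<^sub>L f"
    using hfself hA fA h by (simp add: op_adj_compose clin fself positive_op_def)
  define b where "b = op_adj (a o\<^sub>L f)"
  have afA: "a o\<^sub>L f \<in> A" using aA fA by (simp add: rules)
  have bN: "b \<in> N" unfolding b_def using a fN by (simp add: von_neumann_rules[OF N(1)])
  have hf1: "norm (h o\<^sub>L f) \<le> 1"
  proof -
    obtain q where q: "uniform_limit {0..norm h} (\<lambda>n. poly (q n)) (\<lambda>x. x * ?f x) sequentially"
      "(\<lambda>n. poly_op (q n) h) \<longlonglongrightarrow> pos_fun_calc (\<lambda>x. x * ?f x) h"
      by (rule pos_fun_calc_approx[OF h chf])
    have "norm (pos_fun_calc (\<lambda>x. x * ?f x) h) \<le> 1 + d" if d: "d > 0" for d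
    proof (rule tendsto_upperbound[OF tendsto_norm[OF q(2)]])
      show "\<forall>\<^sub>F n in sequentially. norm (poly_op (q n) h) \<le> 1 + d"
        using uniform_limitD[OF q(1) d]
      proof eventually_elim
        case (elim n)
        show ?case
        proof (rule norm_poly_op_le[OF h])
          fix x assume x: "x \<in> {0..norm h}"
          have "0 \<le> x * ?f x" "x * ?f x \<le> 1" using x e by (simp_all add: divide_le_eq_1)
          then show "\<bar>poly (q n) x\<bar> \<le> 1 + d"
            using elim[rule_format, OF x] d unfolding dist_real_def by argo
        qed
      qed
    qed simp
    then show ?thesis unfolding hf by (rule field_le_epsilon)
  qed
  have "norm (a o\<^sub>L f) \<le> 1"
  proof (rule norm_blinfun_bound)
    fix x
    let ?y = "blinfun_apply f x"
    have "(norm (blinfun_apply a ?y))\<^sup>2 = Re (cinner (blinfun_apply (op_adj a o\<^sub>L a) ?y) ?y)"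
      using clin[OF aA] by (simp add: cinner_adj_left cinner_self)
    also have "\<dots> = Re (cinner (blinfun_apply h ?y) (blinfun_apply h ?y))"
      unfolding hh using h cinner_adj_left[of h "blinfun_apply h ?y" ?y] by (simp add: positive_op_def)
    also have "\<dots> = (norm (blinfun_apply (h o\<^sub>L f) x))\<^sup>2" by (simp add: cinner_self)
    finally have "norm (blinfun_apply (a o\<^sub>L f) x) = norm (blinfun_apply (h o\<^sub>L f) x)"
      by (simp add: power2_eq_iff_nonneg)
    also have "\<dots> \<le> norm (h o\<^sub>L f) * norm x" by (rule norm_blinfun)
    also have "\<dots> \<le> 1 * norm x" using hf1 by (rule mult_right_mono) simp
    finally show "norm (blinfun_apply (a o\<^sub>L f) x) \<le> 1 * norm x" .
  qed simp
  then have b1: "norm b \<le> 1" unfolding b_def using norm_op_adj[OF clin[OF afA]] by simp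
  have "nc_norm E 1 a - e = Re (E (pos_fun_calc (\<lambda>x. x - e) h))"
  proof -
    have "pos_fun_calc (\<lambda>x. x - e) h = h - e *\<^sub>R id_blinfun"
      using pos_fun_calc_diff[OF h ci, of "\<lambda>x. e"] by (simp add: pos_fun_calc_ident[OF h] pos_fun_calc_const[OF h])
    then show ?thesis using hA nc_norm_1[OF aA] by (simp add: E_diff E_scaleR rules E_id h_def)
  qed
  also have "\<dots> \<le> Re (E (pos_fun_calc (\<lambda>x. x * (x * ?f x)) h))"
  proof (rule E_pos_fun_calc_mono[OF h hA])
    show "continuous_on {0..norm h} (\<lambda>x. x * (x * ?f x))" by (intro continuous_on_mult ci cf)
    show "continuous_on {0..norm h} (\<lambda>x. x - e)" by (intro continuous_intros)
    fix x assume "x \<in> {0..norm h}"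
    then have x: "0 \<le> x" by simp
    have "(x - e) * (x + e) \<le> x * x" by (simp add: algebra_simps)
    then have "x - e \<le> x * x / (x + e)" using x e by (simp add: pos_le_divide_eq)
    then show "x - e \<le> x * (x * ?f x)" by simp
  qed
  also have "pos_fun_calc (\<lambda>x. x * (x * ?f x)) h = h o\<^sub>L (h o\<^sub>L f)"
    using pos_fun_calc_mult[OF h ci chf] by (simp add: hf pos_fun_calc_ident[OF h])
  also have "h o\<^sub>L (h o\<^sub>L f) = (h o\<^sub>L h) o\<^sub>L f" by (simp add: blinfun_compose_assoc)
  also have "E \<dots> = E (f o\<^sub>L (op_adj a o\<^sub>L a))" using hA fA by (simp add: hh E_trace rules)
  also have "f o\<^sub>L (op_adj a o\<^sub>L a) = b o\<^sub>L a" unfolding b_def using clin[OF aA] clin[OF fA]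
    by (simp add: op_adj_compose fself blinfun_compose_assoc)
  also have "E (b o\<^sub>L a) = E (a o\<^sub>L b)" using bN aA N by (intro E_trace) auto
  finally have "nc_norm E 1 a - e \<le> Re (E (a o\<^sub>L b))" .
  then show ?thesis using that bN b1 by blast
qed

end

section \<open>Completions and conditional expectations\<close>

text \<open>The exponents 1 and 2 are treated together. Both norms are dominated by \<open>\<parallel>\<cdot>\<parallel>\<^sub>2\<close>, dominate
  the functionals \<open>a \<mapsto> E[ab]\<close>, and are recovered from these functionals.\<close>

locale wstar_completion = wstar_space A E
  for A :: "('h::chilbert_space \<Rightarrow>\<^sub>L 'h) set" and E +
  fixes p :: ennreal and \<iota> :: "('h \<Rightarrow>\<^sub>L 'h) \<Rightarrow> 'v::banach"
  assumes completion: "Lp_completion A E p \<iota>" and exponent: "p = 1 \<or> p = 2"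
begin

abbreviation tm :: "'v \<Rightarrow> ('h \<Rightarrow>\<^sub>L 'h) \<Rightarrow> complex" where "tm \<equiv> trace_mult A E \<iota>"

lemma emb_add: "a \<in> A \<Longrightarrow> b \<in> A \<Longrightarrow> \<iota> (a + b) = \<iota> a + \<iota> b"
  and emb_scaleR: "a \<in> A \<Longrightarrow> \<iota> (r *\<^sub>R a) = r *\<^sub>R \<iota> a"
  and norm_emb: "a \<in> A \<Longrightarrow> norm (\<iota> a) = nc_norm E p a"
  and emb_dense: "closure (\<iota> ` A) = UNIV"
  using completion by (simp_all add: Lp_completion_def)

lemma emb_diff: "a \<in> A \<Longrightarrow> b \<in> A \<Longrightarrow> \<iota> (a - b) = \<iota> a - \<iota> b"
  using emb_add[of a "(- 1) *\<^sub>R b"] emb_scaleR[of b "- 1"] rules(7)[of b "- 1"] by simp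

lemma emb_0: "\<iota> 0 = 0"
  using emb_scaleR[OF rules(9), of 0] by simp

lemma norm_emb_le_l2: "a \<in> A \<Longrightarrow> norm (\<iota> a) \<le> l2 a"
  using exponent nc_norm_1_le_2[of a] nc_norm_2[of a] by (auto simp: norm_emb)

lemma E_emb_le:
  assumes "a \<in> A" "b \<in> A" shows "cmod (E (a o\<^sub>L b)) \<le> norm (\<iota> a) * norm b"
  using exponent
proof
  assume "p = 1" then show ?thesis using E_Hoelder_1_infinity[OF assms] by (simp add: norm_emb assms)
next
  assume p: "p = 2"
  have "l2 b \<le> norm b" using l2_compose_le[OF assms(2) rules(2)] by (simp add: blinfun_compose_id_right l2_id)
  then have "l2 a * l2 b \<le> l2 a * norm b" using l2_nonneg[OF assms(1)] by (rule mult_left_mono)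
  then show ?thesis using E_Cauchy_Schwarz[OF assms] by (simp add: norm_emb assms nc_norm_2 p)
qed

text \<open>The norming element \<open>b\<close> is normalised by its effect on all of the algebra, which means
  \<open>\<parallel>b\<parallel> \<le> 1\<close> for exponent 1 and \<open>\<parallel>b\<parallel>\<^sub>2 \<le> 1\<close> for exponent 2.\<close>

lemma emb_duality:
  assumes N: "von_neumann_algebra N" "N \<subseteq> A" and a: "a \<in> N" and e: "e > 0"
  obtains b where "b \<in> N" "\<And>c. c \<in> A \<Longrightarrow> cmod (E (c o\<^sub>L b)) \<le> norm (\<iota> c)"
    "norm (\<iota> a) - e \<le> Re (E (a o\<^sub>L b))"
  using exponent
proof
  assume p: "p = 1"
  obtain b where b: "b \<in> N" "norm b \<le> 1" "nc_norm E 1 a - e \<le> Re (E (a o\<^sub>L b))"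
    by (rule nc_norm_1_duality[OF N a e])
  show thesis
  proof (rule that[OF b(1)])
    show "norm (\<iota> a) - e \<le> Re (E (a o\<^sub>L b))" using b(3) a N by (auto simp: norm_emb p)
    fix c assume c: "c \<in> A"
    have "cmod (E (c o\<^sub>L b)) \<le> norm (\<iota> c) * norm b" using c b(1) N by (intro E_emb_le) auto
    also have "\<dots> \<le> norm (\<iota> c) * 1" using b(2) by (rule mult_left_mono) simp
    finally show "cmod (E (c o\<^sub>L b)) \<le> norm (\<iota> c)" by simp
  qed
next
  assume p: "p = 2"
  have aA: "a \<in> A" using a N by blast
  have na: "norm (\<iota> a) = l2 a" by (simp add: norm_emb aA p nc_norm_2)
  define b where "b = inverse (l2 a) *\<^sub>R op_adj a"
  have bN: "b \<in> N" unfolding b_def by (intro von_neumann_rules(7)[OF N(1)] von_neumann_rules(6)[OF N(1)] a)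
  have bA: "b \<in> A" using bN N by blast
  have "l2 b = \<bar>inverse (l2 a)\<bar> * l2 a" unfolding b_def by (simp only: l2_scaleR[OF rules(6)[OF aA]] l2_adj[OF aA])
  then have lb: "l2 b \<le> 1" using l2_nonneg[OF aA] by (cases "l2 a = 0") auto
  show thesis
  proof (rule that[OF bN])
    have "E (a o\<^sub>L b) = inverse (l2 a) *\<^sub>R E (op_adj a o\<^sub>L a)"
      unfolding b_def scaleR_conv_of_real
      by (simp only: compose_scaleR_right E_scaleR[OF rules(4)[OF aA rules(6)[OF aA]]] E_trace[OF aA rules(6)[OF aA]])
    then have "Re (E (a o\<^sub>L b)) = inverse (l2 a) * (l2 a)\<^sup>2" unfolding l2_square[OF aA] by simp
    also have "\<dots> = l2 a" by (cases "l2 a = 0") (simp_all add: power2_eq_square)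
    finally show "norm (\<iota> a) - e \<le> Re (E (a o\<^sub>L b))" using e na by simp
    fix c assume c: "c \<in> A"
    have "cmod (E (c o\<^sub>L b)) \<le> l2 c * l2 b" by (rule E_Cauchy_Schwarz[OF c bA])
    also have "\<dots> \<le> l2 c * 1" using lb by (rule mult_left_mono) (rule l2_nonneg[OF c])
    finally show "cmod (E (c o\<^sub>L b)) \<le> norm (\<iota> c)" by (simp add: norm_emb c p nc_norm_2)
  qed
qed

lemma approx_emb:
  obtains a where "\<And>n::nat. a n \<in> A" "(\<lambda>n. \<iota> (a n)) \<longlonglongrightarrow> x"
proof -
  have "x \<in> closure (\<iota> ` A)" by (simp add: emb_dense)
  then obtain y where y: "\<And>n. y n \<in> \<iota> ` A" "y \<longlonglongrightarrow> x" by (auto simp: closure_sequential)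
  then have "\<exists>a. a \<in> A \<and> y n = \<iota> a" for n by blast
  then obtain a where a: "\<And>n. a n \<in> A" "\<And>n. y n = \<iota> (a n)" by metis
  have "y = (\<lambda>n. \<iota> (a n))" by (rule ext) (rule a(2))
  then show thesis using that[of a] a(1) y(2) by simp
qed

lemma trace_mult_tendsto:
  assumes a: "\<And>n::nat. a n \<in> A" and lim: "(\<lambda>n. \<iota> (a n)) \<longlonglongrightarrow> x" and b: "b \<in> A"
  shows "(\<lambda>n. E (a n o\<^sub>L b)) \<longlonglongrightarrow> tm x b"
proof -
  have diff: "cmod (E (c o\<^sub>L b) - E (d o\<^sub>L b)) \<le> norm (\<iota> c - \<iota> d) * norm b"
    if "c \<in> A" "d \<in> A" for c d
    using E_emb_le[of "c - d" b] that b by (simp add: rules emb_diff compose_diff_left E_diff)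
  have "Cauchy (\<lambda>n. E (a n o\<^sub>L b))"
  proof (rule CauchyI)
    fix e :: real assume e: "e > 0"
    have b1: "0 < norm b + 1" by (rule add_nonneg_pos) auto
    obtain K where K: "\<And>m n. m \<ge> K \<Longrightarrow> n \<ge> K \<Longrightarrow> norm (\<iota> (a m) - \<iota> (a n)) < e / (norm b + 1)"
      using CauchyD[OF LIMSEQ_imp_Cauchy[OF lim] divide_pos_pos[OF e b1]] by blast
    have "norm (E (a m o\<^sub>L b) - E (a n o\<^sub>L b)) < e" if "m \<ge> K" "n \<ge> K" for m n
    proof -
      have "norm (E (a m o\<^sub>L b) - E (a n o\<^sub>L b)) \<le> norm (\<iota> (a m) - \<iota> (a n)) * norm b" by (rule diff[OF a a])
      also have "\<dots> \<le> norm (\<iota> (a m) - \<iota> (a n)) * (norm b + 1)" by (intro mult_left_mono) auto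
      also have "\<dots> < e" using K[OF that] b1 by (simp add: pos_less_divide_eq)
      finally show ?thesis .
    qed
    then show "\<exists>K. \<forall>m\<ge>K. \<forall>n\<ge>K. norm (E (a m o\<^sub>L b) - E (a n o\<^sub>L b)) < e" by blast
  qed
  then obtain z where z: "(\<lambda>n. E (a n o\<^sub>L b)) \<longlonglongrightarrow> z" using Cauchy_convergent convergent_def by blast
  have all: "(\<lambda>n. E (c n o\<^sub>L b)) \<longlonglongrightarrow> z" if c: "\<And>n::nat. c n \<in> A" "(\<lambda>n. \<iota> (c n)) \<longlonglongrightarrow> x" for c
  proof -
    have "(\<lambda>n. norm (\<iota> (c n) - \<iota> (a n)) * norm b) \<longlonglongrightarrow> norm (x - x) * norm b"
      by (intro tendsto_intros c lim)
    then have "(\<lambda>n. E (c n o\<^sub>L b) - E (a n o\<^sub>L b)) \<longlonglongrightarrow> 0"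
      by (intro Lim_null_comparison[of "\<lambda>n. E (c n o\<^sub>L b) - E (a n o\<^sub>L b)"])
         (use diff[OF c(1) a] in auto)
    from tendsto_add[OF this z] show ?thesis by simp
  qed
  have "tm x b = z" unfolding trace_mult_def
  proof (rule the_equality)
    show "\<forall>c. (\<forall>n. c n \<in> A) \<and> (\<lambda>n. \<iota> (c n)) \<longlonglongrightarrow> x \<longrightarrow> (\<lambda>n. E (c n o\<^sub>L b)) \<longlonglongrightarrow> z"
      using all by blast
    fix w assume "\<forall>c. (\<forall>n. c n \<in> A) \<and> (\<lambda>n. \<iota> (c n)) \<longlonglongrightarrow> x \<longrightarrow> (\<lambda>n. E (c n o\<^sub>L b)) \<longlonglongrightarrow> w"
    then have "(\<lambda>n. E (a n o\<^sub>L b)) \<longlonglongrightarrow> w" using a lim by blast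
    then show "w = z" using z by (rule LIMSEQ_unique)
  qed
  then show ?thesis using z by simp
qed

lemma trace_mult_emb: "a \<in> A \<Longrightarrow> b \<in> A \<Longrightarrow> tm (\<iota> a) b = E (a o\<^sub>L b)"
  using trace_mult_tendsto[of "\<lambda>n. a" "\<iota> a" b] by (simp add: LIMSEQ_const_iff)

lemma trace_mult_diff_left:
  assumes b: "b \<in> A" shows "tm (x - y) b = tm x b - tm y b"
proof -
  obtain a where a: "\<And>n::nat. a n \<in> A" "(\<lambda>n. \<iota> (a n)) \<longlonglongrightarrow> x" using approx_emb by blast
  obtain c where c: "\<And>n::nat. c n \<in> A" "(\<lambda>n. \<iota> (c n)) \<longlonglongrightarrow> y" using approx_emb by blast
  have "(\<lambda>n. E ((a n - c n) o\<^sub>L b)) \<longlonglongrightarrow> tm (x - y) b"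
    using a c tendsto_diff[OF a(2) c(2)] by (intro trace_mult_tendsto[OF _ _ b]) (simp_all add: rules emb_diff)
  moreover have "(\<lambda>n. E ((a n - c n) o\<^sub>L b)) \<longlonglongrightarrow> tm x b - tm y b"
    using tendsto_diff[OF trace_mult_tendsto[OF a b] trace_mult_tendsto[OF c b]] a c b
    by (simp add: compose_diff_left E_diff rules)
  ultimately show ?thesis by (rule LIMSEQ_unique)
qed

lemma trace_mult_zero_left: "b \<in> A \<Longrightarrow> tm 0 b = 0"
  using trace_mult_diff_left[of b 0 0] by simp

lemma trace_mult_add_right:
  assumes b: "b \<in> A" "c \<in> A" shows "tm x (b + c) = tm x b + tm x c"
proof -
  obtain a where a: "\<And>n::nat. a n \<in> A" "(\<lambda>n. \<iota> (a n)) \<longlonglongrightarrow> x" using approx_emb by blast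
  have "(\<lambda>n. E (a n o\<^sub>L (b + c))) \<longlonglongrightarrow> tm x (b + c)"
    using b by (intro trace_mult_tendsto a) (simp_all add: rules)
  moreover have "(\<lambda>n. E (a n o\<^sub>L (b + c))) \<longlonglongrightarrow> tm x b + tm x c"
    using tendsto_add[OF trace_mult_tendsto[OF a b(1)] trace_mult_tendsto[OF a b(2)]] a b
    by (simp add: compose_add_right E_add rules)
  ultimately show ?thesis by (rule LIMSEQ_unique)
qed

lemma trace_mult_scaleC_right:
  assumes b: "b \<in> A" shows "tm x (op_scaleC c b) = c * tm x b"
proof -
  obtain a where a: "\<And>n::nat. a n \<in> A" "(\<lambda>n. \<iota> (a n)) \<longlonglongrightarrow> x" using approx_emb by blast
  have "(\<lambda>n. E (a n o\<^sub>L op_scaleC c b)) \<longlonglongrightarrow> tm x (op_scaleC c b)"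
    using b by (intro trace_mult_tendsto a) (simp_all add: rules)
  moreover have "a n o\<^sub>L op_scaleC c b = op_scaleC c (a n o\<^sub>L b)" for n
    by (rule blinfun_eqI) (simp add: op_scaleC_apply clinear_ops_scaleC[OF clin[OF a(1)]])
  then have "(\<lambda>n. E (a n o\<^sub>L op_scaleC c b)) \<longlonglongrightarrow> c * tm x b"
    using tendsto_mult_left[OF trace_mult_tendsto[OF a b], of c] a b by (simp add: E_scaleC rules)
  ultimately show ?thesis by (rule LIMSEQ_unique)
qed

lemma trace_mult_bound:
  assumes b: "b \<in> A" and le: "\<And>c. c \<in> A \<Longrightarrow> cmod (E (c o\<^sub>L b)) \<le> norm (\<iota> c) * k"
  shows "cmod (tm x b) \<le> norm x * k"
proof -
  obtain a where a: "\<And>n::nat. a n \<in> A" "(\<lambda>n. \<iota> (a n)) \<longlonglongrightarrow> x" using approx_emb by blast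
  show ?thesis
  proof (rule LIMSEQ_le)
    show "(\<lambda>n. cmod (E (a n o\<^sub>L b))) \<longlonglongrightarrow> cmod (tm x b)" by (intro tendsto_norm trace_mult_tendsto a b)
    show "(\<lambda>n. norm (\<iota> (a n)) * k) \<longlonglongrightarrow> norm x * k" by (intro tendsto_intros a)
  qed (use le a in auto)
qed

lemma closed_Lp_sub: "closed (Lp_sub \<iota> N)" by (simp add: Lp_sub_def)

lemma emb_in_Lp_sub: "a \<in> N \<Longrightarrow> \<iota> a \<in> Lp_sub \<iota> N"
  unfolding Lp_sub_def by (rule subsetD[OF closure_subset]) (rule imageI)

lemma Lp_sub_mono: "N \<subseteq> N' \<Longrightarrow> Lp_sub \<iota> N \<subseteq> Lp_sub \<iota> N'"
  unfolding Lp_sub_def by (intro closure_mono image_mono)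

lemma Lp_sub_sequence:
  assumes "x \<in> Lp_sub \<iota> N"
  obtains a where "\<And>n::nat. a n \<in> N" "(\<lambda>n. \<iota> (a n)) \<longlonglongrightarrow> x"
proof -
  obtain y where y: "\<And>n. y n \<in> \<iota> ` N" "y \<longlonglongrightarrow> x"
    using assms by (auto simp: Lp_sub_def closure_sequential)
  then have "\<exists>a. a \<in> N \<and> y n = \<iota> a" for n by blast
  then obtain a where a: "\<And>n. a n \<in> N" "\<And>n. y n = \<iota> (a n)" by metis
  have "y = (\<lambda>n. \<iota> (a n))" by (rule ext) (rule a(2))
  then show thesis using that[of a] a(1) y(2) by simp
qed

lemma subspace_Lp_sub:
  assumes N: "von_neumann_algebra N" "N \<subseteq> A" shows "subspace (Lp_sub \<iota> N)"
proof (rule subspaceI)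
  have NA: "a \<in> A" if "a \<in> N" for a using N that by blast
  show "0 \<in> Lp_sub \<iota> N" using emb_in_Lp_sub[OF von_neumann_rules(9)[OF N(1)]] by (simp only: emb_0)
  fix x assume x: "x \<in> Lp_sub \<iota> N"
  obtain a where a: "\<And>n::nat. a n \<in> N" "(\<lambda>n. \<iota> (a n)) \<longlonglongrightarrow> x" using Lp_sub_sequence[OF x] by blast
  show "r *\<^sub>R x \<in> Lp_sub \<iota> N" for r
  proof (rule closed_sequentially[OF closed_Lp_sub])
    show "\<iota> (r *\<^sub>R a n) \<in> Lp_sub \<iota> N" for n
      by (rule emb_in_Lp_sub[OF von_neumann_rules(7)[OF N(1) a(1)]])
    show "(\<lambda>n. \<iota> (r *\<^sub>R a n)) \<longlonglongrightarrow> r *\<^sub>R x"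
      unfolding emb_scaleR[OF NA[OF a(1)]] by (intro tendsto_intros a)
  qed
  fix y assume y: "y \<in> Lp_sub \<iota> N"
  obtain b where b: "\<And>n::nat. b n \<in> N" "(\<lambda>n. \<iota> (b n)) \<longlonglongrightarrow> y" using Lp_sub_sequence[OF y] by blast
  show "x + y \<in> Lp_sub \<iota> N"
  proof (rule closed_sequentially[OF closed_Lp_sub])
    show "\<iota> (a n + b n) \<in> Lp_sub \<iota> N" for n
      by (rule emb_in_Lp_sub[OF von_neumann_rules(3)[OF N(1) a(1) b(1)]])
    show "(\<lambda>n. \<iota> (a n + b n)) \<longlonglongrightarrow> x + y"
      unfolding emb_add[OF NA[OF a(1)] NA[OF b(1)]] by (intro tendsto_intros a b)
  qed
qed

text \<open>Test \<open>y\<close> against the elements that nearly attain the norms of its approximants in \<open>N\<close>.\<close>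

lemma trace_mult_separates:
  assumes N: "von_neumann_algebra N" "N \<subseteq> A" and y: "y \<in> Lp_sub \<iota> N"
    and zero: "\<And>b. b \<in> N \<Longrightarrow> tm y b = 0"
  shows "y = 0"
proof -
  obtain a where a: "\<And>n::nat. a n \<in> N" "(\<lambda>n. \<iota> (a n)) \<longlonglongrightarrow> y" using Lp_sub_sequence[OF y] by blast
  have aA: "a n \<in> A" for n using a N by blast
  have "norm (\<iota> (a n)) \<le> norm (\<iota> (a n) - y)" for n
  proof (rule field_le_epsilon)
    fix e :: real assume e: "e > 0"
    obtain b where b: "b \<in> N" "\<And>c. c \<in> A \<Longrightarrow> cmod (E (c o\<^sub>L b)) \<le> norm (\<iota> c)"
      "norm (\<iota> (a n)) - e \<le> Re (E (a n o\<^sub>L b))"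
      using emb_duality[OF N a(1) e] by blast
    have bA: "b \<in> A" using b N by blast
    have "Re (E (a n o\<^sub>L b)) = Re (tm (\<iota> (a n) - y) b)"
      by (simp add: trace_mult_diff_left bA zero[OF b(1)] trace_mult_emb aA)
    also have "\<dots> \<le> cmod (tm (\<iota> (a n) - y) b)" by (rule complex_Re_le_cmod)
    also have "\<dots> \<le> norm (\<iota> (a n) - y) * 1" by (rule trace_mult_bound[OF bA]) (simp add: b(2))
    finally show "norm (\<iota> (a n)) \<le> norm (\<iota> (a n) - y) + e" using b(3) by simp
  qed
  moreover have "(\<lambda>n. norm (\<iota> (a n))) \<longlonglongrightarrow> norm y" by (intro tendsto_intros a)
  moreover have "(\<lambda>n. norm (\<iota> (a n) - y)) \<longlonglongrightarrow> norm (y - y)" by (intro tendsto_intros a)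
  ultimately have "norm y \<le> norm (y - y)" by (intro LIMSEQ_le[of "\<lambda>n. norm (\<iota> (a n))"]) auto
  then show ?thesis by simp
qed

lemma cond_exp_eqI:
  assumes N: "von_neumann_algebra N" "N \<subseteq> A" and y: "y \<in> Lp_sub \<iota> N"
    and eq: "\<And>b. b \<in> N \<Longrightarrow> tm y b = tm x b"
  shows "cond_exp A E \<iota> N x = y"
  unfolding cond_exp_def
proof (rule the_equality)
  show "y \<in> Lp_sub \<iota> N \<and> (\<forall>b\<in>N. tm y b = tm x b)" using y eq by blast
  fix z assume z: "z \<in> Lp_sub \<iota> N \<and> (\<forall>b\<in>N. tm z b = tm x b)"
  have "z - y = 0"
  proof (rule trace_mult_separates[OF N])
    show "z - y \<in> Lp_sub \<iota> N" using z y subspace_Lp_sub[OF N] by (simp add: subspace_diff)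
    show "tm (z - y) b = 0" if "b \<in> N" for b
    proof -
      have "b \<in> A" using that N by blast
      then show ?thesis using z eq[OF that] that by (simp add: trace_mult_diff_left)
    qed
  qed
  then show "z = y" by simp
qed

text \<open>The Hilbert space projection, carried out in \<open>N\<close> for the inner product \<open>E[b\<^sup>*a]\<close>. The
  approximate projections converge in the completion because its norm is dominated by
  \<open>\<parallel>\<cdot>\<parallel>\<^sub>2\<close>. In \<open>L\<^sup>2\<close> every element satisfies the bound, and in \<open>L\<^sup>1\<close> every element of the
  algebra does.\<close>

lemma cond_exp_characterization:
  assumes N: "von_neumann_algebra N" "N \<subseteq> A"
    and bound: "\<And>b. b \<in> N \<Longrightarrow> cmod (tm x b) \<le> k * l2 b"
  shows "cond_exp A E \<iota> N x \<in> Lp_sub \<iota> N"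
    and "b \<in> N \<Longrightarrow> tm (cond_exp A E \<iota> N x) b = tm x b"
proof -
  have NA: "a \<in> A" if "a \<in> N" for a using N that by blast
  note Nrules = von_neumann_rules[OF N(1)]
  let ?B = "\<lambda>a b. Re (E (op_adj b o\<^sub>L a))" and ?\<phi> = "\<lambda>b. Re (tm x (op_adj b))"
  obtain a :: "nat \<Rightarrow> _" where aN: "\<And>n. a n \<in> N"
    and cauchy: "\<And>e. e > 0 \<Longrightarrow> \<exists>K. \<forall>m\<ge>K. \<forall>n\<ge>K. ?B (a m - a n) (a m - a n) < e"
    and lim: "\<And>b. b \<in> N \<Longrightarrow> (\<lambda>n. ?B (a n) b) \<longlonglongrightarrow> ?\<phi> b"
  proof (rule riesz_approximation[of N ?B ?\<phi> k])
    show "subspace N" by (rule von_neumann_subspace[OF N(1)])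
    fix u v w assume u: "u \<in> N" and v: "v \<in> N" and w: "w \<in> N"
    show "?B u v = ?B v u" using E_cross[OF NA[OF u] NA[OF v]] by simp
    show "?B (u + v) w = ?B u w + ?B v w"
      using NA[OF u] NA[OF v] NA[OF w] by (simp add: compose_add_right E_add rules)
    show "?B (r *\<^sub>R u) v = r * ?B u v" for r
      using NA[OF u] NA[OF v] by (simp add: compose_scaleR_right E_scaleR rules)
    show "0 \<le> ?B u u" by (rule E_pos[OF NA[OF u]])
    show "?\<phi> (u + v) = ?\<phi> u + ?\<phi> v"
      using NA[OF u] NA[OF v] by (simp add: op_adj_add clin trace_mult_add_right rules)
    show "?\<phi> (r *\<^sub>R u) = r * ?\<phi> u" for r
      using NA[OF u] trace_mult_scaleC_right[of "op_adj u" x "of_real r"]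
      by (simp add: op_adj_scaleR clin rules op_scaleC_of_real)
    show "?\<phi> u \<le> k * sqrt (?B u u)"
      using bound[OF Nrules(6)[OF u]] complex_Re_le_cmod[of "tm x (op_adj u)"] l2_adj[OF NA[OF u]]
      by (simp add: l2_def)
  next
    fix a :: "nat \<Rightarrow> _"
    assume 1: "\<And>n. a n \<in> N"
      and 2: "\<And>e. e > 0 \<Longrightarrow> \<exists>K. \<forall>m\<ge>K. \<forall>n\<ge>K. ?B (a m - a n) (a m - a n) < e"
      and 3: "\<And>b. b \<in> N \<Longrightarrow> (\<lambda>n. ?B (a n) b) \<longlonglongrightarrow> ?\<phi> b"
    show thesis by (rule that[OF 1 2 3])
  qed
  have "Cauchy (\<lambda>n. \<iota> (a n))"
  proof (rule CauchyI)
    fix e :: real assume e: "e > 0"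
    then obtain K where K: "\<forall>m\<ge>K. \<forall>n\<ge>K. ?B (a m - a n) (a m - a n) < e\<^sup>2" using cauchy[of "e\<^sup>2"] by auto
    have "norm (\<iota> (a m) - \<iota> (a n)) < e" if "m \<ge> K" "n \<ge> K" for m n
    proof -
      have dA: "a m - a n \<in> A" using NA[OF aN] by (simp add: rules)
      have "(l2 (a m - a n))\<^sup>2 < e\<^sup>2" using K that by (simp add: l2_square[OF dA])
      then have "l2 (a m - a n) < e" using e by (rule power_less_imp_less_base[OF _ less_imp_le])
      then show ?thesis using norm_emb_le_l2[OF dA] by (simp add: emb_diff NA[OF aN])
    qed
    then show "\<exists>K. \<forall>m\<ge>K. \<forall>n\<ge>K. norm (\<iota> (a m) - \<iota> (a n)) < e" by blast
  qed
  then obtain y where y: "(\<lambda>n. \<iota> (a n)) \<longlonglongrightarrow> y" using Cauchy_convergent convergent_def by blast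
  have yN: "y \<in> Lp_sub \<iota> N"
    by (rule closed_sequentially[OF closed_Lp_sub _ y]) (rule emb_in_Lp_sub[OF aN])
  have re: "Re (tm y b) = Re (tm x b)" if b: "b \<in> N" for b
  proof (rule LIMSEQ_unique)
    show "(\<lambda>n. Re (E (a n o\<^sub>L b))) \<longlonglongrightarrow> Re (tm y b)"
      by (intro tendsto_Re trace_mult_tendsto[OF _ y] NA aN b)
    have "E (op_adj (op_adj b) o\<^sub>L a n) = E (a n o\<^sub>L b)" for n
      using NA[OF aN] NA[OF b] by (simp add: op_adj_adj clin E_trace)
    then show "(\<lambda>n. Re (E (a n o\<^sub>L b))) \<longlonglongrightarrow> Re (tm x b)"
      using lim[OF Nrules(6)[OF b]] by (simp add: op_adj_adj clin NA[OF b])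
  qed
  have eq: "tm y b = tm x b" if b: "b \<in> N" for b
  proof (rule complex_eqI)
    show "Re (tm y b) = Re (tm x b)" by (rule re[OF b])
    show "Im (tm y b) = Im (tm x b)"
      using re[OF Nrules(5)[OF b, of \<i>]] by (simp add: trace_mult_scaleC_right NA[OF b])
  qed
  have "cond_exp A E \<iota> N x = y" by (rule cond_exp_eqI[OF N yN eq])
  then show "cond_exp A E \<iota> N x \<in> Lp_sub \<iota> N" and "b \<in> N \<Longrightarrow> tm (cond_exp A E \<iota> N x) b = tm x b"
    using yN eq by simp_all
qed

lemma cond_exp_self:
  assumes "von_neumann_algebra N" "N \<subseteq> A" "x \<in> Lp_sub \<iota> N"
  shows "cond_exp A E \<iota> N x = x"
  by (rule cond_exp_eqI[OF assms]) (rule refl)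

lemma cond_exp_emb:
  assumes N: "von_neumann_algebra N" "N \<subseteq> A" and c: "c \<in> A"
  shows "cond_exp A E \<iota> N (\<iota> c) \<in> Lp_sub \<iota> N"
    and "b \<in> N \<Longrightarrow> tm (cond_exp A E \<iota> N (\<iota> c)) b = E (c o\<^sub>L b)"
proof -
  have NA: "a \<in> A" if "a \<in> N" for a using N that by blast
  have le: "cmod (tm (\<iota> c) b) \<le> l2 c * l2 b" if "b \<in> N" for b
    using E_Cauchy_Schwarz[OF c NA[OF that]] by (simp add: trace_mult_emb c NA[OF that])
  show "cond_exp A E \<iota> N (\<iota> c) \<in> Lp_sub \<iota> N" by (rule cond_exp_characterization(1)[OF N le])
  show "tm (cond_exp A E \<iota> N (\<iota> c)) b = E (c o\<^sub>L b)" if "b \<in> N"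
    using cond_exp_characterization(2)[OF N le that] by (simp add: trace_mult_emb c NA[OF that])
qed

text \<open>For \<open>c \<in> N\<close> this is the defining property of the conditional expectation of \<open>d\<close>. In general \<open>c\<close> is
  a limit of elements of \<open>N\<close> in the completion only, and the identity passes to the limit because
  \<open>d\<close> is bounded.\<close>

lemma E_orthogonal_emb:
  assumes N: "von_neumann_algebra N" "N \<subseteq> A" and c: "c \<in> A" and d: "d \<in> A"
    and cN: "\<iota> c \<in> Lp_sub \<iota> N" and dN: "cond_exp A E \<iota> N (\<iota> d) = 0"
  shows "E (op_adj c o\<^sub>L d) = 0"
proof -
  obtain a where a: "\<And>n::nat. a n \<in> N" "(\<lambda>n. \<iota> (a n)) \<longlonglongrightarrow> \<iota> c" using Lp_sub_sequence[OF cN] by blast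
  have aA: "a n \<in> A" for n using a N by blast
  have "E (d o\<^sub>L b) = 0" if "b \<in> N" for b
  proof -
    have "b \<in> A" using that N by blast
    then show ?thesis using cond_exp_emb(2)[OF N d that] by (simp add: dN trace_mult_zero_left)
  qed
  then have "E (d o\<^sub>L op_adj (a n)) = 0" for n using a(1) von_neumann_rules(6)[OF N(1)] by blast
  moreover have "E (a n o\<^sub>L op_adj d) = cnj (E (d o\<^sub>L op_adj (a n)))" for n
    using E_adj[of "d o\<^sub>L op_adj (a n)"] aA[of n] d by (simp add: rules op_adj_compose clin op_adj_adj)
  ultimately have "(\<lambda>n. E (a n o\<^sub>L op_adj d)) = (\<lambda>n. 0)" by simp
  moreover have "(\<lambda>n. E (a n o\<^sub>L op_adj d)) \<longlonglongrightarrow> E (c o\<^sub>L op_adj d)"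
    using trace_mult_tendsto[OF aA a(2) rules(6)[OF d]] by (simp add: trace_mult_emb c rules d)
  ultimately have "E (c o\<^sub>L op_adj d) = 0" by (simp add: LIMSEQ_const_iff)
  then show ?thesis
    using E_cross[OF c d] c d by (simp add: E_trace rules)
qed

subsection \<open>Martingales in the square-integrable case\<close>

text \<open>The martingale property tested against the algebra; unlike the original one it is visibly
  linear in the process.\<close>

definition weak_martingale :: "(real \<Rightarrow> ('h \<Rightarrow>\<^sub>L 'h) set) \<Rightarrow> (real \<Rightarrow> 'v) \<Rightarrow> bool" where
  "weak_martingale F X \<longleftrightarrow> (\<forall>t\<ge>0. X t \<in> Lp_sub \<iota> (F t)) \<and>
     (\<forall>s t. 0 \<le> s \<and> s \<le> t \<longrightarrow> (\<forall>b\<in>F s. tm (X t) b = tm (X s) b))"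

lemma filtration_rules:
  assumes "filtration A F" "0 \<le> s" "s \<le> t"
  shows "von_neumann_algebra (F s)" "F s \<subseteq> A" "F s \<subseteq> F t"
  using assms by (auto simp: filtration_def)

lemma weak_martingale_diff:
  assumes F: "filtration A F" and X: "weak_martingale F X" and Y: "weak_martingale F Y"
  shows "weak_martingale F (\<lambda>t. X t - Y t)"
  unfolding weak_martingale_def
proof (intro conjI allI impI ballI)
  fix t :: real assume "0 \<le> t"
  then have "X t \<in> Lp_sub \<iota> (F t)" "Y t \<in> Lp_sub \<iota> (F t)"
    using X Y unfolding weak_martingale_def by simp_all
  then show "X t - Y t \<in> Lp_sub \<iota> (F t)"
    using subspace_Lp_sub[OF filtration_rules(1,2)[OF F \<open>0 \<le> t\<close> order_refl]] by (simp add: subspace_diff)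
next
  fix s t b assume st: "0 \<le> s \<and> s \<le> t" and b: "b \<in> F s"
  then have "b \<in> A" using filtration_rules(2)[OF F] by blast
  then show "tm (X t - Y t) b = tm (X s - Y s) b"
    using X Y st b unfolding weak_martingale_def by (simp add: trace_mult_diff_left)
qed

context
  assumes p2: "p = 2"
begin

lemma trace_mult_bound_l2:
  assumes "b \<in> A" shows "cmod (tm x b) \<le> norm x * l2 b"
  by (rule trace_mult_bound[OF assms])
     (use E_Cauchy_Schwarz[OF _ assms] in \<open>simp add: norm_emb p2 nc_norm_2\<close>)

lemma cond_exp_L2:
  assumes N: "von_neumann_algebra N" "N \<subseteq> A"
  shows "cond_exp A E \<iota> N x \<in> Lp_sub \<iota> N"
    and "b \<in> N \<Longrightarrow> tm (cond_exp A E \<iota> N x) b = tm x b"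
proof -
  have "cmod (tm x b) \<le> norm x * l2 b" if "b \<in> N" for b
    using that N by (intro trace_mult_bound_l2) blast
  note * = cond_exp_characterization[OF N this]
  show "cond_exp A E \<iota> N x \<in> Lp_sub \<iota> N" by (rule *(1))
  show "tm (cond_exp A E \<iota> N x) b = tm x b" if "b \<in> N" by (rule *(2)[OF _ that])
qed

lemma weak_martingaleI:
  assumes F: "filtration A F" and X: "Lp_martingale A F E \<iota> X"
  shows "weak_martingale F X"
  unfolding weak_martingale_def
proof (intro conjI allI impI ballI)
  show "X t \<in> Lp_sub \<iota> (F t)" if "0 \<le> t" for t using X that by (simp add: Lp_martingale_def adapted_def)
  fix s t b assume st: "0 \<le> s \<and> s \<le> t" and b: "b \<in> F s"
  then have "cond_exp A E \<iota> (F s) (X t) = X s" using X by (simp add: Lp_martingale_def)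
  then show "tm (X t) b = tm (X s) b"
    using cond_exp_L2(2)[OF filtration_rules(1,2)[OF F, of s s] b, of "X t"] st by simp
qed

text \<open>Pythagoras' theorem in the completion, where orthogonality of \<open>z\<close> to \<open>L\<^sup>2(N)\<close> is expressed by the
  extended trace.\<close>

lemma norm_add_square_orthogonal:
  assumes N: "N \<subseteq> A" and adj: "\<And>b. b \<in> N \<Longrightarrow> op_adj b \<in> N"
    and z: "\<And>b. b \<in> N \<Longrightarrow> tm z b = 0" and x: "x \<in> Lp_sub \<iota> N"
  shows "(norm (z + x))\<^sup>2 = (norm z)\<^sup>2 + (norm x)\<^sup>2"
proof -
  have NA: "a \<in> A" if "a \<in> N" for a using N that by blast
  obtain a where a: "\<And>n::nat. a n \<in> A" "(\<lambda>n. \<iota> (a n)) \<longlonglongrightarrow> z" using approx_emb by blast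
  obtain b where b: "\<And>n::nat. b n \<in> N" "(\<lambda>n. \<iota> (b n)) \<longlonglongrightarrow> x" using Lp_sub_sequence[OF x] by blast
  have nl: "norm (\<iota> c) = l2 c" if "c \<in> A" for c using that by (simp add: norm_emb p2 nc_norm_2)
  have step: "(norm (z + \<iota> c))\<^sup>2 = (norm z)\<^sup>2 + (norm (\<iota> c))\<^sup>2" if c: "c \<in> N" for c
  proof (rule LIMSEQ_unique)
    show "(\<lambda>n. (norm (\<iota> (a n) + \<iota> c))\<^sup>2) \<longlonglongrightarrow> (norm (z + \<iota> c))\<^sup>2" by (intro tendsto_intros a)
    have "(norm (\<iota> (a n) + \<iota> c))\<^sup>2 = (norm (\<iota> (a n)))\<^sup>2 + (norm (\<iota> c))\<^sup>2 + 2 * Re (E (a n o\<^sub>L op_adj c))" for n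
      using l2_add_square[OF a(1)[of n] NA[OF c]] a(1)[of n] NA[OF c]
      by (simp add: emb_add[symmetric] nl rules E_trace[of "a n"])
    moreover have "(\<lambda>n. (norm (\<iota> (a n)))\<^sup>2 + (norm (\<iota> c))\<^sup>2 + 2 * Re (E (a n o\<^sub>L op_adj c)))
        \<longlonglongrightarrow> (norm z)\<^sup>2 + (norm (\<iota> c))\<^sup>2 + 2 * Re (tm z (op_adj c))"
      by (intro tendsto_intros a trace_mult_tendsto rules NA c)
    ultimately show "(\<lambda>n. (norm (\<iota> (a n) + \<iota> c))\<^sup>2) \<longlonglongrightarrow> (norm z)\<^sup>2 + (norm (\<iota> c))\<^sup>2"
      using z[OF adj[OF c]] by simp
  qed
  show ?thesis
  proof (rule LIMSEQ_unique)
    show "(\<lambda>n. (norm (z + \<iota> (b n)))\<^sup>2) \<longlonglongrightarrow> (norm (z + x))\<^sup>2" by (intro tendsto_intros b)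
    show "(\<lambda>n. (norm (z + \<iota> (b n)))\<^sup>2) \<longlonglongrightarrow> (norm z)\<^sup>2 + (norm x)\<^sup>2"
      unfolding step[OF b(1)] by (intro tendsto_intros b)
  qed
qed

lemma martingale_increment:
  assumes F: "filtration A F" and X: "weak_martingale F X" and st: "0 \<le> s" "s \<le> t"
  shows "(norm (X t - X s))\<^sup>2 = (norm (X t))\<^sup>2 - (norm (X s))\<^sup>2"
proof -
  note Fs = filtration_rules[OF F st]
  have "(norm ((X t - X s) + X s))\<^sup>2 = (norm (X t - X s))\<^sup>2 + (norm (X s))\<^sup>2"
  proof (rule norm_add_square_orthogonal[OF Fs(2)])
    show "op_adj b \<in> F s" if "b \<in> F s" for b by (rule von_neumann_rules(6)[OF Fs(1) that])
    show "tm (X t - X s) b = 0" if "b \<in> F s" for b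
    proof -
      have "b \<in> A" using that Fs(2) by blast
      then show ?thesis using X st that unfolding weak_martingale_def by (simp add: trace_mult_diff_left)
    qed
    show "X s \<in> Lp_sub \<iota> (F s)" using X st unfolding weak_martingale_def by simp
  qed
  then show ?thesis by simp
qed

lemma cond_exp_increment:
  assumes F: "filtration A F" and X: "weak_martingale F X" and st: "0 \<le> s" "s \<le> t"
  shows "cond_exp A E \<iota> (F s) (X t - X s) = 0"
proof (rule cond_exp_eqI)
  note Fs = filtration_rules[OF F st]
  show "von_neumann_algebra (F s)" "F s \<subseteq> A" by (fact Fs)+
  show "0 \<in> Lp_sub \<iota> (F s)" using subspace_Lp_sub[OF Fs(1,2)] by (rule subspace_0)
  show "tm 0 b = tm (X t - X s) b" if "b \<in> F s" for b
  proof -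
    have "b \<in> A" using that Fs(2) by blast
    then show ?thesis using X st that unfolding weak_martingale_def
      by (simp add: trace_mult_diff_left trace_mult_zero_left)
  qed
qed

end

end

section \<open>Partitions and the mesh filter\<close>

lemma left_nb_zero: "left_nb P 0 = 0" by (simp add: left_nb_def)

context
  fixes P :: "real set"
  assumes fin: "finite P" and zero: "0 \<in> P"
begin

lemma left_nb_pos:
  assumes s: "0 < s"
  shows "left_nb P s \<in> P" and "left_nb P s < s" and "u \<in> P \<Longrightarrow> u < s \<Longrightarrow> u \<le> left_nb P s"
proof -
  have f: "finite {u\<in>P. u < s}" using fin by simp
  have ne: "{u\<in>P. u < s} \<noteq> {}" using zero s by blast
  have eq: "left_nb P s = Max {u\<in>P. u < s}" using s by (simp add: left_nb_def)
  have "left_nb P s \<in> {u\<in>P. u < s}" unfolding eq by (rule Max_in[OF f ne])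
  then show "left_nb P s \<in> P" "left_nb P s < s" by simp_all
  show "u \<le> left_nb P s" if "u \<in> P" "u < s" unfolding eq by (rule Max_ge[OF f]) (simp add: that)
qed

lemma left_nb_in: "0 \<le> s \<Longrightarrow> left_nb P s \<in> P"
  using left_nb_pos(1)[of s] zero by (cases "s = 0") (simp_all add: left_nb_zero)

lemma left_nb_le: "0 \<le> s \<Longrightarrow> left_nb P s \<le> s"
  using left_nb_pos(2)[of s] by (cases "s = 0") (simp_all add: left_nb_zero)

lemma left_nb_nonneg: "0 \<le> s \<Longrightarrow> 0 \<le> left_nb P s"
  using left_nb_pos(3)[of s 0] zero by (cases "s = 0") (simp_all add: left_nb_zero)

lemma left_nb_eqI:
  assumes "u \<in> P" "u < s" "0 < s" "\<And>v. v \<in> P \<Longrightarrow> v < s \<Longrightarrow> v \<le> u"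
  shows "left_nb P s = u"
  using assms left_nb_pos[OF assms(3)] by (meson order_antisym)

end

lemma partition_rules:
  assumes "is_partition t P"
  shows "finite P" "0 \<in> P" "t \<in> P" "0 \<le> t" and "s \<in> P \<Longrightarrow> 0 \<le> s" "s \<in> P \<Longrightarrow> s \<le> t"
  using assms unfolding is_partition_def by auto

lemma partition_left_nb:
  assumes P: "is_partition t P" and s: "0 \<le> s"
  shows "left_nb P s \<in> P" "left_nb P s \<le> s" "0 \<le> left_nb P s"
  using left_nb_in[OF partition_rules(1,2)[OF P] s] left_nb_le[OF partition_rules(1,2)[OF P] s]
    left_nb_nonneg[OF partition_rules(1,2)[OF P] s] by simp_all

lemma sum_telescope_Max:
  fixes G :: "real \<Rightarrow> 'w::real_vector"
  assumes "finite P" "0 \<in> P" "\<And>s. s \<in> P \<Longrightarrow> 0 \<le> s"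
  shows "(\<Sum>s\<in>P. G s - G (left_nb P s)) = G (Max P) - G 0"
  using assms
proof (induction P rule: finite_linorder_max_induct)
  case (insert b A)
  show ?case
  proof (cases "A = {}")
    case True
    then have "b = 0" using insert.prems by simp
    then show ?thesis using True by (simp add: left_nb_zero)
  next
    case False
    have A0: "0 \<in> A"
    proof (rule ccontr)
      assume "0 \<notin> A"
      then have "b = 0" using insert.prems by simp
      obtain a where "a \<in> A" using False by blast
      then have "a < 0" "0 \<le> a" using insert.hyps(2) insert.prems(2) \<open>b = 0\<close> by auto
      then show False by simp
    qed
    then have b: "0 < b" using insert.hyps by simp
    have nbA: "left_nb (insert b A) s = left_nb A s" if "s \<in> A" for s
    proof -
      have "{u \<in> insert b A. u < s} = {u \<in> A. u < s}" using insert.hyps(2) that by auto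
      then show ?thesis by (simp add: left_nb_def)
    qed
    have "{u \<in> insert b A. u < b} = A" using insert.hyps(2) by auto
    then have nbb: "left_nb (insert b A) b = Max A" using b by (simp add: left_nb_def)
    have bA: "b \<notin> A" using insert.hyps(2) by blast
    have "Max A \<le> b" using insert.hyps False by (simp add: Max_le_iff less_imp_le)
    then have Max: "Max (insert b A) = b" using insert.hyps False by (simp add: max_absorb1)
    have "(\<Sum>s\<in>insert b A. G s - G (left_nb (insert b A) s))
        = (G b - G (Max A)) + (\<Sum>s\<in>A. G s - G (left_nb A s))"
      using insert.hyps bA by (simp add: nbb nbA)
    also have "(\<Sum>s\<in>A. G s - G (left_nb A s)) = G (Max A) - G 0"
      using insert.IH[OF A0] insert.prems(2) by blast
    finally show ?thesis by (simp add: Max)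
  qed
qed simp

lemma sum_telescope:
  fixes G :: "real \<Rightarrow> 'w::real_vector"
  assumes P: "is_partition t P"
  shows "(\<Sum>s\<in>P. G s - G (left_nb P s)) = G t - G 0"
proof -
  have "Max P = t" using partition_rules[OF P] by (intro Max_eqI) auto
  then show ?thesis using sum_telescope_Max[of P G] partition_rules[OF P] by simp
qed

text \<open>A sum over a coarse partition whose terms depend on the left end point of the cell, written as
  a sum over a refinement: telescope in the second argument inside each coarse cell.\<close>

lemma sum_refine:
  fixes F :: "real \<Rightarrow> real \<Rightarrow> 'w::real_vector"
  assumes P: "is_partition t P" and R: "is_partition t R" and PR: "P \<subseteq> R" and diag: "\<And>a. F a a = 0"
  shows "(\<Sum>s\<in>P. F (left_nb P s) s)
    = (\<Sum>s\<in>R. F (left_nb P s) s - F (left_nb P s) (left_nb R s))"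
proof -
  note Pr = partition_rules[OF P] and Rr = partition_rules[OF R]
  \<comment> \<open>the sum over the completed cells before \<open>x\<close>, plus the part of the current cell up to \<open>x\<close>\<close>
  define G where "G x = (\<Sum>p\<in>{p\<in>P. p < x}. F (left_nb P p) p) + F (left_nb P x) x" for x
  have step: "G s - G (left_nb R s) = F (left_nb P s) s - F (left_nb P s) (left_nb R s)" if "s \<in> R" for s
  proof (cases "s = 0")
    case False
    with Rr(5)[OF that] have s: "0 < s" by simp
    note l = left_nb_pos[OF Pr(1,2) s] and r = left_nb_pos[OF Rr(1,2) s]
    define u where "u = left_nb R s"
    have lu: "left_nb P s \<le> u" unfolding u_def using r(3) l(1,2) PR by blast
    have us: "u < s" unfolding u_def by (rule r(2))
    show ?thesis
    proof (cases "u \<in> P")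
      case True
      then have uP: "left_nb P s = u" using l(3)[OF True us] lu by simp
      have "{p\<in>P. p < s} = insert u {p\<in>P. p < u}"
      proof (intro equalityI subsetI)
        fix p assume p: "p \<in> {p\<in>P. p < s}"
        then have "p \<le> u" using l(3)[of p] uP by simp
        then show "p \<in> insert u {p\<in>P. p < u}" using p by auto
      next
        fix p assume "p \<in> insert u {p\<in>P. p < u}"
        then show "p \<in> {p\<in>P. p < s}" using us True by auto
      qed
      then have "G s = F (left_nb P u) u + (\<Sum>p\<in>{p\<in>P. p < u}. F (left_nb P p) p) + F u s"
        unfolding G_def using Pr(1) by (simp add: uP)
      then show ?thesis unfolding u_def[symmetric] uP by (simp add: G_def diag)
    next
      case False
      then have "u \<noteq> left_nb P s" using l(1) by blast
      then have less: "left_nb P s < u" using lu by simp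
      have u0: "0 < u" using less partition_left_nb(3)[OF P, of s] s by simp
      have lPu: "left_nb P u = left_nb P s"
        by (rule left_nb_eqI[OF Pr(1,2) l(1) less u0]) (use l(3) us in auto)
      have "{p\<in>P. p < s} = {p\<in>P. p < u}"
      proof (intro equalityI subsetI)
        fix p assume p: "p \<in> {p\<in>P. p < s}"
        then have "p \<le> left_nb P s" using l(3)[of p] by simp
        then show "p \<in> {p\<in>P. p < u}" using p less by simp
      next
        fix p assume "p \<in> {p\<in>P. p < u}"
        then show "p \<in> {p\<in>P. p < s}" using us by simp
      qed
      then show ?thesis unfolding u_def[symmetric] by (simp add: G_def lPu)
    qed
  qed (simp add: left_nb_zero)
  have empty: "{p\<in>P. p < 0} = {}" using Pr(5) by force
  have "P = insert t {p\<in>P. p < t}" using Pr by force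
  then have "(\<Sum>s\<in>P. F (left_nb P s) s) = (\<Sum>s\<in>insert t {p\<in>P. p < t}. F (left_nb P s) s)" by simp
  also have "\<dots> = G t" unfolding G_def using Pr(1) by simp
  also have "\<dots> = G t - G 0" by (simp add: G_def empty diag left_nb_zero)
  also have "\<dots> = (\<Sum>s\<in>R. G s - G (left_nb R s))" by (rule sum_telescope[OF R, symmetric])
  also have "\<dots> = (\<Sum>s\<in>R. F (left_nb P s) s - F (left_nb P s) (left_nb R s))"
    by (rule sum.cong[OF refl step])
  finally show ?thesis .
qed

text \<open>Also for times \<open>s\<close> outside \<open>P\<close>: the next point of \<open>P\<close> has the same left neighbour.\<close>

lemma cell_length_le_mesh:
  assumes P: "is_partition t P" and s: "0 \<le> s" "s \<le> t"
  shows "s - left_nb P s \<le> mesh P"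
proof -
  note Pr = partition_rules[OF P]
  define q where "q = Min {u\<in>P. s \<le> u}"
  have "q \<in> {u\<in>P. s \<le> u}" unfolding q_def using Pr(1,3) s by (intro Min_in) auto
  then have q: "q \<in> P" "s \<le> q" by simp_all
  have qmin: "q \<le> u" if "u \<in> P" "s \<le> u" for u unfolding q_def using Pr(1) that by (intro Min_le) auto
  have "left_nb P q \<le> left_nb P s"
  proof (cases "q = 0")
    case True then show ?thesis using partition_left_nb(3)[OF P s(1)] by (simp add: left_nb_zero)
  next
    case False
    then have q0: "0 < q" using q s by simp
    note l = left_nb_pos[OF Pr(1,2) q0]
    have ls: "left_nb P q < s" using qmin[OF l(1)] l(2) by (meson not_le order.trans order.strict_trans2)
    then have "0 < s" using partition_left_nb(3)[OF P, of q] q0 by simp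
    then show ?thesis using left_nb_pos(3)[OF Pr(1,2)] l(1) ls by blast
  qed
  moreover have "q - left_nb P q \<le> mesh P"
    unfolding mesh_def using Pr(1) q(1) by (intro Max_ge) auto
  ultimately show ?thesis using q(2) by linarith
qed

lemma mesh_le:
  assumes "is_partition t P" "\<And>s. s \<in> P \<Longrightarrow> s - left_nb P s \<le> d"
  shows "mesh P \<le> d"
  unfolding mesh_def using partition_rules[OF assms(1)] assms(2) by (subst Max_le_iff) auto

lemma mesh_refine_le:
  assumes P: "is_partition t P" and R: "is_partition t R" and PR: "P \<subseteq> R"
  shows "mesh R \<le> mesh P"
proof (rule mesh_le[OF R])
  fix s assume "s \<in> R"
  note s = partition_rules(5,6)[OF R this]
  have "left_nb P s \<le> left_nb R s"
  proof (cases "s = 0")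
    case False
    then have s0: "0 < s" using s by simp
    show ?thesis
      using left_nb_pos(3)[OF partition_rules(1,2)[OF R] s0] left_nb_pos(1,2)[OF partition_rules(1,2)[OF P] s0] PR
      by blast
  qed (simp add: left_nb_zero)
  then show "s - left_nb R s \<le> mesh P" using cell_length_le_mesh[OF P s] by linarith
qed

lemma partition_Un:
  "is_partition t P \<Longrightarrow> is_partition t R \<Longrightarrow> is_partition t (P \<union> R)"
  by (simp add: is_partition_def)

lemma partition_insert: "is_partition t P \<Longrightarrow> 0 \<le> s \<Longrightarrow> s \<le> t \<Longrightarrow> is_partition t (insert s P)"
  by (simp add: is_partition_def)

lemma left_nb_restrict: "s \<le> r \<Longrightarrow> (\<And>u. u \<in> P \<Longrightarrow> 0 \<le> u) \<Longrightarrow> left_nb (P \<inter> {0..r}) s = left_nb P s"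
proof -
  assume "s \<le> r" "\<And>u. u \<in> P \<Longrightarrow> 0 \<le> u"
  then have "{u \<in> P \<inter> {0..r}. u < s} = {u\<in>P. u < s}" by fastforce
  then show ?thesis by (simp add: left_nb_def)
qed

lemma partition_restrict:
  assumes P: "is_partition t P" and r: "r \<in> P"
  shows "is_partition r (P \<inter> {0..r})" and "mesh (P \<inter> {0..r}) \<le> mesh P"
proof -
  note Pr = partition_rules[OF P]
  show part: "is_partition r (P \<inter> {0..r})" using Pr r by (auto simp: is_partition_def)
  show "mesh (P \<inter> {0..r}) \<le> mesh P"
  proof (rule mesh_le[OF part])
    fix s assume s: "s \<in> P \<inter> {0..r}"
    have "left_nb (P \<inter> {0..r}) s = left_nb P s" using s Pr(5) by (intro left_nb_restrict) auto
    then show "s - left_nb (P \<inter> {0..r}) s \<le> mesh P"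
      using cell_length_le_mesh[OF P, of s] s Pr by auto
  qed
qed

lemma fine_partition_exists:
  assumes t: "0 \<le> t" and d: "0 < d"
  obtains P where "is_partition t P" "mesh P < d"
proof -
  obtain n :: nat where n: "t / d < real n" using reals_Archimedean2 by blast
  have n0: "0 < real n" using n t d by (meson divide_nonneg_pos order.strict_trans1)
  define P where "P = (\<lambda>k. t * real k / real n) ` {0..n}"
  have P: "is_partition t P" unfolding is_partition_def
  proof (intro conjI)
    show "0 \<in> P" unfolding P_def by (rule image_eqI[of _ _ 0]) auto
    show "t \<in> P" unfolding P_def by (rule image_eqI[of _ _ n]) (use n0 in auto)
    show "P \<subseteq> {0..t}"
    proof
      fix s assume "s \<in> P"
      then obtain k where k: "s = t * real k / real n" "k \<le> n"
      unfolding P_def by (elim imageE) (metis atLeastAtMost_iff)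
      have "t * real k \<le> t * real n" using t k(2) by (intro mult_left_mono) auto
      then show "s \<in> {0..t}" using k(1) t n0 by (simp add: pos_divide_le_eq)
    qed
  qed (simp add: P_def)
  have "mesh P \<le> t / real n"
  proof (rule mesh_le[OF P])
    fix s assume sP: "s \<in> P"
    then obtain k where k: "s = t * real k / real n" "k \<le> n"
      unfolding P_def by (elim imageE) (metis atLeastAtMost_iff)
    show "s - left_nb P s \<le> t / real n"
    proof (cases "s = 0")
      case False
      then have s: "0 < s" using partition_rules(5)[OF P sP] by simp
      then obtain j where j: "k = Suc j" using k(1) by (cases k) auto
      have t0: "0 < t" using s k(1) t by (cases "t = 0") auto
      have diff: "s - t * real j / real n = t / real n" unfolding k(1) j by (simp add: algebra_simps add_divide_distrib)
      have "t * real j / real n \<in> P" unfolding P_def using k(2) j by (intro image_eqI[of _ _ j]) auto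
      moreover have "t * real j / real n < s" using diff divide_pos_pos[OF t0 n0] by linarith
      ultimately have "t * real j / real n \<le> left_nb P s"
        by (rule left_nb_pos(3)[OF partition_rules(1,2)[OF P] s])
      then show ?thesis using diff by linarith
    qed (simp add: left_nb_zero t)
  qed
  also have "t / real n < d" using n n0 d by (simp add: pos_divide_less_eq mult.commute)
  finally show ?thesis using that P by blast
qed

lemma eventually_mesh_filter:
  "eventually Q (mesh_filter t) \<longleftrightarrow> (\<exists>d>0. \<forall>P. is_partition t P \<and> mesh P < d \<longrightarrow> Q P)"
  unfolding mesh_filter_def
proof (subst eventually_INF_base)
  show "{0<..} \<noteq> ({} :: real set)" by (simp add: ex_in_conv[symmetric] gt_ex)
  fix a b :: real assume "a \<in> {0<..}" "b \<in> {0<..}"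
  then show "\<exists>x\<in>{0<..}. principal {P. is_partition t P \<and> mesh P < x}
      \<le> inf (principal {P. is_partition t P \<and> mesh P < a}) (principal {P. is_partition t P \<and> mesh P < b})"
    by (intro bexI[of _ "min a b"]) (auto simp: inf_principal)
next
  show "(\<exists>b\<in>{0<..}. eventually Q (principal {P. is_partition t P \<and> mesh P < b}))
      = (\<exists>d>0. \<forall>P. is_partition t P \<and> mesh P < d \<longrightarrow> Q P)"
    by (simp add: eventually_principal Bex_def)
qed

lemma mesh_filter_nontrivial:
  assumes "0 \<le> t" shows "mesh_filter t \<noteq> bot"
proof
  assume "mesh_filter t = bot"
  then have "eventually (\<lambda>P. False) (mesh_filter t)" by simp
  then obtain d where "d > 0" "\<And>P. is_partition t P \<Longrightarrow> \<not> mesh P < d" unfolding eventually_mesh_filter by blast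
  then show False using fine_partition_exists[OF assms] by metis
qed

definition refinement_Cauchy :: "real \<Rightarrow> (real set \<Rightarrow> 'w::real_normed_vector) \<Rightarrow> bool" where
  "refinement_Cauchy t f \<longleftrightarrow> (\<forall>e>0. \<exists>d>0. \<forall>P R. is_partition t P \<and> is_partition t R \<and> P \<subseteq> R \<and> mesh P < d
      \<longrightarrow> norm (f P - f R) \<le> e)"

text \<open>Two fine partitions are compared through their union.\<close>

lemma mesh_filter_Cauchy_limit:
  fixes f :: "real set \<Rightarrow> 'w::banach"
  assumes t: "0 \<le> t" and cauchy: "refinement_Cauchy t f"
  obtains L where "(f \<longlongrightarrow> L) (mesh_filter t)"
proof -
  have two: "\<exists>d>0. \<forall>P R. is_partition t P \<and> is_partition t R \<and> mesh P < d \<and> mesh R < d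
      \<longrightarrow> norm (f P - f R) < e" if e: "e > 0" for e
  proof -
    obtain d where d: "d > 0" and le: "\<And>P R. is_partition t P \<Longrightarrow> is_partition t R \<Longrightarrow> P \<subseteq> R \<Longrightarrow> mesh P < d
        \<Longrightarrow> norm (f P - f R) \<le> e / 3"
      using cauchy[unfolded refinement_Cauchy_def, rule_format, of "e / 3"] e by auto
    have "norm (f P - f R) < e" if "is_partition t P" "is_partition t R" "mesh P < d" "mesh R < d" for P R
    proof -
      have U: "is_partition t (P \<union> R)" using that by (intro partition_Un)
      have "norm (f P - f R) \<le> norm (f P - f (P \<union> R)) + norm (f R - f (P \<union> R))"
        using norm_triangle_ineq4[of "f P - f (P \<union> R)" "f R - f (P \<union> R)"] by simp
      also have "\<dots> \<le> e / 3 + e / 3" using that U by (intro add_mono le) auto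
      finally show ?thesis using e by simp
    qed
    then show ?thesis using d by blast
  qed
  have "\<exists>P. is_partition t P \<and> mesh P < inverse (real (Suc n))" for n
    using fine_partition_exists[OF t, of "inverse (real (Suc n))"] by auto
  then obtain P where P: "\<And>n. is_partition t (P n)" "\<And>n. mesh (P n) < inverse (real (Suc n))" by metis
  have small: "\<exists>K. \<forall>n\<ge>K. mesh (P n) < d" if d: "d > 0" for d
  proof -
    obtain K where K: "inverse (real (Suc K)) < d" using reals_Archimedean[OF d] by blast
    have "mesh (P n) < d" if "n \<ge> K" for n
    proof -
      have "inverse (real (Suc n)) \<le> inverse (real (Suc K))" using that by (simp add: field_simps)
      then show ?thesis using P(2)[of n] K by linarith
    qed
    then show ?thesis by blast
  qed
  have "Cauchy (\<lambda>n. f (P n))"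
  proof (rule CauchyI)
    fix e :: real assume "e > 0"
    then obtain d where d: "d > 0" "\<And>P R. is_partition t P \<Longrightarrow> is_partition t R \<Longrightarrow> mesh P < d \<Longrightarrow> mesh R < d
        \<Longrightarrow> norm (f P - f R) < e" using two[of e] by auto
    obtain K where "\<forall>n\<ge>K. mesh (P n) < d" using small[OF d(1)] by blast
    then show "\<exists>K. \<forall>m\<ge>K. \<forall>n\<ge>K. norm (f (P m) - f (P n)) < e" using d(2) P(1) by blast
  qed
  then obtain L where L: "(\<lambda>n. f (P n)) \<longlonglongrightarrow> L" using Cauchy_convergent convergent_def by blast
  have "(f \<longlongrightarrow> L) (mesh_filter t)"
  proof (rule tendstoI)
    fix e :: real assume e: "e > 0"
    then obtain d where d: "d > 0" "\<And>P R. is_partition t P \<Longrightarrow> is_partition t R \<Longrightarrow> mesh P < d \<Longrightarrow> mesh R < d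
        \<Longrightarrow> norm (f P - f R) < e / 2" using two[of "e / 2"] by auto
    obtain K where K: "\<forall>n\<ge>K. mesh (P n) < d" using small[OF d(1)] by blast
    have "dist (f R) L < e" if R: "is_partition t R" "mesh R < d" for R
    proof -
      have "norm (f R - L) \<le> e / 2"
      proof (rule LIMSEQ_le_const2)
        show "(\<lambda>n. norm (f R - f (P n))) \<longlonglongrightarrow> norm (f R - L)" by (intro tendsto_intros L)
        show "\<exists>N. \<forall>n\<ge>N. norm (f R - f (P n)) \<le> e / 2" using d(2) P(1) R K by (meson less_imp_le)
      qed
      then show ?thesis using e by (simp add: dist_norm)
    qed
    then show "eventually (\<lambda>R. dist (f R) L < e) (mesh_filter t)"
      unfolding eventually_mesh_filter using d(1) by blast
  qed
  then show ?thesis by (rule that)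
qed

section \<open>Quadratic sums: deterministic estimates\<close>

text \<open>What remains of the martingale property when the filtration is forgotten: it makes
  \<open>\<Sum>\<parallel>X(s) - X(s\<^sub>-)\<parallel>\<^sup>2\<close> telescope.\<close>

definition orthogonal_increments :: "(real \<Rightarrow> 'u::real_normed_vector) \<Rightarrow> bool" where
  "orthogonal_increments X \<longleftrightarrow>
     (\<forall>s t. 0 \<le> s \<and> s \<le> t \<longrightarrow> (norm (X t - X s))\<^sup>2 = (norm (X t))\<^sup>2 - (norm (X s))\<^sup>2)"

lemma sum_increments_square:
  assumes X: "orthogonal_increments X" and P: "is_partition t P"
  shows "(\<Sum>s\<in>P. (norm (X s - X (left_nb P s)))\<^sup>2) \<le> (norm (X t))\<^sup>2"
proof -
  have "(\<Sum>s\<in>P. (norm (X s - X (left_nb P s)))\<^sup>2)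
      = (\<Sum>s\<in>P. (norm (X s))\<^sup>2 - (norm (X (left_nb P s)))\<^sup>2)"
    using X partition_left_nb[OF P partition_rules(5)[OF P]]
    by (intro sum.cong) (auto simp: orthogonal_increments_def)
  also have "\<dots> = (norm (X t))\<^sup>2 - (norm (X 0))\<^sup>2" by (rule sum_telescope[OF P])
  finally show ?thesis by simp
qed

lemma sum_increments_product:
  assumes X: "orthogonal_increments X" and Y: "orthogonal_increments Y" and P: "is_partition t P"
  shows "(\<Sum>s\<in>P. norm (X s - X (left_nb P s)) * norm (Y s - Y (left_nb P s))) \<le> norm (X t) * norm (Y t)"
proof -
  let ?f = "\<lambda>s. norm (X s - X (left_nb P s))" and ?g = "\<lambda>s. norm (Y s - Y (left_nb P s))"
  have "(\<Sum>s\<in>P. ?f s * ?g s) \<le> L2_set ?f P * L2_set ?g P" using L2_set_mult_ineq[of ?f ?g P] by simp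
  also have "\<dots> \<le> norm (X t) * norm (Y t)"
    using sum_increments_square[OF X P] sum_increments_square[OF Y P]
    by (intro mult_mono) (auto simp: L2_set_def intro: real_le_lsqrt sum_nonneg)
  finally show ?thesis .
qed

lemma norm_apply2_le: "norm (blinfun_apply (blinfun_apply L x) y) \<le> norm L * (norm x * norm y)"
proof -
  have "norm (blinfun_apply (blinfun_apply L x) y) \<le> norm (blinfun_apply L x) * norm y" by (rule norm_blinfun)
  also have "\<dots> \<le> norm L * norm x * norm y" by (intro mult_right_mono norm_blinfun) simp
  finally show ?thesis by (simp add: mult.assoc)
qed

lemma sum_bilinear_increments_le:
  assumes L: "\<And>s. s \<in> P \<Longrightarrow> norm (L s) \<le> k"
  shows "norm (\<Sum>s\<in>P. blinfun_apply (blinfun_apply (L s) (X s - X (left_nb P s))) (Y s - Y (left_nb P s)))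
    \<le> k * (\<Sum>s\<in>P. norm (X s - X (left_nb P s)) * norm (Y s - Y (left_nb P s)))"
proof -
  have "norm (\<Sum>s\<in>P. blinfun_apply (blinfun_apply (L s) (X s - X (left_nb P s))) (Y s - Y (left_nb P s)))
      \<le> (\<Sum>s\<in>P. k * (norm (X s - X (left_nb P s)) * norm (Y s - Y (left_nb P s))))"
  proof (rule sum_norm_le)
    fix s assume s: "s \<in> P"
    have "norm (blinfun_apply (blinfun_apply (L s) (X s - X (left_nb P s))) (Y s - Y (left_nb P s)))
        \<le> norm (L s) * (norm (X s - X (left_nb P s)) * norm (Y s - Y (left_nb P s)))" by (rule norm_apply2_le)
    also have "\<dots> \<le> k * (norm (X s - X (left_nb P s)) * norm (Y s - Y (left_nb P s)))"
      using L[OF s] by (rule mult_right_mono) simp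
    finally show "norm (blinfun_apply (blinfun_apply (L s) (X s - X (left_nb P s))) (Y s - Y (left_nb P s))) \<le> \<dots>" .
  qed
  then show ?thesis by (simp add: sum_distrib_left)
qed

lemma continuous_bounded_on_interval:
  fixes \<Lambda> :: "real \<Rightarrow> 'a::real_normed_vector"
  assumes "continuous_on {0..} \<Lambda>"
  obtains k where "k \<ge> 0" "\<And>s. 0 \<le> s \<Longrightarrow> s \<le> t \<Longrightarrow> norm (\<Lambda> s) \<le> k"
proof -
  have "continuous_on {0..t} \<Lambda>" using assms by (rule continuous_on_subset) auto
  then have "bounded (\<Lambda> ` {0..t})" by (intro compact_imp_bounded compact_continuous_image) auto
  then obtain k where k: "\<And>x. x \<in> \<Lambda> ` {0..t} \<Longrightarrow> norm x \<le> k" unfolding bounded_iff by blast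
  show ?thesis
  proof (rule that[of "\<bar>k\<bar>"])
    fix s assume "0 \<le> s" "s \<le> t"
    then have "norm (\<Lambda> s) \<le> k" by (intro k) auto
    then show "norm (\<Lambda> s) \<le> \<bar>k\<bar>" by linarith
  qed simp
qed

lemma continuous_uniform_on_interval:
  fixes f :: "real \<Rightarrow> 'a::real_normed_vector"
  assumes "continuous_on {0..} f" "e > 0"
  obtains d where "d > 0"
    "\<And>r s. 0 \<le> r \<Longrightarrow> r \<le> t \<Longrightarrow> 0 \<le> s \<Longrightarrow> s \<le> t \<Longrightarrow> \<bar>r - s\<bar> < d \<Longrightarrow> norm (f r - f s) < e"
proof -
  have "continuous_on {0..t} f" using assms(1) by (rule continuous_on_subset) auto
  then have "uniformly_continuous_on {0..t} f" by (intro compact_uniformly_continuous) auto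
  then obtain d where d: "d > 0" "\<And>r s. r \<in> {0..t} \<Longrightarrow> s \<in> {0..t} \<Longrightarrow> dist s r < d \<Longrightarrow> dist (f s) (f r) < e"
    using assms(2) unfolding uniformly_continuous_on_def by blast
  show ?thesis
  proof (rule that[OF d(1)])
    fix r s assume "0 \<le> r" "r \<le> t" "0 \<le> s" "s \<le> t" "\<bar>r - s\<bar> < d"
    then show "norm (f r - f s) < e" using d(2)[of s r] by (simp add: dist_norm)
  qed
qed

text \<open>Mixed terms with a factor of bounded variation vanish in the limit: the other factor has
  uniformly small increments.\<close>

lemma product_increments_tendsto_zero:
  fixes X :: "real \<Rightarrow> 'a::real_normed_vector" and V :: "real \<Rightarrow> 'b::real_normed_vector"
  assumes X: "continuous_on {0..} X" and V: "locally_bv V" and t: "0 \<le> t"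
  shows "((\<lambda>P. \<Sum>s\<in>P. norm (X s - X (left_nb P s)) * norm (V s - V (left_nb P s))) \<longlongrightarrow> 0) (mesh_filter t)"
proof (rule tendstoI)
  fix e :: real assume e: "e > 0"
  obtain k where k: "\<And>P. is_partition t P \<Longrightarrow> (\<Sum>s\<in>P. norm (V s - V (left_nb P s))) \<le> k"
    using V t unfolding locally_bv_def bdd_above_def by blast
  define k' where "k' = \<bar>k\<bar> + 1"
  have k': "0 < k'" "k < k'" unfolding k'_def by auto
  obtain d where d: "d > 0"
    "\<And>r s. 0 \<le> r \<Longrightarrow> r \<le> t \<Longrightarrow> 0 \<le> s \<Longrightarrow> s \<le> t \<Longrightarrow> \<bar>r - s\<bar> < d \<Longrightarrow> norm (X r - X s) < e / k'"
    using continuous_uniform_on_interval[OF X divide_pos_pos[OF e k'(1)], of t] by blast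
  have "(\<Sum>s\<in>P. norm (X s - X (left_nb P s)) * norm (V s - V (left_nb P s))) < e"
    if P: "is_partition t P" "mesh P < d" for P
  proof -
    have "(\<Sum>s\<in>P. norm (X s - X (left_nb P s)) * norm (V s - V (left_nb P s)))
        \<le> (\<Sum>s\<in>P. e / k' * norm (V s - V (left_nb P s)))"
    proof (rule sum_mono)
      fix s assume "s \<in> P"
      note s = partition_rules(5,6)[OF P(1) this]
      note l = partition_left_nb[OF P(1) s(1)]
      have "s - left_nb P s < d" using cell_length_le_mesh[OF P(1) s] P(2) by linarith
      then have "norm (X s - X (left_nb P s)) < e / k'" using s l by (intro d(2)) auto
      then show "norm (X s - X (left_nb P s)) * norm (V s - V (left_nb P s)) \<le> e / k' * norm (V s - V (left_nb P s))"
        by (intro mult_right_mono) auto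
    qed
    also have "\<dots> = e / k' * (\<Sum>s\<in>P. norm (V s - V (left_nb P s)))" by (simp add: sum_distrib_left)
    also have "\<dots> \<le> e / k' * k" using k[OF P(1)] e k' by (intro mult_left_mono) auto
    also have "\<dots> < e" using e k' by (simp add: pos_divide_less_eq)
    finally show ?thesis .
  qed
  moreover have "0 \<le> (\<Sum>s\<in>P. norm (X s - X (left_nb P s)) * norm (V s - V (left_nb P s)))" for P
    by (intro sum_nonneg) simp
  ultimately show "eventually (\<lambda>P. dist (\<Sum>s\<in>P. norm (X s - X (left_nb P s)) * norm (V s - V (left_nb P s))) 0 < e) (mesh_filter t)"
    unfolding eventually_mesh_filter using d(1) by (auto simp: dist_real_def)
qed

lemma eventually_partition: "eventually (is_partition t) (mesh_filter t)"
  unfolding eventually_mesh_filter by (auto intro: exI[of _ 1])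

lemma quad_sum_tendsto_zero:
  assumes \<Lambda>: "continuous_on {0..} \<Lambda>"
    and lim: "((\<lambda>P. \<Sum>s\<in>P. norm (X s - X (left_nb P s)) * norm (Y s - Y (left_nb P s))) \<longlongrightarrow> 0) (mesh_filter t)"
  shows "(quad_sum \<Lambda> X Y \<longlongrightarrow> 0) (mesh_filter t)"
proof -
  obtain k where k: "k \<ge> 0" "\<And>s. 0 \<le> s \<Longrightarrow> s \<le> t \<Longrightarrow> norm (\<Lambda> s) \<le> k"
    using continuous_bounded_on_interval[OF \<Lambda>, of t] by blast
  have "((\<lambda>P. k * (\<Sum>s\<in>P. norm (X s - X (left_nb P s)) * norm (Y s - Y (left_nb P s)))) \<longlongrightarrow> k * 0) (mesh_filter t)"
    by (intro tendsto_intros lim)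
  then have lim': "((\<lambda>P. k * (\<Sum>s\<in>P. norm (X s - X (left_nb P s)) * norm (Y s - Y (left_nb P s)))) \<longlongrightarrow> 0) (mesh_filter t)"
    by simp
  show ?thesis
  proof (rule Lim_null_comparison[OF _ lim'])
    show "\<forall>\<^sub>F P in mesh_filter t. norm (quad_sum \<Lambda> X Y P)
        \<le> k * (\<Sum>s\<in>P. norm (X s - X (left_nb P s)) * norm (Y s - Y (left_nb P s)))"
      using eventually_partition
    proof eventually_elim
      case (elim P)
      show ?case unfolding quad_sum_def
      proof (rule sum_bilinear_increments_le)
        fix s assume "s \<in> P"
        note s = partition_rules(5,6)[OF elim this]
        show "norm (\<Lambda> (left_nb P s)) \<le> k" using partition_left_nb[OF elim s(1)] s by (intro k(2)) auto
      qed
    qed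
  qed
qed

section \<open>Martingale difference sums\<close>

context wstar_completion
begin

lemma emb_sum:
  assumes "finite S" "\<And>s. s \<in> S \<Longrightarrow> c s \<in> A"
  shows "sum c S \<in> A" and "\<iota> (sum c S) = (\<Sum>s\<in>S. \<iota> (c s))"
proof -
  have "sum c S \<in> A \<and> \<iota> (sum c S) = (\<Sum>s\<in>S. \<iota> (c s))"
    using assms by (induction S rule: finite_induct) (auto simp: rules(9) emb_0 rules(3) emb_add)
  then show "sum c S \<in> A" "\<iota> (sum c S) = (\<Sum>s\<in>S. \<iota> (c s))" by auto
qed

text \<open>Bounded martingale differences are orthogonal for the trace. Hence their sum is as small as the
  root of the sum of squares, which the triangle inequality in \<open>L\<^sup>1\<close> would not give.\<close>

lemma norm_sum_martingale_differences:
  assumes F: "filtration A F" and R: "is_partition t R"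
    and c: "\<And>s. s \<in> R \<Longrightarrow> c s \<in> A"
    and ad: "\<And>s. s \<in> R \<Longrightarrow> \<iota> (c s) \<in> Lp_sub \<iota> (F s)"
    and diff: "\<And>s. s \<in> R \<Longrightarrow> cond_exp A E \<iota> (F (left_nb R s)) (\<iota> (c s)) = 0"
  shows "norm (\<Sum>s\<in>R. \<iota> (c s)) \<le> sqrt (\<Sum>s\<in>R. (l2 (c s))\<^sup>2)"
proof -
  note Rr = partition_rules[OF R]
  have main: "(l2 (sum c S))\<^sup>2 = (\<Sum>s\<in>S. (l2 (c s))\<^sup>2)" if "finite S" "S \<subseteq> R" for S
    using that
  proof (induction S rule: finite_linorder_max_induct)
    case empty
    show ?case by (simp add: l2_def E_scaleR[OF rules(9), of 0, simplified] compose_zero_right)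
  next
    case (insert b S)
    have SR: "S \<subseteq> R" and bR: "b \<in> R" and bS: "b \<notin> S" using insert.prems insert.hyps by auto
    have cS: "c s \<in> A" if "s \<in> S" for s using c SR that by blast
    have sumS: "sum c S \<in> A" "\<iota> (sum c S) = (\<Sum>s\<in>S. \<iota> (c s))"
      using emb_sum[of S c] insert.hyps(1) cS by simp_all
    have "E (op_adj (sum c S) o\<^sub>L c b) = 0"
    proof (cases "S = {}")
      case True
      then show ?thesis
        using op_adj_scaleR[OF clin[OF rules(9)], of 0] E_scaleR[OF rules(9), of 0] by (simp add: compose_zero_left)
    next
      case False
      then obtain s0 where "s0 \<in> S" by blast
      then have b0: "0 < b" using insert.hyps(2) Rr(5) SR by (meson order.strict_trans1 subsetD)
      define u where "u = left_nb R b"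
      note Fu = filtration_rules[OF F partition_left_nb(3)[OF R less_imp_le[OF b0]] order_refl, folded u_def]
      have "\<iota> (c s) \<in> Lp_sub \<iota> (F u)" if s: "s \<in> S" for s
      proof -
        have sR: "s \<in> R" and sb: "s < b" using s SR insert.hyps(2) by auto
        have "s \<le> u" unfolding u_def by (rule left_nb_pos(3)[OF Rr(1,2) b0 sR sb])
        then show ?thesis using ad[OF sR] Lp_sub_mono[OF filtration_rules(3)[OF F Rr(5)[OF sR]]] by blast
      qed
      then have "\<iota> (sum c S) \<in> Lp_sub \<iota> (F u)"
        unfolding sumS(2) by (rule subspace_sum[OF subspace_Lp_sub[OF Fu(1,2)]])
      then show ?thesis
        using diff[OF bR] unfolding u_def[symmetric]
        by (intro E_orthogonal_emb[OF Fu(1,2) sumS(1) c[OF bR]])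
    qed
    then have "(l2 (c b + sum c S))\<^sup>2 = (l2 (c b))\<^sup>2 + (l2 (sum c S))\<^sup>2"
      using l2_add_square[OF c[OF bR] sumS(1)] by simp
    then show ?case using insert.hyps(1) bS insert.IH[OF SR] by simp
  qed
  have cR: "c s \<in> A" if "s \<in> R" for s using c that by blast
  have sumR: "sum c R \<in> A" "\<iota> (sum c R) = (\<Sum>s\<in>R. \<iota> (c s))"
    using emb_sum[of R c] Rr(1) cR by simp_all
  have "norm (\<Sum>s\<in>R. \<iota> (c s)) \<le> l2 (sum c R)" using norm_emb_le_l2[OF sumR(1)] by (simp add: sumR(2))
  also have "\<dots> = sqrt (\<Sum>s\<in>R. (l2 (c s))\<^sup>2)"
    unfolding main[OF Rr(1) order_refl, symmetric] using l2_nonneg[OF sumR(1)] by simp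
  finally show ?thesis .
qed

text \<open>The form in which orthogonality is applied: the summands are dominated in \<open>L\<^sup>2\<close> by the
  increments of a process \<open>Z\<close> whose squares telescope.\<close>

lemma norm_martingale_transform:
  assumes F: "filtration A F" and R: "is_partition t R" and Z: "orthogonal_increments Z" and k: "0 \<le> k"
    and v: "\<And>s. s \<in> R \<Longrightarrow> \<exists>c\<in>A. \<iota> c = v s \<and> l2 c \<le> k * norm (Z s - Z (left_nb R s))"
    and ad: "\<And>s. s \<in> R \<Longrightarrow> v s \<in> Lp_sub \<iota> (F s)"
    and diff: "\<And>s. s \<in> R \<Longrightarrow> cond_exp A E \<iota> (F (left_nb R s)) (v s) = 0"
  shows "norm (\<Sum>s\<in>R. v s) \<le> k * norm (Z t)"
proof -
  obtain c where c: "\<And>s. s \<in> R \<Longrightarrow> c s \<in> A" "\<And>s. s \<in> R \<Longrightarrow> \<iota> (c s) = v s"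
    "\<And>s. s \<in> R \<Longrightarrow> l2 (c s) \<le> k * norm (Z s - Z (left_nb R s))" using v by metis
  have "norm (\<Sum>s\<in>R. v s) = norm (\<Sum>s\<in>R. \<iota> (c s))" using c(2) by simp
  also have "\<dots> \<le> sqrt (\<Sum>s\<in>R. (l2 (c s))\<^sup>2)"
    by (rule norm_sum_martingale_differences[OF F R c(1)]) (simp_all add: c(2) ad diff)
  also have "\<dots> \<le> sqrt (\<Sum>s\<in>R. k\<^sup>2 * (norm (Z s - Z (left_nb R s)))\<^sup>2)"
  proof (intro real_sqrt_le_mono sum_mono)
    fix s assume s: "s \<in> R"
    show "(l2 (c s))\<^sup>2 \<le> k\<^sup>2 * (norm (Z s - Z (left_nb R s)))\<^sup>2"
      unfolding power_mult_distrib[symmetric] using c(3)[OF s] l2_nonneg[OF c(1)[OF s]] by (rule power_mono)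
  qed
  also have "\<dots> = k * sqrt (\<Sum>s\<in>R. (norm (Z s - Z (left_nb R s)))\<^sup>2)"
    using k by (simp add: sum_distrib_left[symmetric] real_sqrt_mult)
  also have "\<dots> \<le> k * norm (Z t)"
    using sum_increments_square[OF Z R] k by (intro mult_left_mono real_le_lsqrt sum_nonneg) auto
  finally show ?thesis .
qed

end

section \<open>Adapted bilinear integrands\<close>

locale covariation =
  AA: wstar_completion A EA 2 \<iota>A + BB: wstar_completion B EB 2 \<iota>B + CC: wstar_completion C EC 1 \<iota>C
  for A :: "('h::chilbert_space \<Rightarrow>\<^sub>L 'h) set" and EA and \<iota>A :: "('h \<Rightarrow>\<^sub>L 'h) \<Rightarrow> 'u::banach"
    and B :: "('k::chilbert_space \<Rightarrow>\<^sub>L 'k) set" and EB and \<iota>B :: "('k \<Rightarrow>\<^sub>L 'k) \<Rightarrow> 'v::banach"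
    and C :: "('l::chilbert_space \<Rightarrow>\<^sub>L 'l) set" and EC and \<iota>C :: "('l \<Rightarrow>\<^sub>L 'l) \<Rightarrow> 'w::banach" +
  fixes FA FB FC and \<Lambda> :: "real \<Rightarrow> 'u \<Rightarrow>\<^sub>L 'v \<Rightarrow>\<^sub>L 'w"
  assumes FA: "filtration A FA" and FB: "filtration B FB" and FC: "filtration C FC"
    and adapted: "adapted_bilinear A FA EA \<iota>A B FB EB \<iota>B C FC EC \<iota>C \<Lambda>"
    and cont: "continuous_on {0..} \<Lambda>"
    and bounded: "\<And>t x y. 0 \<le> t \<Longrightarrow> x \<in> A \<Longrightarrow> y \<in> B \<Longrightarrow> \<Lambda> t (\<iota>A x) (\<iota>B y) \<in> \<iota>C ` C"
    and Hoelder: "\<And>t. 0 \<le> t \<Longrightarrow> bdd_above {nc_norm EC r c | p q r x y c.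
             1 \<le> p \<and> 1 \<le> q \<and> 1 \<le> r \<and> 1 / p + 1 / q = 1 / r \<and>
             x \<in> A \<and> nc_norm EA p x \<le> 1 \<and> y \<in> B \<and> nc_norm EB q y \<le> 1 \<and>
             c \<in> C \<and> \<iota>C c = \<Lambda> t (\<iota>A x) (\<iota>B y)}"
begin

lemma bounded_representative:
  assumes "0 \<le> t" "x \<in> A" "y \<in> B"
  obtains c where "c \<in> C" "\<iota>C c = \<Lambda> t (\<iota>A x) (\<iota>B y)"
proof -
  obtain c where "\<Lambda> t (\<iota>A x) (\<iota>B y) = \<iota>C c" "c \<in> C" using bounded[OF assms] by (rule imageE)
  then show thesis by (intro that[of c]) simp_all
qed

text \<open>The Hoelder-type bounds at the exponents \<open>(\<infinity>, 2, 2)\<close> and \<open>(2, \<infinity>, 2)\<close>, in homogeneous form. The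
  element \<open>c\<close> is existentially quantified in place of a function inverting the embedding.\<close>

definition L2_bounded_at :: "real \<Rightarrow> real \<Rightarrow> bool" where
  "L2_bounded_at t k \<longleftrightarrow> 0 \<le> k \<and> (\<forall>x\<in>A. \<forall>y\<in>B.
     (\<exists>c\<in>C. \<iota>C c = \<Lambda> t (\<iota>A x) (\<iota>B y) \<and> CC.l2 c \<le> k * (norm x * BB.l2 y)) \<and>
     (\<exists>c\<in>C. \<iota>C c = \<Lambda> t (\<iota>A x) (\<iota>B y) \<and> CC.l2 c \<le> k * (AA.l2 x * norm y)))"

lemma L2_bounded_at_mono:
  assumes "L2_bounded_at t k" "k \<le> k'" shows "L2_bounded_at t k'"
  unfolding L2_bounded_at_def
proof (intro conjI ballI)
  show "0 \<le> k'" using assms unfolding L2_bounded_at_def by linarith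
  fix x y assume xy: "x \<in> A" "y \<in> B"
  obtain c where c: "c \<in> C" "\<iota>C c = \<Lambda> t (\<iota>A x) (\<iota>B y)" "CC.l2 c \<le> k * (norm x * BB.l2 y)"
    using assms(1) xy unfolding L2_bounded_at_def by blast
  have "k * (norm x * BB.l2 y) \<le> k' * (norm x * BB.l2 y)"
    using assms(2) BB.l2_nonneg[OF xy(2)] by (intro mult_right_mono) auto
  then show "\<exists>c\<in>C. \<iota>C c = \<Lambda> t (\<iota>A x) (\<iota>B y) \<and> CC.l2 c \<le> k' * (norm x * BB.l2 y)"
    using c by (intro bexI[of _ c]) auto
  obtain c where c: "c \<in> C" "\<iota>C c = \<Lambda> t (\<iota>A x) (\<iota>B y)" "CC.l2 c \<le> k * (AA.l2 x * norm y)"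
    using assms(1) xy unfolding L2_bounded_at_def by blast
  have "k * (AA.l2 x * norm y) \<le> k' * (AA.l2 x * norm y)"
    using assms(2) AA.l2_nonneg[OF xy(1)] by (intro mult_right_mono) auto
  then show "\<exists>c\<in>C. \<iota>C c = \<Lambda> t (\<iota>A x) (\<iota>B y) \<and> CC.l2 c \<le> k' * (AA.l2 x * norm y)"
    using c by (intro bexI[of _ c]) auto
qed

lemma L2_bounded_at_exists:
  assumes t: "0 \<le> t" obtains k where "L2_bounded_at t k"
proof -
  define S where "S = {nc_norm EC r c | p q r x y c.
             1 \<le> p \<and> 1 \<le> q \<and> 1 \<le> r \<and> 1 / p + 1 / q = 1 / r \<and>
             x \<in> A \<and> nc_norm EA p x \<le> 1 \<and> y \<in> B \<and> nc_norm EB q y \<le> 1 \<and>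
             c \<in> C \<and> \<iota>C c = \<Lambda> t (\<iota>A x) (\<iota>B y)}"
  have "bdd_above S" unfolding S_def by (rule Hoelder[OF t])
  then obtain k where kS: "\<And>v. v \<in> S \<Longrightarrow> v \<le> k" unfolding bdd_above_def by blast
  have k: "nc_norm EC r c \<le> k" if "1 \<le> p" "1 \<le> q" "1 \<le> r" "1 / p + 1 / q = 1 / r"
      "x \<in> A" "nc_norm EA p x \<le> 1" "y \<in> B" "nc_norm EB q y \<le> 1"
      "c \<in> C" "\<iota>C c = \<Lambda> t (\<iota>A x) (\<iota>B y)" for p q r x y c
    by (rule kS, unfold S_def, rule CollectI, rule exI[of _ p], rule exI[of _ q], rule exI[of _ r],
        rule exI[of _ x], rule exI[of _ y], rule exI[of _ c]) (simp add: that)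
  have one2: "(1::ennreal) \<le> 2" by simp
  have homogeneous: "\<exists>c\<in>C. \<iota>C c = \<Lambda> t (\<iota>A x) (\<iota>B y) \<and> CC.l2 c \<le> \<bar>k\<bar> * (a * b)"
    if x: "x \<in> A" and y: "y \<in> B" and a: "0 \<le> a" "a = 0 \<Longrightarrow> \<iota>A x = 0" and b: "0 \<le> b" "b = 0 \<Longrightarrow> \<iota>B y = 0"
      and unit: "\<And>c. a \<noteq> 0 \<Longrightarrow> b \<noteq> 0 \<Longrightarrow> c \<in> C \<Longrightarrow>
        \<iota>C c = \<Lambda> t (\<iota>A (inverse a *\<^sub>R x)) (\<iota>B (inverse b *\<^sub>R y)) \<Longrightarrow> CC.l2 c \<le> k"
    for x y a b
  proof (cases "a = 0 \<or> b = 0")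
    case True
    then have "\<Lambda> t (\<iota>A x) (\<iota>B y) = 0" using a b by (auto simp: blinfun.zero_right blinfun.zero_left)
    moreover have "CC.l2 0 = 0" using CC.l2_scaleR[OF CC.rules(9), of 0] by simp
    ultimately show ?thesis using a b by (intro bexI[OF _ CC.rules(9)]) (simp add: CC.emb_0)
  next
    case False
    then have ab: "a \<noteq> 0" "b \<noteq> 0" "0 < a * b" using a b by auto
    have xa: "inverse a *\<^sub>R x \<in> A" and yb: "inverse b *\<^sub>R y \<in> B" using x y by (simp_all add: AA.rules BB.rules)
    obtain c where c: "c \<in> C" "\<iota>C c = \<Lambda> t (\<iota>A (inverse a *\<^sub>R x)) (\<iota>B (inverse b *\<^sub>R y))"
      by (rule bounded_representative[OF t xa yb])
    have le: "CC.l2 c \<le> k" by (rule unit[OF ab(1,2) c])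
    have one: "a * b * (inverse b * inverse a) = 1" using ab(1,2) by (simp add: field_simps)
    show ?thesis
    proof (intro bexI conjI)
      show "(a * b) *\<^sub>R c \<in> C" using c(1) by (rule CC.rules(7))
      show "\<iota>C ((a * b) *\<^sub>R c) = \<Lambda> t (\<iota>A x) (\<iota>B y)"
        using ab(1,2) x y one by (simp add: CC.emb_scaleR[OF c(1)] c(2) AA.emb_scaleR BB.emb_scaleR
            blinfun.scaleR_right blinfun.scaleR_left)
      have "CC.l2 ((a * b) *\<^sub>R c) = (a * b) * CC.l2 c" using ab(3) by (simp add: CC.l2_scaleR[OF c(1)])
      also have "\<dots> \<le> (a * b) * \<bar>k\<bar>" using le ab(3) by (intro mult_left_mono) auto
      finally show "CC.l2 ((a * b) *\<^sub>R c) \<le> \<bar>k\<bar> * (a * b)" by (simp add: mult.commute)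
    qed
  qed
  have "L2_bounded_at t \<bar>k\<bar>"
    unfolding L2_bounded_at_def
  proof (intro conjI ballI)
    fix x y assume x: "x \<in> A" and y: "y \<in> B"
    have nx: "norm (\<iota>A x) = AA.l2 x" and ny: "norm (\<iota>B y) = BB.l2 y"
      using AA.nc_norm_2[OF x] BB.nc_norm_2[OF y] by (simp_all add: AA.norm_emb[OF x] BB.norm_emb[OF y])
    show "\<exists>c\<in>C. \<iota>C c = \<Lambda> t (\<iota>A x) (\<iota>B y) \<and> CC.l2 c \<le> \<bar>k\<bar> * (norm x * BB.l2 y)"
    proof (rule homogeneous[OF x y])
      show "0 \<le> BB.l2 y" by (rule BB.l2_nonneg[OF y])
      show "\<iota>B y = 0" if "BB.l2 y = 0" using ny that by simp
      show "\<iota>A x = 0" if "norm x = 0" using that by (simp add: AA.emb_0)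
      fix c assume nz: "norm x \<noteq> 0" "BB.l2 y \<noteq> 0" and c: "c \<in> C"
        and eq: "\<iota>C c = \<Lambda> t (\<iota>A (inverse (norm x) *\<^sub>R x)) (\<iota>B (inverse (BB.l2 y) *\<^sub>R y))"
      have "nc_norm EC 2 c \<le> k"
      proof (rule k[of \<infinity> 2 2, OF _ one2 one2 _ AA.rules(7)[OF x] _ BB.rules(7)[OF y] _ c eq])
        show "nc_norm EA \<infinity> (inverse (norm x) *\<^sub>R x) \<le> 1" using nz by (simp add: nc_norm_def)
        show "nc_norm EB 2 (inverse (BB.l2 y) *\<^sub>R y) \<le> 1"
          using nz BB.l2_nonneg[OF y] by (simp add: BB.nc_norm_2[OF BB.rules(7)[OF y]] BB.l2_scaleR[OF y])
      qed simp_all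
      then show "CC.l2 c \<le> k" by (simp add: CC.nc_norm_2[OF c])
    qed simp
    show "\<exists>c\<in>C. \<iota>C c = \<Lambda> t (\<iota>A x) (\<iota>B y) \<and> CC.l2 c \<le> \<bar>k\<bar> * (AA.l2 x * norm y)"
    proof (rule homogeneous[OF x y])
      show "0 \<le> AA.l2 x" by (rule AA.l2_nonneg[OF x])
      show "\<iota>A x = 0" if "AA.l2 x = 0" using nx that by simp
      show "\<iota>B y = 0" if "norm y = 0" using that by (simp add: BB.emb_0)
      fix c assume nz: "AA.l2 x \<noteq> 0" "norm y \<noteq> 0" and c: "c \<in> C"
        and eq: "\<iota>C c = \<Lambda> t (\<iota>A (inverse (AA.l2 x) *\<^sub>R x)) (\<iota>B (inverse (norm y) *\<^sub>R y))"
      have "nc_norm EC 2 c \<le> k"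
      proof (rule k[of 2 \<infinity> 2, OF one2 _ one2 _ AA.rules(7)[OF x] _ BB.rules(7)[OF y] _ c eq])
        show "nc_norm EB \<infinity> (inverse (norm y) *\<^sub>R y) \<le> 1" using nz by (simp add: nc_norm_def)
        show "nc_norm EA 2 (inverse (AA.l2 x) *\<^sub>R x) \<le> 1"
          using nz AA.l2_nonneg[OF x] by (simp add: AA.nc_norm_2[OF AA.rules(7)[OF x]] AA.l2_scaleR[OF x])
      qed simp_all
      then show "CC.l2 c \<le> k" by (simp add: CC.nc_norm_2[OF c])
    qed simp
  qed simp
  then show thesis by (rule that)
qed

lemma adapted_left:
  "0 \<le> t \<Longrightarrow> t \<le> u \<Longrightarrow> x \<in> Lp_sub \<iota>A (FA u) \<Longrightarrow>
    cond_exp C EC \<iota>C (FC u) (\<Lambda> t x y) = \<Lambda> t x (cond_exp B EB \<iota>B (FB u) y)"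
  using adapted unfolding adapted_bilinear_def by blast

lemma adapted_right:
  "0 \<le> t \<Longrightarrow> t \<le> u \<Longrightarrow> y \<in> Lp_sub \<iota>B (FB u) \<Longrightarrow>
    cond_exp C EC \<iota>C (FC u) (\<Lambda> t x y) = \<Lambda> t (cond_exp A EA \<iota>A (FA u) x) y"
  using adapted unfolding adapted_bilinear_def by blast

text \<open>For bounded arguments the value is fixed by the conditional expectation; the general case
  follows by density.\<close>

lemma adapted_value:
  assumes tu: "0 \<le> t" "t \<le> u" and x: "x \<in> Lp_sub \<iota>A (FA u)" and y: "y \<in> Lp_sub \<iota>B (FB u)"
  shows "\<Lambda> t x y \<in> Lp_sub \<iota>C (FC u)"
proof -
  have u0: "0 \<le> u" using tu by simp
  note FAu = AA.filtration_rules[OF FA u0 order_refl] and FBu = BB.filtration_rules[OF FB u0 order_refl]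
    and FCu = CC.filtration_rules[OF FC u0 order_refl]
  have bd: "\<Lambda> t (\<iota>A a) (\<iota>B b) \<in> Lp_sub \<iota>C (FC u)" if a: "a \<in> FA u" and b: "b \<in> FB u" for a b
  proof -
    have aA: "a \<in> A" and bB: "b \<in> B" using a b FAu(2) FBu(2) by auto
    obtain c where c: "c \<in> C" "\<iota>C c = \<Lambda> t (\<iota>A a) (\<iota>B b)" by (rule bounded_representative[OF tu(1) aA bB])
    have "cond_exp C EC \<iota>C (FC u) (\<Lambda> t (\<iota>A a) (\<iota>B b)) = \<Lambda> t (\<iota>A a) (\<iota>B b)"
      using adapted_left[OF tu AA.emb_in_Lp_sub[OF a], of "\<iota>B b"]
        BB.cond_exp_self[OF FBu(1,2) BB.emb_in_Lp_sub[OF b]] by simp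
    then show ?thesis using CC.cond_exp_emb(1)[OF FCu(1,2) c(1)] by (simp add: c(2))
  qed
  obtain a where a: "\<And>n::nat. a n \<in> FA u" "(\<lambda>n. \<iota>A (a n)) \<longlonglongrightarrow> x" using AA.Lp_sub_sequence[OF x] by blast
  obtain b where b: "\<And>n::nat. b n \<in> FB u" "(\<lambda>n. \<iota>B (b n)) \<longlonglongrightarrow> y" using BB.Lp_sub_sequence[OF y] by blast
  show ?thesis
  proof (rule closed_sequentially[OF CC.closed_Lp_sub])
    show "\<Lambda> t (\<iota>A (a n)) (\<iota>B (b n)) \<in> Lp_sub \<iota>C (FC u)" for n by (rule bd[OF a(1) b(1)])
    show "(\<lambda>n. \<Lambda> t (\<iota>A (a n)) (\<iota>B (b n))) \<longlonglongrightarrow> \<Lambda> t x y"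
      by (intro blinfun.tendsto tendsto_const a b)
  qed
qed

lemma quad_sum_adapted:
  assumes P: "is_partition t P" and X: "adapted FA \<iota>A X" and Y: "adapted FB \<iota>B Y"
  shows "quad_sum \<Lambda> X Y P \<in> Lp_sub \<iota>C (FC t)"
  unfolding quad_sum_def
proof (rule subspace_sum)
  note t0 = partition_rules(4)[OF P]
  show "subspace (Lp_sub \<iota>C (FC t))"
    by (rule CC.subspace_Lp_sub[OF CC.filtration_rules(1,2)[OF FC t0 order_refl]])
  fix s assume "s \<in> P"
  note s = partition_rules(5,6)[OF P this]
  note l = partition_left_nb[OF P s(1)]
  have lt: "left_nb P s \<le> t" using l s by linarith
  have XX: "X r \<in> Lp_sub \<iota>A (FA t)" if "0 \<le> r" "r \<le> t" for r
    using X that AA.Lp_sub_mono[OF AA.filtration_rules(3)[OF FA that]] unfolding adapted_def by blast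
  have YY: "Y r \<in> Lp_sub \<iota>B (FB t)" if "0 \<le> r" "r \<le> t" for r
    using Y that BB.Lp_sub_mono[OF BB.filtration_rules(3)[OF FB that]] unfolding adapted_def by blast
  show "\<Lambda> (left_nb P s) (X s - X (left_nb P s)) (Y s - Y (left_nb P s)) \<in> Lp_sub \<iota>C (FC t)"
  proof (rule adapted_value[OF l(3) lt])
    show "X s - X (left_nb P s) \<in> Lp_sub \<iota>A (FA t)"
      by (intro subspace_diff AA.subspace_Lp_sub[OF AA.filtration_rules(1,2)[OF FA t0 order_refl]] XX s l lt)
    show "Y s - Y (left_nb P s) \<in> Lp_sub \<iota>B (FB t)"
      by (intro subspace_diff BB.subspace_Lp_sub[OF BB.filtration_rules(1,2)[OF FB t0 order_refl]] YY s l lt)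
  qed
qed

text \<open>Sums \<open>\<Sum>\<Lambda>(g s)[x\<^sub>s, N(s) - N(s\<^sub>-)]\<close> with \<open>x\<^sub>s\<close> known at time \<open>s\<^sub>-\<close> are martingale transforms; the
  two versions differ in which argument carries the increment.\<close>

lemma norm_transform_left:
  assumes R: "is_partition t R" and n: "\<And>s. 0 \<le> s \<Longrightarrow> n s \<in> FB s" "BB.weak_martingale FB (\<lambda>s. \<iota>B (n s))"
    and g: "\<And>s. s \<in> R \<Longrightarrow> 0 \<le> g s" "\<And>s. s \<in> R \<Longrightarrow> g s \<le> left_nb R s"
    and x: "\<And>s. s \<in> R \<Longrightarrow> x s \<in> FA (left_nb R s)" "\<And>s. s \<in> R \<Longrightarrow> norm (x s) \<le> \<eta>"
    and k: "\<And>s. s \<in> R \<Longrightarrow> L2_bounded_at (g s) k"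
  shows "norm (\<Sum>s\<in>R. \<Lambda> (g s) (\<iota>A (x s)) (\<iota>B (n s) - \<iota>B (n (left_nb R s)))) \<le> k * \<eta> * norm (\<iota>B (n t))"
proof (rule CC.norm_martingale_transform[OF FC R])
  show "orthogonal_increments (\<lambda>s. \<iota>B (n s))"
    unfolding orthogonal_increments_def using BB.martingale_increment[OF refl FB n(2)] by blast
  have k0: "0 \<le> k" using k[OF partition_rules(2)[OF R]] unfolding L2_bounded_at_def by blast
  have "0 \<le> \<eta>" using x(2)[OF partition_rules(2)[OF R]] norm_ge_zero order_trans by blast
  then show "0 \<le> k * \<eta>" using k0 by simp
  fix s assume s: "s \<in> R"
  let ?r = "left_nb R s"
  have l: "0 \<le> s" "0 \<le> ?r" "?r \<le> s"
    using partition_rules(5)[OF R s] partition_left_nb[OF R partition_rules(5)[OF R s]] by simp_all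
  have nB: "n r \<in> B" if "0 \<le> r" for r using n(1)[OF that] BB.filtration_rules(2)[OF FB that order_refl] by blast
  have nd: "\<iota>B (n s - n ?r) = \<iota>B (n s) - \<iota>B (n ?r)" by (rule BB.emb_diff[OF nB[OF l(1)] nB[OF l(2)]])
  have xs: "\<iota>A (x s) \<in> Lp_sub \<iota>A (FA ?r)" by (rule AA.emb_in_Lp_sub[OF x(1)[OF s]])
  show "\<exists>c\<in>C. \<iota>C c = \<Lambda> (g s) (\<iota>A (x s)) (\<iota>B (n s) - \<iota>B (n ?r))
      \<and> CC.l2 c \<le> k * \<eta> * norm (\<iota>B (n s) - \<iota>B (n ?r))"
  proof -
    have xA: "x s \<in> A" using x(1)[OF s] AA.filtration_rules(2)[OF FA l(2) order_refl] by blast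
    have dB: "n s - n ?r \<in> B" by (rule BB.rules(8)[OF nB[OF l(1)] nB[OF l(2)]])
    obtain c where c: "c \<in> C" "\<iota>C c = \<Lambda> (g s) (\<iota>A (x s)) (\<iota>B (n s - n ?r))"
      "CC.l2 c \<le> k * (norm (x s) * BB.l2 (n s - n ?r))"
      using k[OF s] xA dB unfolding L2_bounded_at_def by blast
    have "k * (norm (x s) * BB.l2 (n s - n ?r)) \<le> k * (\<eta> * BB.l2 (n s - n ?r))"
      using x(2)[OF s] k0 BB.l2_nonneg[OF dB] by (intro mult_left_mono mult_right_mono) auto
    moreover have "BB.l2 (n s - n ?r) = norm (\<iota>B (n s) - \<iota>B (n ?r))"
      using BB.norm_emb[OF dB] BB.nc_norm_2[OF dB] by (simp add: nd)
    ultimately show ?thesis using c by (intro bexI[of _ c]) (simp_all add: nd mult.assoc)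
  qed
  show "\<Lambda> (g s) (\<iota>A (x s)) (\<iota>B (n s) - \<iota>B (n ?r)) \<in> Lp_sub \<iota>C (FC s)"
    unfolding nd[symmetric]
  proof (rule adapted_value[OF g(1)[OF s]])
    show "g s \<le> s" using g(2)[OF s] l(3) by linarith
    show "\<iota>A (x s) \<in> Lp_sub \<iota>A (FA s)" using xs AA.Lp_sub_mono[OF AA.filtration_rules(3)[OF FA l(2,3)]] by blast
    have "n ?r \<in> FB s" using n(1)[OF l(2)] BB.filtration_rules(3)[OF FB l(2,3)] by blast
    then show "\<iota>B (n s - n ?r) \<in> Lp_sub \<iota>B (FB s)"
      by (intro BB.emb_in_Lp_sub von_neumann_rules(8)[OF BB.filtration_rules(1)[OF FB l(1) order_refl]] n(1)[OF l(1)])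
  qed
  show "cond_exp C EC \<iota>C (FC ?r) (\<Lambda> (g s) (\<iota>A (x s)) (\<iota>B (n s) - \<iota>B (n ?r))) = 0"
    unfolding adapted_left[OF g[OF s] xs] BB.cond_exp_increment[OF refl FB n(2) l(2,3)] by (rule blinfun.zero_right)
qed

lemma norm_transform_right:
  assumes R: "is_partition t R" and m: "\<And>s. 0 \<le> s \<Longrightarrow> m s \<in> FA s" "AA.weak_martingale FA (\<lambda>s. \<iota>A (m s))"
    and g: "\<And>s. s \<in> R \<Longrightarrow> 0 \<le> g s" "\<And>s. s \<in> R \<Longrightarrow> g s \<le> left_nb R s"
    and y: "\<And>s. s \<in> R \<Longrightarrow> y s \<in> FB (left_nb R s)" "\<And>s. s \<in> R \<Longrightarrow> norm (y s) \<le> \<eta>"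
    and k: "\<And>s. s \<in> R \<Longrightarrow> L2_bounded_at (g s) k"
  shows "norm (\<Sum>s\<in>R. \<Lambda> (g s) (\<iota>A (m s) - \<iota>A (m (left_nb R s))) (\<iota>B (y s))) \<le> k * \<eta> * norm (\<iota>A (m t))"
proof (rule CC.norm_martingale_transform[OF FC R])
  show "orthogonal_increments (\<lambda>s. \<iota>A (m s))"
    unfolding orthogonal_increments_def using AA.martingale_increment[OF refl FA m(2)] by blast
  have k0: "0 \<le> k" using k[OF partition_rules(2)[OF R]] unfolding L2_bounded_at_def by blast
  have "0 \<le> \<eta>" using y(2)[OF partition_rules(2)[OF R]] norm_ge_zero order_trans by blast
  then show "0 \<le> k * \<eta>" using k0 by simp
  fix s assume s: "s \<in> R"
  let ?r = "left_nb R s"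
  have l: "0 \<le> s" "0 \<le> ?r" "?r \<le> s"
    using partition_rules(5)[OF R s] partition_left_nb[OF R partition_rules(5)[OF R s]] by simp_all
  have mA: "m r \<in> A" if "0 \<le> r" for r using m(1)[OF that] AA.filtration_rules(2)[OF FA that order_refl] by blast
  have md: "\<iota>A (m s - m ?r) = \<iota>A (m s) - \<iota>A (m ?r)" by (rule AA.emb_diff[OF mA[OF l(1)] mA[OF l(2)]])
  have ys: "\<iota>B (y s) \<in> Lp_sub \<iota>B (FB ?r)" by (rule BB.emb_in_Lp_sub[OF y(1)[OF s]])
  show "\<exists>c\<in>C. \<iota>C c = \<Lambda> (g s) (\<iota>A (m s) - \<iota>A (m ?r)) (\<iota>B (y s))
      \<and> CC.l2 c \<le> k * \<eta> * norm (\<iota>A (m s) - \<iota>A (m ?r))"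
  proof -
    have yB: "y s \<in> B" using y(1)[OF s] BB.filtration_rules(2)[OF FB l(2) order_refl] by blast
    have dA: "m s - m ?r \<in> A" by (rule AA.rules(8)[OF mA[OF l(1)] mA[OF l(2)]])
    obtain c where c: "c \<in> C" "\<iota>C c = \<Lambda> (g s) (\<iota>A (m s - m ?r)) (\<iota>B (y s))"
      "CC.l2 c \<le> k * (AA.l2 (m s - m ?r) * norm (y s))"
      using k[OF s] dA yB unfolding L2_bounded_at_def by blast
    have "k * (AA.l2 (m s - m ?r) * norm (y s)) \<le> k * (AA.l2 (m s - m ?r) * \<eta>)"
      using y(2)[OF s] k0 AA.l2_nonneg[OF dA] by (intro mult_left_mono) auto
    moreover have "AA.l2 (m s - m ?r) = norm (\<iota>A (m s) - \<iota>A (m ?r))"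
      using AA.norm_emb[OF dA] AA.nc_norm_2[OF dA] by (simp add: md)
    ultimately show ?thesis using c by (intro bexI[of _ c]) (simp_all add: md ac_simps)
  qed
  show "\<Lambda> (g s) (\<iota>A (m s) - \<iota>A (m ?r)) (\<iota>B (y s)) \<in> Lp_sub \<iota>C (FC s)"
    unfolding md[symmetric]
  proof (rule adapted_value[OF g(1)[OF s]])
    show "g s \<le> s" using g(2)[OF s] l(3) by linarith
    show "\<iota>B (y s) \<in> Lp_sub \<iota>B (FB s)" using ys BB.Lp_sub_mono[OF BB.filtration_rules(3)[OF FB l(2,3)]] by blast
    have "m ?r \<in> FA s" using m(1)[OF l(2)] AA.filtration_rules(3)[OF FA l(2,3)] by blast
    then show "\<iota>A (m s - m ?r) \<in> Lp_sub \<iota>A (FA s)"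
      by (intro AA.emb_in_Lp_sub von_neumann_rules(8)[OF AA.filtration_rules(1)[OF FA l(1) order_refl]] m(1)[OF l(1)])
  qed
  show "cond_exp C EC \<iota>C (FC ?r) (\<Lambda> (g s) (\<iota>A (m s) - \<iota>A (m ?r)) (\<iota>B (y s))) = 0"
    unfolding adapted_right[OF g[OF s] ys] AA.cond_exp_increment[OF refl FA m(2) l(2,3)] by (simp add: blinfun.zero_right blinfun.zero_left)
qed

end

section \<open>Existence and regularity of the quadratic covariation integral\<close>

context covariation
begin

lemma weak_martingale_orthogonal_increments:
  shows "AA.weak_martingale FA M \<Longrightarrow> orthogonal_increments M"
    and "BB.weak_martingale FB N \<Longrightarrow> orthogonal_increments N"
  unfolding orthogonal_increments_def
  using AA.martingale_increment[OF refl FA] BB.martingale_increment[OF refl FB] by blast+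

text \<open>The Hoelder-type bounds are only pointwise in time. Uniformity over the times of a
  partition is obtained by sampling \<open>\<Lambda>\<close> on a fixed grid \<open>\<delta>\<int>\<close>: by uniform continuity this
  costs little in \<open>B\<^sub>2\<close>, and rounding down keeps the sampled integrand adapted.\<close>

lemma grid_sampling:
  assumes t: "0 \<le> t" and d: "0 < \<delta>"
  obtains g k where "\<And>s. 0 \<le> s \<Longrightarrow> 0 \<le> g s \<and> g s \<le> s \<and> s - g s < \<delta>"
    and "\<And>s. 0 \<le> s \<Longrightarrow> s \<le> t \<Longrightarrow> L2_bounded_at (g s) k"
proof -
  define g where "g s = \<delta> * of_int \<lfloor>s / \<delta>\<rfloor>" for s :: real
  have g: "0 \<le> g s \<and> g s \<le> s \<and> s - g s < \<delta>" if s: "0 \<le> s" for s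
  proof -
    have "0 \<le> \<lfloor>s / \<delta>\<rfloor>" using s d by simp
    moreover have "\<delta> * of_int \<lfloor>s / \<delta>\<rfloor> \<le> \<delta> * (s / \<delta>)" using d by (intro mult_left_mono) auto
    moreover have "\<delta> * (s / \<delta>) < \<delta> * (of_int \<lfloor>s / \<delta>\<rfloor> + 1)"
      using d by (intro mult_strict_left_mono) linarith+
    ultimately show ?thesis using d by (simp add: g_def algebra_simps)
  qed
  have "g ` {0..t} \<subseteq> (\<lambda>j::int. \<delta> * of_int j) ` {0..\<lfloor>t / \<delta>\<rfloor>}"
  proof
    fix v assume "v \<in> g ` {0..t}"
    then obtain s where s: "v = g s" "0 \<le> s" "s \<le> t" by auto
    have "\<lfloor>s / \<delta>\<rfloor> \<le> \<lfloor>t / \<delta>\<rfloor>" using s d by (intro floor_mono divide_right_mono) auto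
    then show "v \<in> (\<lambda>j::int. \<delta> * of_int j) ` {0..\<lfloor>t / \<delta>\<rfloor>}"
      using s d by (intro image_eqI[of _ _ "\<lfloor>s / \<delta>\<rfloor>"]) (simp_all add: g_def)
  qed
  then have fin: "finite (g ` {0..t})" by (rule finite_subset) simp
  have "\<exists>k. L2_bounded_at r k" if r: "0 \<le> r" for r
    using L2_bounded_at_exists[OF r] by metis
  then obtain K where K: "\<And>r. 0 \<le> r \<Longrightarrow> L2_bounded_at r (K r)" by metis
  show thesis
  proof (rule that[OF g])
    fix s assume s: "0 \<le> s" "s \<le> t"
    have "K (g s) \<le> Max (K ` g ` {0..t})" using fin s by (intro Max_ge) auto
    moreover have "0 \<le> g s" using g[OF s(1)] by simp
    ultimately show "L2_bounded_at (g s) (Max (K ` g ` {0..t}))" using K L2_bounded_at_mono by blast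
  qed
qed

text \<open>The comparison of a partition with its refinement described at the beginning: the martingales
  are operator-norm continuous here, so the transforms are small for fine partitions.\<close>

lemma quad_sum_Cauchy_bounded:
  assumes t: "0 \<le> t"
    and m: "continuous_on {0..} m" "\<And>s. 0 \<le> s \<Longrightarrow> m s \<in> FA s" "AA.weak_martingale FA (\<lambda>s. \<iota>A (m s))"
    and n: "continuous_on {0..} n" "\<And>s. 0 \<le> s \<Longrightarrow> n s \<in> FB s" "BB.weak_martingale FB (\<lambda>s. \<iota>B (n s))"
  shows "refinement_Cauchy t (quad_sum \<Lambda> (\<lambda>s. \<iota>A (m s)) (\<lambda>s. \<iota>B (n s)))"
proof -
  define M N where "M s = \<iota>A (m s)" and "N s = \<iota>B (n s)" for s
  have "refinement_Cauchy t (quad_sum \<Lambda> M N)"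
    unfolding refinement_Cauchy_def
  proof (intro allI impI)
    fix e :: real assume e: "0 < e"
    have oM: "orthogonal_increments M" and oN: "orthogonal_increments N"
      unfolding M_def N_def using weak_martingale_orthogonal_increments m(3) n(3) by simp_all
    define V where "V = norm (M t) * norm (N t) + norm (M t) + norm (N t) + 1"
    have V: "0 < V" "norm (M t) * norm (N t) \<le> V" "norm (M t) \<le> V" "norm (N t) \<le> V"
      unfolding V_def by (simp_all add: add_nonneg_pos)
    define e1 where "e1 = e / (4 * V)"
    have e1: "0 < e1" unfolding e1_def using e V by simp
    obtain d1 where d1: "d1 > 0" "\<And>r s. 0 \<le> r \<Longrightarrow> r \<le> t \<Longrightarrow> 0 \<le> s \<Longrightarrow> s \<le> t \<Longrightarrow> \<bar>r - s\<bar> < d1 \<Longrightarrow> norm (\<Lambda> r - \<Lambda> s) < e1"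
      using continuous_uniform_on_interval[OF cont e1, of t] by blast
    have "0 < d1 / 2" using d1(1) by simp
    then obtain g k where g: "\<And>s. 0 \<le> s \<Longrightarrow> 0 \<le> g s \<and> g s \<le> s \<and> s - g s < d1 / 2"
      and gk: "\<And>s. 0 \<le> s \<Longrightarrow> s \<le> t \<Longrightarrow> L2_bounded_at (g s) k"
      using grid_sampling[OF t] by metis
    have k: "0 \<le> k" using gk[OF order_refl t] unfolding L2_bounded_at_def by blast
    \<comment> \<open>\<open>e1\<close> makes each of the two sampling errors, and \<open>\<eta>\<close> each of the two transforms, at most \<open>e / 4\<close>.\<close>
    define c where "c = k + 1"
    have c: "0 < c" "k \<le> c" unfolding c_def using k by simp_all
    define \<eta> where "\<eta> = e / (4 * V * c)"
    have \<eta>: "0 < \<eta>" unfolding \<eta>_def using e V(1) c(1) by simp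
    have k\<eta>: "k * \<eta> * v \<le> e / 4" if "v \<le> V" for v
    proof -
      have "k * \<eta> * v \<le> k * \<eta> * V" using k \<eta> that by (intro mult_left_mono) auto
      also have "\<dots> \<le> c * \<eta> * V" using \<eta> V(1) c(2) by (intro mult_right_mono) auto
      also have "\<dots> = e / 4" unfolding \<eta>_def using V(1) c(1) by (simp add: field_simps)
      finally show ?thesis .
    qed
    obtain d2 where d2: "d2 > 0" "\<And>r s. 0 \<le> r \<Longrightarrow> r \<le> t \<Longrightarrow> 0 \<le> s \<Longrightarrow> s \<le> t \<Longrightarrow> \<bar>r - s\<bar> < d2 \<Longrightarrow> norm (m r - m s) < \<eta>"
      using continuous_uniform_on_interval[OF m(1) \<eta>, of t] by blast
    obtain d3 where d3: "d3 > 0" "\<And>r s. 0 \<le> r \<Longrightarrow> r \<le> t \<Longrightarrow> 0 \<le> s \<Longrightarrow> s \<le> t \<Longrightarrow> \<bar>r - s\<bar> < d3 \<Longrightarrow> norm (n r - n s) < \<eta>"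
      using continuous_uniform_on_interval[OF n(1) \<eta>, of t] by blast
    define d where "d = min (d1 / 2) (min d2 d3)"
    have d: "0 < d" unfolding d_def using d1(1) d2(1) d3(1) by simp
    have "norm (quad_sum \<Lambda> M N P - quad_sum \<Lambda> M N R) \<le> e"
      if P: "is_partition t P" and R: "is_partition t R" and PR: "P \<subseteq> R" and mesh: "mesh P < d" for P R
    proof -
      let ?a = "left_nb P" and ?b = "left_nb R"
      have order: "0 \<le> ?a s" "?a s \<le> ?b s" "?b s \<le> s" "s \<le> t" "s - ?a s < d" "0 \<le> s" if s: "s \<in> R" for s
      proof -
        note st = partition_rules(5,6)[OF R s]
        show "0 \<le> s" "s \<le> t" by (fact st)+
        show "0 \<le> ?a s" "?b s \<le> s" by (rule partition_left_nb[OF P st(1)] partition_left_nb[OF R st(1)])+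
        show "?a s \<le> ?b s"
        proof (cases "s = 0")
          case False
          then have s0: "0 < s" using st by simp
          show ?thesis
            using left_nb_pos(3)[OF partition_rules(1,2)[OF R] s0] left_nb_pos(1,2)[OF partition_rules(1,2)[OF P] s0] PR
            by blast
        qed (simp add: left_nb_zero)
        show "s - ?a s < d" using cell_length_le_mesh[OF P st] mesh by linarith
      qed
      \<comment> \<open>\<open>F\<close> is the sampled sum over one coarse cell; \<open>S1\<close>, \<open>S2\<close> are the sampling errors and \<open>T1\<close>,
        \<open>T2\<close> the two martingale transforms.\<close>
      define F where "F a s = \<Lambda> (g a) (M s - M a) (N s - N a)" for a s
      let ?S1 = "\<Sum>s\<in>P. (\<Lambda> (?a s) - \<Lambda> (g (?a s))) (M s - M (?a s)) (N s - N (?a s))"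
      let ?S2 = "\<Sum>s\<in>R. (\<Lambda> (g (?a s)) - \<Lambda> (?b s)) (M s - M (?b s)) (N s - N (?b s))"
      let ?T1 = "\<Sum>s\<in>R. \<Lambda> (g (?a s)) (\<iota>A (m (?b s) - m (?a s))) (N s - N (?b s))"
      let ?T2 = "\<Sum>s\<in>R. \<Lambda> (g (?a s)) (M s - M (?b s)) (\<iota>B (n (?b s) - n (?a s)))"
      have mA: "m s \<in> A" if "0 \<le> s" for s using m(2)[OF that] AA.filtration_rules(2)[OF FA that order_refl] by blast
      have nB: "n s \<in> B" if "0 \<le> s" for s using n(2)[OF that] BB.filtration_rules(2)[OF FB that order_refl] by blast
      have split: "F (?a s) s - F (?a s) (?b s) = \<Lambda> (g (?a s)) (M s - M (?b s)) (N s - N (?b s))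
          + \<Lambda> (g (?a s)) (\<iota>A (m (?b s) - m (?a s))) (N s - N (?b s))
          + \<Lambda> (g (?a s)) (M s - M (?b s)) (\<iota>B (n (?b s) - n (?a s)))" if s: "s \<in> R" for s
      proof -
        have b0: "0 \<le> ?b s" using order[OF s] by linarith
        have em: "\<iota>A (m (?b s) - m (?a s)) = M (?b s) - M (?a s)"
          unfolding M_def by (rule AA.emb_diff[OF mA[OF b0] mA[OF order(1)[OF s]]])
        have en: "\<iota>B (n (?b s) - n (?a s)) = N (?b s) - N (?a s)"
          unfolding N_def by (rule BB.emb_diff[OF nB[OF b0] nB[OF order(1)[OF s]]])
        have bil: "L (x + x') (y + y') - L x' y' = L x y + L x' y + L x y'"
          for L :: "'u \<Rightarrow>\<^sub>L 'v \<Rightarrow>\<^sub>L 'w" and x x' y y'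
          by (simp add: blinfun.add_right blinfun.add_left)
        show ?thesis
          using bil[of "\<Lambda> (g (?a s))" "M s - M (?b s)" "M (?b s) - M (?a s)" "N s - N (?b s)" "N (?b s) - N (?a s)"]
          unfolding F_def em en by simp
      qed
      have "quad_sum \<Lambda> M N P = ?S1 + (\<Sum>s\<in>P. F (?a s) s)"
        unfolding quad_sum_def F_def by (simp add: blinfun.diff_left sum_subtractf)
      also have "(\<Sum>s\<in>P. F (?a s) s) = (\<Sum>s\<in>R. F (?a s) s - F (?a s) (?b s))"
        by (rule sum_refine[OF P R PR]) (simp add: F_def blinfun.zero_right)
      also have "\<dots> = (\<Sum>s\<in>R. \<Lambda> (g (?a s)) (M s - M (?b s)) (N s - N (?b s))
          + \<Lambda> (g (?a s)) (\<iota>A (m (?b s) - m (?a s))) (N s - N (?b s))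
          + \<Lambda> (g (?a s)) (M s - M (?b s)) (\<iota>B (n (?b s) - n (?a s))))"
        by (rule sum.cong[OF refl split])
      also have "\<dots> = (?S2 + quad_sum \<Lambda> M N R) + ?T1 + ?T2"
        unfolding quad_sum_def by (simp add: sum.distrib blinfun.diff_left sum_subtractf)
      finally have eq: "quad_sum \<Lambda> M N P - quad_sum \<Lambda> M N R = ?S1 + ?S2 + ?T1 + ?T2" by simp
      have e1V: "e1 * v \<le> e / 4" if "v \<le> V" for v
      proof -
        have "e1 * v \<le> e1 * V" using e1 that by (intro mult_left_mono) auto
        also have "\<dots> = e / 4" unfolding e1_def using V(1) by simp
        finally show ?thesis .
      qed
      have prodP: "(\<Sum>s\<in>P. norm (M s - M (?a s)) * norm (N s - N (?a s))) \<le> V"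
        using sum_increments_product[OF oM oN P] V(2) by linarith
      have prodR: "(\<Sum>s\<in>R. norm (M s - M (?b s)) * norm (N s - N (?b s))) \<le> V"
        using sum_increments_product[OF oM oN R] V(2) by linarith
      have "norm ?S1 \<le> e1 * (\<Sum>s\<in>P. norm (M s - M (?a s)) * norm (N s - N (?a s)))"
      proof (rule sum_bilinear_increments_le)
        fix s assume "s \<in> P"
        then have s: "s \<in> R" using PR by blast
        show "norm (\<Lambda> (?a s) - \<Lambda> (g (?a s))) \<le> e1"
          using order[OF s] g[OF order(1)[OF s]] d1(1) by (intro d1(2)[THEN less_imp_le]) auto
      qed
      also have "\<dots> \<le> e / 4" by (rule e1V[OF prodP])
      finally have S1: "norm ?S1 \<le> e / 4" .
      have "norm ?S2 \<le> e1 * (\<Sum>s\<in>R. norm (M s - M (?b s)) * norm (N s - N (?b s)))"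
      proof (rule sum_bilinear_increments_le)
        fix s assume s: "s \<in> R"
        have "\<bar>g (?a s) - ?b s\<bar> < d1"
          using order[OF s] g[OF order(1)[OF s]] unfolding d_def by linarith
        then show "norm (\<Lambda> (g (?a s)) - \<Lambda> (?b s)) \<le> e1"
          using order[OF s] g[OF order(1)[OF s]] by (intro d1(2)[THEN less_imp_le]) auto
      qed
      also have "\<dots> \<le> e / 4" by (rule e1V[OF prodR])
      finally have S2: "norm ?S2 \<le> e / 4" .
      have "norm ?T1 \<le> k * \<eta> * norm (\<iota>B (n t))"
        unfolding N_def
      proof (rule norm_transform_left[OF R n(2,3)])
        fix s assume s: "s \<in> R"
        have b0: "0 \<le> ?b s" using order[OF s] by linarith
        show "0 \<le> g (?a s)" "g (?a s) \<le> ?b s" using order[OF s] g[OF order(1)[OF s]] by linarith+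
        have "m (?a s) \<in> FA (?b s)" using m(2)[OF order(1)[OF s]] AA.filtration_rules(3)[OF FA order(1,2)[OF s]] by blast
        then show "m (?b s) - m (?a s) \<in> FA (?b s)"
          by (intro von_neumann_rules(8)[OF AA.filtration_rules(1)[OF FA b0 order_refl]] m(2)[OF b0])
        show "norm (m (?b s) - m (?a s)) \<le> \<eta>"
          using order[OF s] unfolding d_def by (intro d2(2)[THEN less_imp_le]) auto
        show "L2_bounded_at (g (?a s)) k" using order[OF s] by (intro gk) auto
      qed
      also have "\<dots> \<le> e / 4" using V(4) unfolding N_def by (rule k\<eta>)
      finally have T1: "norm ?T1 \<le> e / 4" .
      have "norm ?T2 \<le> k * \<eta> * norm (\<iota>A (m t))"
        unfolding M_def
      proof (rule norm_transform_right[OF R m(2,3)])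
        fix s assume s: "s \<in> R"
        have b0: "0 \<le> ?b s" using order[OF s] by linarith
        show "0 \<le> g (?a s)" "g (?a s) \<le> ?b s" using order[OF s] g[OF order(1)[OF s]] by linarith+
        have "n (?a s) \<in> FB (?b s)" using n(2)[OF order(1)[OF s]] BB.filtration_rules(3)[OF FB order(1,2)[OF s]] by blast
        then show "n (?b s) - n (?a s) \<in> FB (?b s)"
          by (intro von_neumann_rules(8)[OF BB.filtration_rules(1)[OF FB b0 order_refl]] n(2)[OF b0])
        show "norm (n (?b s) - n (?a s)) \<le> \<eta>"
          using order[OF s] unfolding d_def by (intro d3(2)[THEN less_imp_le]) auto
        show "L2_bounded_at (g (?a s)) k" using order[OF s] by (intro gk) auto
      qed
      also have "\<dots> \<le> e / 4" using V(3) unfolding M_def by (rule k\<eta>)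
      finally have T2: "norm ?T2 \<le> e / 4" .
      have "norm (?S1 + ?S2 + ?T1 + ?T2) \<le> norm ?S1 + norm ?S2 + norm ?T1 + norm ?T2"
        by (intro norm_triangle_le add_mono order_refl)
      then show ?thesis unfolding eq using S1 S2 T1 T2 by linarith
    qed
    then show "\<exists>d>0. \<forall>P R. is_partition t P \<and> is_partition t R \<and> P \<subseteq> R \<and> mesh P < d \<longrightarrow>
      norm (quad_sum \<Lambda> M N P - quad_sum \<Lambda> M N R) \<le> e" using d by blast
  qed
  then show ?thesis unfolding M_def N_def .
qed

lemma quad_sum_bound:
  assumes M: "orthogonal_increments M" and N: "orthogonal_increments N" and P: "is_partition t P"
    and k: "0 \<le> k" "\<And>s. 0 \<le> s \<Longrightarrow> s \<le> t \<Longrightarrow> norm (\<Lambda> s) \<le> k"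
  shows "norm (quad_sum \<Lambda> M N P) \<le> k * (norm (M t) * norm (N t))"
proof -
  have "norm (quad_sum \<Lambda> M N P) \<le> k * (\<Sum>s\<in>P. norm (M s - M (left_nb P s)) * norm (N s - N (left_nb P s)))"
    unfolding quad_sum_def
  proof (rule sum_bilinear_increments_le)
    fix s assume "s \<in> P"
    note s = partition_rules(5,6)[OF P this]
    show "norm (\<Lambda> (left_nb P s)) \<le> k" using partition_left_nb[OF P s(1)] s by (intro k(2)) auto
  qed
  also have "\<dots> \<le> k * (norm (M t) * norm (N t))" using k(1) by (intro mult_left_mono sum_increments_product M N P)
  finally show ?thesis .
qed

lemma quad_sum_diff_left: "quad_sum \<Lambda> (\<lambda>s. X s - Y s) Z P = quad_sum \<Lambda> X Z P - quad_sum \<Lambda> Y Z P"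
proof -
  have eq: "X s - Y s - (X r - Y r) = (X s - X r) - (Y s - Y r)" for r s by simp
  have "\<Lambda> l (X s - Y s - (X r - Y r)) z = \<Lambda> l (X s - X r) z - \<Lambda> l (Y s - Y r) z" for l r s z
    by (simp only: eq blinfun.diff_right[of "\<Lambda> l" "X s - X r" "Y s - Y r"] blinfun.diff_left)
  then show ?thesis unfolding quad_sum_def sum_subtractf[symmetric] by (simp only:)
qed

lemma quad_sum_diff_right: "quad_sum \<Lambda> Z (\<lambda>s. X s - Y s) P = quad_sum \<Lambda> Z X P - quad_sum \<Lambda> Z Y P"
proof -
  have eq: "X s - Y s - (X r - Y r) = (X s - X r) - (Y s - Y r)" for r s by simp
  have "\<Lambda> l z (X s - Y s - (X r - Y r)) = \<Lambda> l z (X s - X r) - \<Lambda> l z (Y s - Y r)" for l r s z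
    by (simp only: eq blinfun.diff_right[of "\<Lambda> l z" "X s - X r" "Y s - Y r"])
  then show ?thesis unfolding quad_sum_def sum_subtractf[symmetric] by (simp only:)
qed

text \<open>Replacing \<open>M\<close> and \<open>N\<close> by approximants changes every quadratic sum by little,
  uniformly over all partitions, so the Cauchy property passes to the limit.\<close>

lemma quad_sum_Cauchy:
  assumes t: "0 \<le> t"
    and M: "AA.weak_martingale FA M" "loc_unif_approximable A FA EA \<iota>A M"
    and N: "BB.weak_martingale FB N" "loc_unif_approximable B FB EB \<iota>B N"
  shows "refinement_Cauchy t (quad_sum \<Lambda> M N)"
  unfolding refinement_Cauchy_def
proof (intro allI impI)
  fix e :: real assume e: "0 < e"
  obtain m where m: "\<And>j. continuous_on {0..} (m j)" "\<And>j s. 0 \<le> s \<Longrightarrow> m j s \<in> FA s"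
      "\<And>j. Lp_martingale A FA EA \<iota>A (\<lambda>s. \<iota>A (m j s))"
    and limm: "uniform_limit {0..t} (\<lambda>j s. \<iota>A (m j s)) M sequentially"
    using M(2) t unfolding loc_unif_approximable_def by metis
  obtain n where n: "\<And>j. continuous_on {0..} (n j)" "\<And>j s. 0 \<le> s \<Longrightarrow> n j s \<in> FB s"
      "\<And>j. Lp_martingale B FB EB \<iota>B (\<lambda>s. \<iota>B (n j s))"
    and limn: "uniform_limit {0..t} (\<lambda>j s. \<iota>B (n j s)) N sequentially"
    using N(2) t unfolding loc_unif_approximable_def by metis
  define Mj Nj where "Mj j s = \<iota>A (m j s)" and "Nj j s = \<iota>B (n j s)" for j s
  have wM: "AA.weak_martingale FA (Mj j)" and wN: "BB.weak_martingale FB (Nj j)" for j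
    unfolding Mj_def Nj_def using AA.weak_martingaleI[OF refl FA m(3)] BB.weak_martingaleI[OF refl FB n(3)] by simp_all
  have Mt: "(\<lambda>j. Mj j t) \<longlonglongrightarrow> M t" and Nt: "(\<lambda>j. Nj j t) \<longlonglongrightarrow> N t"
    unfolding Mj_def Nj_def using tendsto_uniform_limitI[OF limm, of t] tendsto_uniform_limitI[OF limn, of t] t by simp_all
  obtain k where k: "0 \<le> k" "\<And>s. 0 \<le> s \<Longrightarrow> s \<le> t \<Longrightarrow> norm (\<Lambda> s) \<le> k"
    using continuous_bounded_on_interval[OF cont, of t] by blast
  define \<epsilon> where "\<epsilon> j = k * (norm (M t - Mj j t) * norm (N t)) + k * (norm (Mj j t) * norm (N t - Nj j t))" for j
  have "\<epsilon> \<longlonglongrightarrow> k * (norm (M t - M t) * norm (N t)) + k * (norm (M t) * norm (N t - N t))"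
    unfolding \<epsilon>_def by (intro tendsto_intros Mt Nt)
  then have "\<epsilon> \<longlonglongrightarrow> 0" by simp
  then have "eventually (\<lambda>j. \<epsilon> j < e / 3) sequentially" using e by (intro order_tendstoD(2)[of \<epsilon> 0]) auto
  then obtain j where j: "\<epsilon> j < e / 3" unfolding eventually_sequentially by blast
  have close: "norm (quad_sum \<Lambda> M N P - quad_sum \<Lambda> (Mj j) (Nj j) P) \<le> e / 3" if P: "is_partition t P" for P
  proof -
    have "quad_sum \<Lambda> M N P - quad_sum \<Lambda> (Mj j) (Nj j) P
        = quad_sum \<Lambda> (\<lambda>s. M s - Mj j s) N P + quad_sum \<Lambda> (Mj j) (\<lambda>s. N s - Nj j s) P"
      by (simp add: quad_sum_diff_left quad_sum_diff_right)
    also have "norm \<dots> \<le> \<epsilon> j" unfolding \<epsilon>_def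
    proof (rule norm_triangle_mono)
      have "orthogonal_increments (\<lambda>s. M s - Mj j s)"
        by (intro weak_martingale_orthogonal_increments AA.weak_martingale_diff FA M(1) wM)
      then show "norm (quad_sum \<Lambda> (\<lambda>s. M s - Mj j s) N P) \<le> k * (norm (M t - Mj j t) * norm (N t))"
        using quad_sum_bound[OF _ weak_martingale_orthogonal_increments(2)[OF N(1)] P k] by blast
      have "orthogonal_increments (\<lambda>s. N s - Nj j s)"
        by (intro weak_martingale_orthogonal_increments BB.weak_martingale_diff FB N(1) wN)
      then show "norm (quad_sum \<Lambda> (Mj j) (\<lambda>s. N s - Nj j s) P) \<le> k * (norm (Mj j t) * norm (N t - Nj j t))"
        using quad_sum_bound[OF weak_martingale_orthogonal_increments(1)[OF wM] _ P k] by blast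
    qed
    finally show ?thesis using j by simp
  qed
  have "refinement_Cauchy t (quad_sum \<Lambda> (Mj j) (Nj j))"
    using quad_sum_Cauchy_bounded[OF t m(1,2) wM[unfolded Mj_def] n(1,2) wN[unfolded Nj_def], of j j]
    unfolding Mj_def Nj_def .
  then obtain d where d: "d > 0" "\<And>P R. is_partition t P \<Longrightarrow> is_partition t R \<Longrightarrow> P \<subseteq> R \<Longrightarrow> mesh P < d \<Longrightarrow>
    norm (quad_sum \<Lambda> (Mj j) (Nj j) P - quad_sum \<Lambda> (Mj j) (Nj j) R) \<le> e / 3"
    unfolding refinement_Cauchy_def using e by (metis divide_pos_pos zero_less_numeral)
  have "norm (quad_sum \<Lambda> M N P - quad_sum \<Lambda> M N R) \<le> e"
    if P: "is_partition t P" "is_partition t R" "P \<subseteq> R" "mesh P < d" for P R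
  proof -
    let ?p = "quad_sum \<Lambda> (Mj j) (Nj j) P" and ?r = "quad_sum \<Lambda> (Mj j) (Nj j) R"
    have "quad_sum \<Lambda> M N P - quad_sum \<Lambda> M N R
        = (quad_sum \<Lambda> M N P - ?p) + (?p - ?r) + (?r - quad_sum \<Lambda> M N R)" by simp
    also have "norm \<dots> \<le> e / 3 + e / 3 + e / 3"
      using close[OF P(1)] close[OF P(2)] d(2)[OF P]
      by (intro norm_triangle_mono) (simp_all add: norm_minus_commute)
    finally show ?thesis by simp
  qed
  then show "\<exists>d>0. \<forall>P R. is_partition t P \<and> is_partition t R \<and> P \<subseteq> R \<and> mesh P < d
      \<longrightarrow> norm (quad_sum \<Lambda> M N P - quad_sum \<Lambda> M N R) \<le> e"
    using d(1) by blast
qed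

text \<open>The integral over \<open>[s, t]\<close> is controlled by the increment of \<open>\<parallel>M\<parallel>\<^sup>2 + \<parallel>N\<parallel>\<^sup>2\<close>, an
  increasing function that is continuous if \<open>M\<close> and \<open>N\<close> are. Bounded variation and continuity of the
  limit both follow from this.\<close>

lemma quad_limit_increment:
  assumes M: "orthogonal_increments M" and N: "orthogonal_increments N"
    and lim: "\<And>t. 0 \<le> t \<Longrightarrow> (quad_sum \<Lambda> M N \<longlongrightarrow> Q t) (mesh_filter t)"
    and k: "0 \<le> k" "\<And>r. 0 \<le> r \<Longrightarrow> r \<le> t \<Longrightarrow> norm (\<Lambda> r) \<le> k"
    and st: "0 \<le> s" "s \<le> t"
  shows "norm (Q t - Q s) \<le> k * (((norm (M t))\<^sup>2 + (norm (N t))\<^sup>2) - ((norm (M s))\<^sup>2 + (norm (N s))\<^sup>2))"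
proof (rule field_le_epsilon)
  let ?\<psi> = "\<lambda>r. (norm (M r))\<^sup>2 + (norm (N r))\<^sup>2"
  fix e :: real assume e: "e > 0"
  have ev: "\<exists>d>0. \<forall>P. is_partition r P \<and> mesh P < d \<longrightarrow> dist (quad_sum \<Lambda> M N P) (Q r) < e / 2" if "0 \<le> r" for r
    using tendstoD[OF lim[OF that], of "e / 2"] e by (simp add: eventually_mesh_filter)
  have t: "0 \<le> t" using st by simp
  obtain d1 where d1: "d1 > 0" "\<And>P. is_partition t P \<Longrightarrow> mesh P < d1 \<Longrightarrow> dist (quad_sum \<Lambda> M N P) (Q t) < e / 2"
    using ev[OF t] by blast
  obtain d2 where d2: "d2 > 0" "\<And>P. is_partition s P \<Longrightarrow> mesh P < d2 \<Longrightarrow> dist (quad_sum \<Lambda> M N P) (Q s) < e / 2"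
    using ev[OF st(1)] by blast
  obtain P0 where P0: "is_partition t P0" "mesh P0 < min d1 d2" by (rule fine_partition_exists[OF t, of "min d1 d2"]) (use d1(1) d2(1) in simp)
  define P where "P = insert s P0"
  have P: "is_partition t P" unfolding P_def by (rule partition_insert[OF P0(1) st])
  have mP: "mesh P < min d1 d2" using mesh_refine_le[OF P0(1) P] P0(2) unfolding P_def by fastforce
  have sP: "s \<in> P" unfolding P_def by simp
  define P' where "P' = P \<inter> {0..s}"
  have P': "is_partition s P'" "mesh P' < d2"
    unfolding P'_def using partition_restrict[OF P sP] mP by simp_all
  have P'P: "P' \<subseteq> P" unfolding P'_def by blast
  have nb: "left_nb P' r = left_nb P r" if "r \<in> P'" for r
    unfolding P'_def using that partition_rules(5)[OF P] by (intro left_nb_restrict) (auto simp: P'_def)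
  have fin: "finite P" by (rule partition_rules(1)[OF P])
  have "quad_sum \<Lambda> M N P' = (\<Sum>r\<in>P'. \<Lambda> (left_nb P r) (M r - M (left_nb P r)) (N r - N (left_nb P r)))"
    unfolding quad_sum_def using nb by simp
  then have "quad_sum \<Lambda> M N P - quad_sum \<Lambda> M N P'
      = (\<Sum>r\<in>P. \<Lambda> (left_nb P r) (M r - M (left_nb P r)) (N r - N (left_nb P r)))
      - (\<Sum>r\<in>P'. \<Lambda> (left_nb P r) (M r - M (left_nb P r)) (N r - N (left_nb P r)))"
    by (simp only: quad_sum_def[of \<Lambda> M N P])
  also have "\<dots> = (\<Sum>r\<in>P - P'. \<Lambda> (left_nb P r) (M r - M (left_nb P r)) (N r - N (left_nb P r)))"
    by (rule sum_diff[OF fin P'P, symmetric])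
  also have "norm \<dots> \<le> (\<Sum>r\<in>P - P'. k * (?\<psi> r - ?\<psi> (left_nb P r)))"
  proof (rule sum_norm_le)
    fix r assume "r \<in> P - P'"
    then have "r \<in> P" by simp
    note r = partition_rules(5,6)[OF P this]
    note l = partition_left_nb[OF P r(1)]
    let ?x = "norm (M r - M (left_nb P r))" and ?y = "norm (N r - N (left_nb P r))"
    have "?x * ?y \<le> ?x\<^sup>2 + ?y\<^sup>2"
    proof -
      have "2 * ?x * ?y \<le> ?x\<^sup>2 + ?y\<^sup>2" by (rule sum_squares_bound)
      moreover have "0 \<le> ?x * ?y" by simp
      ultimately show ?thesis by argo
    qed
    moreover have "?x\<^sup>2 = (norm (M r))\<^sup>2 - (norm (M (left_nb P r)))\<^sup>2" "?y\<^sup>2 = (norm (N r))\<^sup>2 - (norm (N (left_nb P r)))\<^sup>2"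
      using M N l unfolding orthogonal_increments_def by blast+
    ultimately have xy: "?x * ?y \<le> ?\<psi> r - ?\<psi> (left_nb P r)" by linarith
    have "norm (\<Lambda> (left_nb P r) (M r - M (left_nb P r)) (N r - N (left_nb P r))) \<le> norm (\<Lambda> (left_nb P r)) * (?x * ?y)"
      by (rule norm_apply2_le)
    also have "\<dots> \<le> k * (?x * ?y)" using k(2)[OF l(3)] l r by (intro mult_right_mono) auto
    also have "\<dots> \<le> k * (?\<psi> r - ?\<psi> (left_nb P r))" using xy k(1) by (rule mult_left_mono)
    finally show "norm (\<Lambda> (left_nb P r) (M r - M (left_nb P r)) (N r - N (left_nb P r))) \<le> k * (?\<psi> r - ?\<psi> (left_nb P r))" .
  qed
  also have "\<dots> = k * (\<Sum>r\<in>P - P'. ?\<psi> r - ?\<psi> (left_nb P r))" by (simp add: sum_distrib_left)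
  also have "(\<Sum>r\<in>P - P'. ?\<psi> r - ?\<psi> (left_nb P r))
      = (\<Sum>r\<in>P. ?\<psi> r - ?\<psi> (left_nb P r)) - (\<Sum>r\<in>P'. ?\<psi> r - ?\<psi> (left_nb P r))"
    by (rule sum_diff[OF fin P'P])
  also have "(\<Sum>r\<in>P'. ?\<psi> r - ?\<psi> (left_nb P r)) = (\<Sum>r\<in>P'. ?\<psi> r - ?\<psi> (left_nb P' r))" using nb by simp
  also have "\<dots> = ?\<psi> s - ?\<psi> 0" by (rule sum_telescope[OF P'(1), of ?\<psi>])
  also have "(\<Sum>r\<in>P. ?\<psi> r - ?\<psi> (left_nb P r)) = ?\<psi> t - ?\<psi> 0" by (rule sum_telescope[OF P, of ?\<psi>])
  also have "(?\<psi> t - ?\<psi> 0) - (?\<psi> s - ?\<psi> 0) = ?\<psi> t - ?\<psi> s" by linarith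
  finally have main: "norm (quad_sum \<Lambda> M N P - quad_sum \<Lambda> M N P') \<le> k * (?\<psi> t - ?\<psi> s)" .
  have "norm (quad_sum \<Lambda> M N P - Q t) < e / 2" using d1(2)[OF P] mP by (simp add: dist_norm)
  moreover have "norm (quad_sum \<Lambda> M N P' - Q s) < e / 2" using d2(2)[OF P'] by (simp add: dist_norm)
  moreover have "norm (Q t - Q s) \<le> norm (quad_sum \<Lambda> M N P - Q t) + norm (quad_sum \<Lambda> M N P - quad_sum \<Lambda> M N P')
      + norm (quad_sum \<Lambda> M N P' - Q s)"
  proof -
    have "Q t - Q s = - (quad_sum \<Lambda> M N P - Q t) + (quad_sum \<Lambda> M N P - quad_sum \<Lambda> M N P')
      + (quad_sum \<Lambda> M N P' - Q s)" by simp
    then show ?thesis by (metis norm_minus_cancel norm_triangle_le norm_triangle_mono order_refl)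
  qed
  ultimately show "norm (Q t - Q s) \<le> k * (?\<psi> t - ?\<psi> s) + e" using main by linarith
qed

lemma quad_limit_regular:
  assumes M: "orthogonal_increments M" "continuous_on {0..} M" and N: "orthogonal_increments N" "continuous_on {0..} N"
    and lim: "\<And>t. 0 \<le> t \<Longrightarrow> (quad_sum \<Lambda> M N \<longlongrightarrow> Q t) (mesh_filter t)"
  shows "continuous_on {0..} Q" and "locally_bv Q"
proof -
  define \<psi> where "\<psi> r = (norm (M r))\<^sup>2 + (norm (N r))\<^sup>2" for r
  have inc: "norm (Q t - Q s) \<le> k * \<bar>\<psi> t - \<psi> s\<bar>"
    if k: "0 \<le> k" "\<And>r. 0 \<le> r \<Longrightarrow> r \<le> T \<Longrightarrow> norm (\<Lambda> r) \<le> k" and st: "0 \<le> s" "s \<le> T" "0 \<le> t" "t \<le> T" for k s t T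
  proof (cases "s \<le> t")
    case True
    have "norm (Q t - Q s) \<le> k * (\<psi> t - \<psi> s)"
      unfolding \<psi>_def by (rule quad_limit_increment[OF M(1) N(1) lim k(1) _ st(1) True]) (use k(2) st in auto)
    also have "\<dots> \<le> k * \<bar>\<psi> t - \<psi> s\<bar>" using k(1) by (intro mult_left_mono) auto
    finally show ?thesis .
  next
    case False
    have "norm (Q s - Q t) \<le> k * (\<psi> s - \<psi> t)"
      unfolding \<psi>_def by (rule quad_limit_increment[OF M(1) N(1) lim k(1) _ st(3)]) (use k(2) st False in auto)
    also have "\<dots> \<le> k * \<bar>\<psi> t - \<psi> s\<bar>" using k(1) by (intro mult_left_mono) auto
    finally show ?thesis by (simp add: norm_minus_commute)
  qed
  have c\<psi>: "continuous_on {0..} \<psi>" unfolding \<psi>_def by (intro continuous_intros M(2) N(2))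
  show "continuous_on {0..} Q"
    unfolding continuous_on_iff
  proof (intro ballI allI impI)
    fix t e :: real assume t: "t \<in> {0..}" and e: "0 < e"
    obtain k where k: "0 \<le> k" "\<And>r. 0 \<le> r \<Longrightarrow> r \<le> t + 1 \<Longrightarrow> norm (\<Lambda> r) \<le> k"
      using continuous_bounded_on_interval[OF cont, of "t + 1"] by blast
    have "0 < e / (k + 1)" using e k(1) by simp
    then obtain d where d: "d > 0" "\<And>s. s \<in> {0..} \<Longrightarrow> dist s t < d \<Longrightarrow> dist (\<psi> s) (\<psi> t) < e / (k + 1)"
      using c\<psi> t unfolding continuous_on_iff by blast
    have "dist (Q s) (Q t) < e" if s: "s \<in> {0..}" "dist s t < min d 1" for s
    proof -
      have "\<bar>s - t\<bar> < 1" using s(2) by (simp add: dist_real_def)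
      then have "s \<le> t + 1" by linarith
      then have "norm (Q s - Q t) \<le> k * \<bar>\<psi> s - \<psi> t\<bar>" using s(1) t by (intro inc[OF k]) auto
      also have "\<dots> \<le> (k + 1) * \<bar>\<psi> s - \<psi> t\<bar>" by (intro mult_right_mono) auto
      also have "\<dots> < e"
        using d(2)[OF s(1)] s(2) k(1) by (simp add: dist_real_def pos_less_divide_eq mult.commute)
      finally show ?thesis by (simp add: dist_norm)
    qed
    then show "\<exists>d>0. \<forall>s\<in>{0..}. dist s t < d \<longrightarrow> dist (Q s) (Q t) < e"
      using d(1) by (intro exI[of _ "min d 1"]) auto
  qed
  show "locally_bv Q"
    unfolding locally_bv_def
  proof (intro allI impI)
    fix t :: real assume t: "0 \<le> t"
    obtain k where k: "0 \<le> k" "\<And>r. 0 \<le> r \<Longrightarrow> r \<le> t \<Longrightarrow> norm (\<Lambda> r) \<le> k"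
      using continuous_bounded_on_interval[OF cont, of t] by blast
    have "(\<Sum>s\<in>P. norm (Q s - Q (left_nb P s))) \<le> k * (\<psi> t - \<psi> 0)" if P: "is_partition t P" for P
    proof -
      have "(\<Sum>s\<in>P. norm (Q s - Q (left_nb P s))) \<le> (\<Sum>s\<in>P. k * (\<psi> s - \<psi> (left_nb P s)))"
      proof (rule sum_mono)
        fix s assume "s \<in> P"
        note s = partition_rules(5,6)[OF P this]
        note l = partition_left_nb[OF P s(1)]
        show "norm (Q s - Q (left_nb P s)) \<le> k * (\<psi> s - \<psi> (left_nb P s))"
          unfolding \<psi>_def by (rule quad_limit_increment[OF M(1) N(1) lim k(1) _ l(3,2)]) (use k(2) s in auto)
      qed
      also have "\<dots> = k * (\<psi> t - \<psi> 0)" using sum_telescope[OF P, of \<psi>] by (simp add: sum_distrib_left[symmetric])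
      finally show ?thesis .
    qed
    then show "bdd_above {\<Sum>s\<in>P. norm (Q s - Q (left_nb P s)) | P. is_partition t P}"
      by (intro bdd_aboveI[of _ "k * (\<psi> t - \<psi> 0)"]) blast
  qed
qed

lemma quad_sum_decomposition:
  assumes P: "is_partition t P"
    and X: "\<And>s. 0 \<le> s \<Longrightarrow> X s = X 0 + M s + V s" and Y: "\<And>s. 0 \<le> s \<Longrightarrow> Y s = Y 0 + N s + W s"
  shows "quad_sum \<Lambda> X Y P
    = quad_sum \<Lambda> M N P + (quad_sum \<Lambda> M W P + quad_sum \<Lambda> V N P + quad_sum \<Lambda> V W P)"
  unfolding quad_sum_def sum.distrib[symmetric]
proof (rule sum.cong[OF refl])
  fix s assume "s \<in> P"
  note s = partition_rules(5)[OF P this]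
  note l = partition_left_nb(3)[OF P s]
  have "X s - X (left_nb P s) = (M s - M (left_nb P s)) + (V s - V (left_nb P s))"
    using X[OF s] X[OF l] by (metis add_diff_add add_diff_cancel_left)
  moreover have "Y s - Y (left_nb P s) = (N s - N (left_nb P s)) + (W s - W (left_nb P s))"
    using Y[OF s] Y[OF l] by (metis add_diff_add add_diff_cancel_left)
  ultimately show "\<Lambda> (left_nb P s) (X s - X (left_nb P s)) (Y s - Y (left_nb P s))
      = \<Lambda> (left_nb P s) (M s - M (left_nb P s)) (N s - N (left_nb P s))
      + (\<Lambda> (left_nb P s) (M s - M (left_nb P s)) (W s - W (left_nb P s))
      + \<Lambda> (left_nb P s) (V s - V (left_nb P s)) (N s - N (left_nb P s))
      + \<Lambda> (left_nb P s) (V s - V (left_nb P s)) (W s - W (left_nb P s)))"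
    by (simp only: blinfun.add_right blinfun.add_left) (simp add: ac_simps)
qed

lemma quadratic_covariation:
  assumes X: "martingale_part A FA EA \<iota>A X M" "adapted FA \<iota>A X"
    and Y: "martingale_part B FB EB \<iota>B Y N" "adapted FB \<iota>B Y"
    and M: "loc_unif_approximable A FA EA \<iota>A M" and N: "loc_unif_approximable B FB EB \<iota>B N"
  shows "(\<forall>t\<ge>0. quad_int \<Lambda> X Y t \<in> Lp_sub \<iota>C (FC t) \<and>
                 (quad_sum \<Lambda> X Y \<longlongrightarrow> quad_int \<Lambda> X Y t) (mesh_filter t)) \<and>
         continuous_on {0..} (quad_int \<Lambda> X Y) \<and>
         Lp_FV FC \<iota>C (quad_int \<Lambda> X Y) \<and>
         (\<forall>t\<ge>0. (quad_sum \<Lambda> M N \<longlongrightarrow> quad_int \<Lambda> M N t) (mesh_filter t) \<and>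
                 quad_int \<Lambda> X Y t = quad_int \<Lambda> M N t)"
proof -
  have mM: "Lp_martingale A FA EA \<iota>A M" and cM: "continuous_on {0..} M"
    using X(1) by (simp_all add: martingale_part_def)
  have mN: "Lp_martingale B FB EB \<iota>B N" and cN: "continuous_on {0..} N"
    using Y(1) by (simp_all add: martingale_part_def)
  obtain V where V: "locally_bv V" "continuous_on {0..} V" "\<And>t. 0 \<le> t \<Longrightarrow> X t = X 0 + M t + V t"
    using X(1) unfolding martingale_part_def Lp_FV_def by blast
  obtain W where W: "locally_bv W" "continuous_on {0..} W" "\<And>t. 0 \<le> t \<Longrightarrow> Y t = Y 0 + N t + W t"
    using Y(1) unfolding martingale_part_def Lp_FV_def by blast
  have wM: "AA.weak_martingale FA M" by (rule AA.weak_martingaleI[OF refl FA mM])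
  have wN: "BB.weak_martingale FB N" by (rule BB.weak_martingaleI[OF refl FB mN])
  have oM: "orthogonal_increments M" and oN: "orthogonal_increments N"
    by (rule weak_martingale_orthogonal_increments(1)[OF wM] weak_martingale_orthogonal_increments(2)[OF wN])+
  have both: "(quad_sum \<Lambda> M N \<longlongrightarrow> quad_int \<Lambda> M N t) (mesh_filter t)
      \<and> (quad_sum \<Lambda> X Y \<longlongrightarrow> quad_int \<Lambda> M N t) (mesh_filter t)
      \<and> quad_int \<Lambda> X Y t = quad_int \<Lambda> M N t" if t: "0 \<le> t" for t
  proof -
    have ne: "mesh_filter t \<noteq> bot" by (rule mesh_filter_nontrivial[OF t])
    obtain L where L: "(quad_sum \<Lambda> M N \<longlongrightarrow> L) (mesh_filter t)"
      by (rule mesh_filter_Cauchy_limit[OF t quad_sum_Cauchy[OF t wM M wN N]])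
    have QL: "quad_int \<Lambda> M N t = L" unfolding quad_int_def by (rule tendsto_Lim[OF ne L])
    have 1: "(quad_sum \<Lambda> M W \<longlongrightarrow> 0) (mesh_filter t)"
      by (rule quad_sum_tendsto_zero[OF cont product_increments_tendsto_zero[OF cM W(1) t]])
    have 2: "(quad_sum \<Lambda> V N \<longlongrightarrow> 0) (mesh_filter t)"
      by (rule quad_sum_tendsto_zero[OF cont])
         (use product_increments_tendsto_zero[OF cN V(1) t] in \<open>simp add: mult.commute\<close>)
    have 3: "(quad_sum \<Lambda> V W \<longlongrightarrow> 0) (mesh_filter t)"
      by (rule quad_sum_tendsto_zero[OF cont product_increments_tendsto_zero[OF V(2) W(1) t]])
    have sum: "((\<lambda>P. quad_sum \<Lambda> M N P + (quad_sum \<Lambda> M W P + quad_sum \<Lambda> V N P + quad_sum \<Lambda> V W P))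
        \<longlongrightarrow> L) (mesh_filter t)"
      using tendsto_add[OF L tendsto_add[OF tendsto_add[OF 1 2] 3]] by simp
    have decomposition: "\<forall>\<^sub>F P in mesh_filter t. quad_sum \<Lambda> M N P
        + (quad_sum \<Lambda> M W P + quad_sum \<Lambda> V N P + quad_sum \<Lambda> V W P) = quad_sum \<Lambda> X Y P"
      using eventually_partition
    proof eventually_elim
      case (elim P)
      show ?case by (rule quad_sum_decomposition[OF elim, symmetric]) (erule V(3), erule W(3))
    qed
    have XY: "(quad_sum \<Lambda> X Y \<longlongrightarrow> L) (mesh_filter t)"
      by (rule Lim_transform_eventually[OF sum decomposition])
    have "quad_int \<Lambda> X Y t = L" unfolding quad_int_def by (rule tendsto_Lim[OF ne XY])
    then show ?thesis using QL L XY by simp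
  qed
  note limM = both[THEN conjunct1] and limX = both[THEN conjunct2, THEN conjunct1]
    and eq = both[THEN conjunct2, THEN conjunct2]
  have mem: "quad_int \<Lambda> X Y t \<in> Lp_sub \<iota>C (FC t)" if t: "0 \<le> t" for t
    unfolding eq[OF t]
  proof (rule Lim_in_closed_set[OF CC.closed_Lp_sub _ mesh_filter_nontrivial[OF t] limX[OF t]])
    show "\<forall>\<^sub>F P in mesh_filter t. quad_sum \<Lambda> X Y P \<in> Lp_sub \<iota>C (FC t)"
      using eventually_partition by eventually_elim (rule quad_sum_adapted[OF _ X(2) Y(2)])
  qed
  have lim: "(quad_sum \<Lambda> M N \<longlongrightarrow> quad_int \<Lambda> X Y t) (mesh_filter t)" if "0 \<le> t" for t
    unfolding eq[OF that] by (rule limM[OF that])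
  note reg = quad_limit_regular[OF oM cM oN cN lim]
  have "Lp_FV FC \<iota>C (quad_int \<Lambda> X Y)"
    unfolding Lp_FV_def adapted_def using mem reg(2) by simp
  then show ?thesis using mem limX limM eq reg(1) by (intro conjI allI impI) simp_all
qed

end

theorem theorem1p9:
  fixes A :: "('h::chilbert_space \<Rightarrow>\<^sub>L 'h) set"
    and B :: "('k::chilbert_space \<Rightarrow>\<^sub>L 'k) set"
    and C :: "('l::chilbert_space \<Rightarrow>\<^sub>L 'l) set"
    and FA :: "real \<Rightarrow> ('h \<Rightarrow>\<^sub>L 'h) set"
    and FB :: "real \<Rightarrow> ('k \<Rightarrow>\<^sub>L 'k) set"
    and FC :: "real \<Rightarrow> ('l \<Rightarrow>\<^sub>L 'l) set"
    and EA :: "('h \<Rightarrow>\<^sub>L 'h) \<Rightarrow> complex"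
    and EB :: "('k \<Rightarrow>\<^sub>L 'k) \<Rightarrow> complex"
    and EC :: "('l \<Rightarrow>\<^sub>L 'l) \<Rightarrow> complex"
    and \<iota>A :: "('h \<Rightarrow>\<^sub>L 'h) \<Rightarrow> 'u::banach"
    and \<iota>B :: "('k \<Rightarrow>\<^sub>L 'k) \<Rightarrow> 'v::banach"
    and \<iota>C :: "('l \<Rightarrow>\<^sub>L 'l) \<Rightarrow> 'w::banach"
    and X M :: "real \<Rightarrow> 'u"
    and Y N :: "real \<Rightarrow> 'v"
    and \<Lambda> :: "real \<Rightarrow> 'u \<Rightarrow>\<^sub>L 'v \<Rightarrow>\<^sub>L 'w"
  assumes "filtered_wstar_prob_space A FA EA"
    and "filtered_wstar_prob_space B FB EB"
    and "filtered_wstar_prob_space C FC EC"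
    and "Lp_completion A EA 2 \<iota>A"
    and "Lp_completion B EB 2 \<iota>B"
    and "Lp_completion C EC 1 \<iota>C"
    and "decomposable A FA EA \<iota>A X"
    and "decomposable B FB EB \<iota>B Y"
    and "martingale_part A FA EA \<iota>A X M"
    and "martingale_part B FB EB \<iota>B Y N"
    and "adapted_bilinear A FA EA \<iota>A B FB EB \<iota>B C FC EC \<iota>C \<Lambda>"
    and "continuous_on {0..} \<Lambda>"
    and "\<forall>t\<ge>0. (\<forall>x\<in>A. \<forall>y\<in>B. \<Lambda> t (\<iota>A x) (\<iota>B y) \<in> \<iota>C ` C) \<and>
           bdd_above {nc_norm EC r c | p q r x y c.
             1 \<le> p \<and> 1 \<le> q \<and> 1 \<le> r \<and> 1 / p + 1 / q = 1 / r \<and>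
             x \<in> A \<and> nc_norm EA p x \<le> 1 \<and> y \<in> B \<and> nc_norm EB q y \<le> 1 \<and>
             c \<in> C \<and> \<iota>C c = \<Lambda> t (\<iota>A x) (\<iota>B y)}"
    and "loc_unif_approximable A FA EA \<iota>A M"
    and "loc_unif_approximable B FB EB \<iota>B N"
  shows "(\<forall>t\<ge>0. quad_int \<Lambda> X Y t \<in> Lp_sub \<iota>C (FC t) \<and>
                 (quad_sum \<Lambda> X Y \<longlongrightarrow> quad_int \<Lambda> X Y t) (mesh_filter t)) \<and>
         continuous_on {0..} (quad_int \<Lambda> X Y) \<and>
         Lp_FV FC \<iota>C (quad_int \<Lambda> X Y) \<and>
         (\<forall>t\<ge>0. (quad_sum \<Lambda> M N \<longlongrightarrow> quad_int \<Lambda> M N t) (mesh_filter t) \<and>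
                 quad_int \<Lambda> X Y t = quad_int \<Lambda> M N t)"
proof -
  have "covariation A EA \<iota>A B EB \<iota>B C EC \<iota>C FA FB FC \<Lambda>"
  proof (intro covariation.intro wstar_completion.intro wstar_space.intro
      wstar_completion_axioms.intro covariation_axioms.intro)
    show "wstar_prob_space A EA" "filtration A FA" using assms(1) by (simp_all add: filtered_wstar_prob_space_def)
    show "wstar_prob_space B EB" "filtration B FB" using assms(2) by (simp_all add: filtered_wstar_prob_space_def)
    show "wstar_prob_space C EC" "filtration C FC" using assms(3) by (simp_all add: filtered_wstar_prob_space_def)
    fix t :: real assume t: "0 \<le> t"
    note c = assms(13)[rule_format, OF t]
    show "\<Lambda> t (\<iota>A x) (\<iota>B y) \<in> \<iota>C ` C" if "x \<in> A" "y \<in> B" for x y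
      using c[THEN conjunct1] that by blast
    show "bdd_above {nc_norm EC r c | p q r x y c.
             1 \<le> p \<and> 1 \<le> q \<and> 1 \<le> r \<and> 1 / p + 1 / q = 1 / r \<and>
             x \<in> A \<and> nc_norm EA p x \<le> 1 \<and> y \<in> B \<and> nc_norm EB q y \<le> 1 \<and>
             c \<in> C \<and> \<iota>C c = \<Lambda> t (\<iota>A x) (\<iota>B y)}" by (rule c[THEN conjunct2])
  qed (rule assms(4,5,6,11,12) disjI1 disjI2 refl)+
  then show ?thesis
  proof (rule covariation.quadratic_covariation)
    show "adapted FA \<iota>A X" "adapted FB \<iota>B Y" using assms(7,8) by (simp_all add: decomposable_def)
  qed (rule assms(9,10,14,15))+
qed

end
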